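(* Let $a,p,r,k,\lambda,\mu$ be integers with $a>1$, $p\geq 1$, $r\geq 1$, $k\geq 1$, $\lambda\geq 0$, $\mu\geq 1$, $\lambda\neq\mu$, and suppose $$r\;\geq\;\frac{\lambda(a-1)+\mu a(p-1)}{\mu a(a-1)}.$$ Let $G=K(a^{(p)};\lambda,\mu)$, let a $k$-edge-coloring of $G$ be given, and let $\omega_j=\omega(G(j))$ for $1\leq j\leq k$. Then the $k$-edge-coloring of $G$ can be embedded into a Hamiltonian decomposition of $K(a^{(p+r)};\lambda,\mu)$ if and only if all of the following hold: (i) $k=\big(\lambda(a-1)+\mu a(p+r-1)\big)/2$; (ii) $\lambda\leq\mu a(p+r-1)$; (iii) every component of $G(j)$ is a path (possibly of length $0$) for $1\leq j\leq k$; and (iv) $\omega_j\leq ar$ for $1\leq j\leq k$.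
   Context: $K(a^{(p)};\lambda,\mu)$ denotes the loopless multigraph whose vertex set is partitioned into $p$ parts, each of size $a$, in which every two distinct vertices in the same part are joined by exactly $\lambda$ edges and every two vertices in different parts are joined by exactly $\mu$ edges. $K(a^{(p)};\lambda,\mu)$ is regarded as the subgraph of $K(a^{(p+r)};\lambda,\mu)$ induced by the vertices of $p$ of its $p+r$ parts. A $k$-edge-coloring of a graph $G$ is a map $E(G)\to\{1,\dots,k\}$ (no properness is required; it need not be surjective). $G(j)$ is the spanning subgraph of $G$ with vertex set $V(G)$ and edge set the edges colored $j$ (so vertices incident with no edge of color $j$ are components of $G(j)$, i.e. paths of length $0$). $\omega(H)$ denotes the number of connected components of a graph $H$. A Hamiltonian decomposition of a graph is a partition of its edge set into edge sets of Hamiltonian cycles. A $k$-edge-coloring of $G$ is embedded into a Hamiltonian decomposition of a supergraph $G^*$ if it extends to a $k$-edge-coloring of $G^*$ (edges of $G$ keep their colors) in which each of the $k$ color classes is a Hamiltonian cycle of $G^*$. *)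

theory Defs
  imports Complex_Main "HOL-Library.FuncSet"
begin

text \<open>Undirected multigraphs: every edge has an identity of its own, and \<open>ends\<close> gives the set
  of its end vertices.\<close>

record ('v, 'e) mgraph =
  verts :: "'v set"
  edges :: "'e set"
  ends :: "'e \<Rightarrow> 'v set"

definition loopless_mgraph :: "('v, 'e) mgraph \<Rightarrow> bool" where
  "loopless_mgraph G \<longleftrightarrow> (\<forall>e\<in>edges G. ends G e \<subseteq> verts G \<and> card (ends G e) = 2)"

definition subgraph :: "('v, 'e) mgraph \<Rightarrow> ('v, 'e) mgraph \<Rightarrow> bool" where
  "subgraph H G \<longleftrightarrow>
     verts H \<subseteq> verts G \<and> edges H \<subseteq> edges G \<and> (\<forall>e\<in>edges H. ends H e = ends G e)"

definition induced_subgraph :: "('v, 'e) mgraph \<Rightarrow> 'v set \<Rightarrow> ('v, 'e) mgraph" where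
  "induced_subgraph G W = G\<lparr>verts := W, edges := {e \<in> edges G. ends G e \<subseteq> W}\<rparr>"

definition adjacency :: "('v, 'e) mgraph \<Rightarrow> ('v \<times> 'v) set" where
  "adjacency G = {(u, v). u \<in> verts G \<and> v \<in> verts G \<and> (\<exists>e\<in>edges G. ends G e = {u, v})}"

definition components :: "('v, 'e) mgraph \<Rightarrow> ('v, 'e) mgraph set" where
  "components G = (\<lambda>u. induced_subgraph G ((adjacency G)\<^sup>* `` {u})) ` verts G"

definition num_components :: "('v, 'e) mgraph \<Rightarrow> nat" where
  "num_components G = card (components G)"

definition is_path :: "('v, 'e) mgraph \<Rightarrow> bool" where
  "is_path P \<longleftrightarrow> (\<exists>vs es. distinct vs \<and> set vs = verts P \<and> distinct es \<and> set es = edges P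
      \<and> length vs = Suc (length es)
      \<and> (\<forall>i<length es. ends P (es ! i) = {vs ! i, vs ! Suc i}))"

text \<open>As usual for multigraphs, two parallel edges form a cycle of length 2.\<close>

definition is_cycle :: "('v, 'e) mgraph \<Rightarrow> bool" where
  "is_cycle C \<longleftrightarrow> (\<exists>vs es. distinct vs \<and> set vs = verts C \<and> distinct es \<and> set es = edges C
      \<and> length vs = length es \<and> length es \<ge> 2
      \<and> (\<forall>i<length es. ends C (es ! i) = {vs ! i, vs ! (Suc i mod length es)}))"

definition hamiltonian_cycle :: "('v, 'e) mgraph \<Rightarrow> ('v, 'e) mgraph \<Rightarrow> bool" where
  "hamiltonian_cycle C G \<longleftrightarrow> subgraph C G \<and> verts C = verts G \<and> is_cycle C"

definition edge_coloring :: "nat \<Rightarrow> ('v, 'e) mgraph \<Rightarrow> ('e \<Rightarrow> nat) \<Rightarrow> bool" where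
  "edge_coloring k G c \<longleftrightarrow> c \<in> edges G \<rightarrow> {1..k}"

definition color_subgraph :: "('v, 'e) mgraph \<Rightarrow> ('e \<Rightarrow> nat) \<Rightarrow> nat \<Rightarrow> ('v, 'e) mgraph" where
  "color_subgraph G c j = G\<lparr>edges := {e \<in> edges G. c e = j}\<rparr>"

definition embeds_in_hamiltonian_decomposition ::
  "nat \<Rightarrow> ('v, 'e) mgraph \<Rightarrow> ('e \<Rightarrow> nat) \<Rightarrow> ('v, 'e) mgraph \<Rightarrow> bool" where
  "embeds_in_hamiltonian_decomposition k G c H \<longleftrightarrow>
     (\<exists>c'. edge_coloring k H c' \<and> (\<forall>e\<in>edges G. c' e = c e)
        \<and> (\<forall>j\<in>{1..k}. hamiltonian_cycle (color_subgraph H c' j) H))"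

text \<open>\<open>multi_K a p l m\<close> is $K(a^{(p)};\lambda,\mu)$ with $\lambda = l$, $\mu = m$. The vertex
  \<open>(s, x)\<close> is the \<open>x\<close>-th vertex of part \<open>s\<close>; the edge \<open>({u, v}, i)\<close> is the \<open>i\<close>-th of the parallel
  edges joining \<open>u\<close> and \<open>v\<close>.\<close>

definition multi_K ::
  "nat \<Rightarrow> nat \<Rightarrow> nat \<Rightarrow> nat \<Rightarrow> (nat \<times> nat, (nat \<times> nat) set \<times> nat) mgraph" where
  "multi_K a p l m =
     \<lparr>verts = {..<p} \<times> {..<a},
      edges = {({u, v}, i) | u v i. u \<in> {..<p} \<times> {..<a} \<and> v \<in> {..<p} \<times> {..<a} \<and> u \<noteq> v
                 \<and> i < (if fst u = fst v then l else m)},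
      ends = fst\<rparr>"

lemma loopless_multi_K: "loopless_mgraph (multi_K a p l m)"
  unfolding loopless_mgraph_def
proof
  fix e assume "e \<in> edges (multi_K a p l m)"
  then obtain u v i where "e = ({u, v}, i)" "u \<in> {..<p} \<times> {..<a}" "v \<in> {..<p} \<times> {..<a}" "u \<noteq> v"
    unfolding multi_K_def mgraph.simps mem_Collect_eq by blast
  then show "ends (multi_K a p l m) e \<subseteq> verts (multi_K a p l m) \<and> card (ends (multi_K a p l m) e) = 2"
    unfolding multi_K_def mgraph.simps by simp
qed

lemma multi_K_edge_iff:
  assumes "u \<noteq> v"
  shows "({u, v}, i) \<in> edges (multi_K a p l m) \<longleftrightarrow>
    u \<in> {..<p} \<times> {..<a} \<and> v \<in> {..<p} \<times> {..<a} \<and> i < (if fst u = fst v then l else m)"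
    (is "?L \<longleftrightarrow> ?R")
proof
  assume ?L
  then obtain u' v' where uv: "{u, v} = {u', v'}" "u' \<in> {..<p} \<times> {..<a}" "v' \<in> {..<p} \<times> {..<a}"
      "i < (if fst u' = fst v' then l else m)"
    unfolding multi_K_def mgraph.simps mem_Collect_eq prod.inject by blast
  from uv(1) have "u = u' \<and> v = v' \<or> u = v' \<and> v = u'" by (simp only: doubleton_eq_iff)
  then show ?R
  proof
    assume "u = u' \<and> v = v'"
    then show ?R using uv(2-4) by simp
  next
    assume "u = v' \<and> v = u'"
    then show ?R using uv(2-4) by (simp add: eq_commute)
  qed
next
  assume ?R
  with assms show ?L unfolding multi_K_def mgraph.simps mem_Collect_eq by blast
qed

lemma multi_K_multiplicity:
  assumes "u \<in> verts (multi_K a p l m)" "v \<in> verts (multi_K a p l m)" "u \<noteq> v"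
  shows "card {e \<in> edges (multi_K a p l m). ends (multi_K a p l m) e = {u, v}} =
           (if fst u = fst v then l else m)" (is "card ?E = ?n")
proof -
  have ends: "ends (multi_K a p l m) = fst" unfolding multi_K_def mgraph.simps ..
  have "e \<in> ?E \<longleftrightarrow> e \<in> Pair {u, v} ` {..<?n}" for e
  proof (cases e)
    case (Pair w i)
    show ?thesis
    proof (cases "w = {u, v}")
      case True
      have uv: "u \<in> {..<p} \<times> {..<a}" "v \<in> {..<p} \<times> {..<a}"
        using assms(1,2) unfolding multi_K_def mgraph.simps .
      have "e \<in> ?E \<longleftrightarrow> i < ?n"
        unfolding Pair True mem_Collect_eq ends fst_conv multi_K_edge_iff[OF assms(3)]
        using uv by simp
      then show ?thesis unfolding Pair True by blast
    next
      case False
      then show ?thesis unfolding Pair mem_Collect_eq ends fst_conv by blast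
    qed
  qed
  then have "?E = Pair {u, v} ` {..<?n}" by (rule set_eqI)
  then show ?thesis by (simp add: card_image inj_on_def)
qed

lemma multi_K_induced_subgraph:
  "induced_subgraph (multi_K a (p + r) l m) (verts (multi_K a p l m)) = multi_K a p l m"
proof -
  let ?V = "{..<p} \<times> {..<a}"
  let ?W = "{..<p + r} \<times> {..<a}"
  have V: "verts (multi_K a p l m) = ?V" unfolding multi_K_def mgraph.simps ..
  have ends: "ends (multi_K a q l m) = fst" for q unfolding multi_K_def mgraph.simps ..
  have sub: "?V \<subseteq> ?W" by auto
  have edges: "{e \<in> edges (multi_K a (p + r) l m). fst e \<subseteq> ?V} = edges (multi_K a p l m)"
  proof (rule set_eqI)
    fix e :: "(nat \<times> nat) set \<times> nat"
    show "e \<in> {e \<in> edges (multi_K a (p + r) l m). fst e \<subseteq> ?V} \<longleftrightarrow> e \<in> edges (multi_K a p l m)"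
    proof (cases "\<exists>u v i. u \<noteq> v \<and> e = ({u, v}, i)")
      case True
      then obtain u v i where uv: "u \<noteq> v" and e: "e = ({u, v}, i)" by blast
      show ?thesis
        unfolding e mem_Collect_eq fst_conv multi_K_edge_iff[OF uv] using sub by blast
    next
      case False
      then have "e \<notin> edges (multi_K a q l m)" for q
        unfolding multi_K_def mgraph.simps mem_Collect_eq by blast
      then show ?thesis by blast
    qed
  qed
  show ?thesis
    unfolding induced_subgraph_def V ends edges unfolding multi_K_def mgraph.simps ..
qed

end

theory Submission
  imports Defs
begin

text \<open>
  Necessity: two neighbouring edges of each colour at a vertex give \<open>2 * k\<close> as the degree of
  $K(a^{(p+r)};\lambda,\mu)$, and a Hamiltonian cycle restricted to a proper subset \<open>W\<close> of the
  vertices is a disjoint union of paths, at most as many as there are vertices outside \<open>W\<close>. For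
  \<open>W\<close> the \<open>p\<close> old parts this gives (iii) and (iv); for \<open>W\<close> a single part it bounds the number of
  edges of each colour inside a part by \<open>a - 1\<close>, which gives (ii).

  Sufficiency is by amalgamation and detachment. All \<open>a * r\<close> new vertices are first merged into one
  vertex \<open>u\<close>, to which every old vertex sends as many edges of each colour as it lacks to have degree
  2 in that colour; every colour class is then connected. Next \<open>u\<close> is split into \<open>r\<close> vertices,
  one for each new part, then each of these into \<open>a\<close> vertices, sharing out the edges evenly and keeping
  the colour classes connected. In the end every colour class is connected and 2-regular. A single
  splitting step rounds a fractional solution with the right degrees to an integral one. The
  hypothesis on \<open>r\<close> says \<open>2 * k \<le> \<mu> * a^2 * r\<close>, and allows one to give all new parts the same
  number of inner edges of each colour.
\<close>

section \<open>Integral rounding of flows and matrices\<close>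

text \<open>The obstacle is connectedness; degrees and multiplicities alone would be an ordinary
  rounding problem. Parity overcomes it. All degrees in all colours stay even, so a component of a
  colour without the vertex being split sends an even number \<open>s > 0\<close> of edges to that
  vertex; a share \<open>s / n\<close> with \<open>n \<ge> 2\<close>, even rounded up, is at most
  \<open>s / 2\<close>, and some edge stays. These component bounds refine the row sums colour by
  colour, so they fit into one flow network together with row and column sums. Two rounds of
  splitting are needed because one round gives all pairs of pieces the same multiplicity and cannot
  tell \<open>l\<close> from \<open>m\<close>. In the first round the loops at \<open>u\<close> are
  only the edges that will run between different new parts; inner edges of the parts are inserted as
  loops before the second round. Splitting shares degrees equally, whence the equal number of inner
  edges per part. The price is rounding \<open>\<omega> j / r\<close> up to an integer in each
  colour, and the bound on \<open>r\<close> pays for it.\<close>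

lemma homogeneous_system_nontrivial_solution:
  fixes A :: "'i \<Rightarrow> 's \<Rightarrow> real"
  assumes "finite I" "finite S" "card I < card S"
  shows "\<exists>h. (\<exists>s\<in>S. h s \<noteq> 0) \<and> (\<forall>i\<in>I. (\<Sum>s\<in>S. A i s * h s) = 0)"
  using assms
proof (induction I arbitrary: S A rule: finite_induct)
  case empty
  then have "S \<noteq> {}" by auto
  then show ?case by (intro exI[of _ "\<lambda>_. 1"]) auto
next
  case (insert i I)
  show ?case
  proof (cases "\<forall>s\<in>S. A i s = 0")
    case True
    have "card I < card S" using insert by simp
    from insert.IH[OF insert.prems(1) this, of A] obtain h
      where "\<exists>s\<in>S. h s \<noteq> 0" "\<forall>i\<in>I. (\<Sum>s\<in>S. A i s * h s) = 0" by blast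
    then show ?thesis using True by (intro exI[of _ h]) auto
  next
    case False
    then obtain s0 where s0: "s0 \<in> S" "A i s0 \<noteq> 0" by blast
    \<comment> \<open>Gaussian elimination: equation \<open>i\<close> is solved for
      \<open>h s0\<close>, with value \<open>c\<close> below, and substituted into the others, which
      leaves one equation and one unknown fewer.\<close>
    define T where "T = S - {s0}"
    have T: "finite T" "card I < card T" "s0 \<notin> T" "S = insert s0 T"
      using insert s0 by (auto simp: T_def)
    from insert.IH[OF T(1,2), of "\<lambda>i' s. A i' s - A i' s0 * A i s / A i s0"] obtain h
      where h: "\<exists>s\<in>T. h s \<noteq> 0"
        "\<forall>i'\<in>I. (\<Sum>s\<in>T. (A i' s - A i' s0 * A i s / A i s0) * h s) = 0" by blast
    define c where "c = - (\<Sum>s\<in>T. A i s * h s) / A i s0"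
    have sum: "(\<Sum>s\<in>S. A i' s * (h(s0 := c)) s) = A i' s0 * c + (\<Sum>s\<in>T. A i' s * h s)" for i'
    proof -
      have "(\<Sum>s\<in>T. A i' s * (h(s0 := c)) s) = (\<Sum>s\<in>T. A i' s * h s)"
        using T(3) by (intro sum.cong) auto
      then show ?thesis using T by simp
    qed
    have "(\<Sum>s\<in>S. A i' s * (h(s0 := c)) s) = 0" if "i' \<in> I" for i'
    proof -
      have "(\<Sum>s\<in>T. (A i' s - A i' s0 * A i s / A i s0) * h s) =
        (\<Sum>s\<in>T. A i' s * h s) - A i' s0 / A i s0 * (\<Sum>s\<in>T. A i s * h s)"
        by (simp add: algebra_simps sum_subtractf sum_distrib_left)
      with h(2) that have "(\<Sum>s\<in>T. A i' s * h s) = A i' s0 / A i s0 * (\<Sum>s\<in>T. A i s * h s)"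
        by simp
      then show ?thesis unfolding sum unfolding c_def using s0 by simp
    qed
    moreover have "(\<Sum>s\<in>S. A i s * (h(s0 := c)) s) = 0"
      unfolding sum unfolding c_def using s0 by simp
    moreover have "\<exists>s\<in>S. (h(s0 := c)) s \<noteq> 0" using h(1) T by fastforce
    ultimately show ?thesis by (intro exI[of _ "h(s0 := c)"]) simp
  qed
qed

text \<open>Signed incidence matrix of a digraph. Summed over the edges against \<open>f\<close> it
  gives the net outflow of \<open>f\<close> at \<open>v\<close>.\<close>

definition incidence :: "('e \<Rightarrow> 'n) \<Rightarrow> ('e \<Rightarrow> 'n) \<Rightarrow> 'n \<Rightarrow> 'e \<Rightarrow> real" where
  "incidence tail head v e = of_bool (tail e = v) - of_bool (head e = v)"

text \<open>As every vertex is incident with no edge or at least two, there are at least as many edges as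
  conservation laws, and these laws are linearly dependent.\<close>

lemma incidence_circulation_exists:
  assumes S: "finite S" "S \<noteq> {}"
    and ne: "\<And>e. e \<in> S \<Longrightarrow> tail e \<noteq> head e"
    and two: "\<And>v e. e \<in> S \<Longrightarrow> incidence tail head v e \<noteq> 0 \<Longrightarrow>
      \<exists>e'\<in>S. e' \<noteq> e \<and> incidence tail head v e' \<noteq> 0"
  shows "\<exists>q. (\<exists>e\<in>S. q e \<noteq> 0) \<and> (\<forall>v. (\<Sum>e\<in>S. incidence tail head v e * q e) = 0)"
proof -
  let ?D = "incidence tail head"
  define N where "N = tail ` S \<union> head ` S"
  have fN: "finite N" using S by (simp add: N_def)
  have deg: "2 \<le> card {e\<in>S. ?D v e \<noteq> 0}" if v: "v \<in> N" for v
  proof -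
    obtain e where e: "e \<in> S" "?D v e \<noteq> 0"
      using v ne by (force simp: N_def incidence_def)
    from two[OF e] obtain e' where e': "e' \<in> S" "e' \<noteq> e" "?D v e' \<noteq> 0" by blast
    have "card {e, e'} \<le> card {e\<in>S. ?D v e \<noteq> 0}"
      using e e' S by (intro card_mono) auto
    then show ?thesis using e' by simp
  qed
  \<comment> \<open>Double counting of incidences: at least two at every vertex of \<open>N\<close>,
    exactly two at every edge.\<close>
  have "2 * card N = (\<Sum>v\<in>N. 2)" by simp
  also have "\<dots> \<le> (\<Sum>v\<in>N. card {e\<in>S. ?D v e \<noteq> 0})" using deg by (intro sum_mono) auto
  also have "\<dots> = (\<Sum>v\<in>N. \<Sum>e\<in>S. of_bool (?D v e \<noteq> 0))"
    using S by (simp add: sum.If_cases Int_def)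
  also have "\<dots> = (\<Sum>e\<in>S. \<Sum>v\<in>N. of_bool (?D v e \<noteq> 0))" by (rule sum.swap)
  also have "\<dots> = (\<Sum>e\<in>S. 2)"
  proof (rule sum.cong)
    fix e assume e: "e \<in> S"
    have "(\<Sum>v\<in>N. of_bool (?D v e \<noteq> 0)) = card {v\<in>N. ?D v e \<noteq> 0}"
      using fN by (simp add: sum.If_cases Int_def)
    also have "{v\<in>N. ?D v e \<noteq> 0} = {tail e, head e}"
      using e ne[OF e] by (auto simp: N_def incidence_def of_bool_def)
    finally show "(\<Sum>v\<in>N. of_bool (?D v e \<noteq> 0)) = (2::nat)" using ne[OF e] by simp
  qed simp
  finally have card: "card N \<le> card S" by simp
  obtain v0 where v0: "v0 \<in> N" using S by (auto simp: N_def)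
  \<comment> \<open>The laws at the vertices of \<open>N\<close> add up to 0, so the one at
    \<open>v0\<close> follows from the others; omitting it leaves fewer equations than
    unknowns.\<close>
  have "card (N - {v0}) < card S" 
    using card v0 fN by (metis card_Diff1_less less_le_trans)
  from homogeneous_system_nontrivial_solution[OF _ S(1) this, of ?D] fN
  obtain q where q: "\<exists>e\<in>S. q e \<noteq> 0" "\<forall>v\<in>N - {v0}. (\<Sum>e\<in>S. ?D v e * q e) = 0" by auto
  have "(\<Sum>v\<in>N. ?D v e) = 0" if "e \<in> S" for e
    using that fN by (simp add: incidence_def sum_subtractf sum.delta' N_def of_bool_def)
  then have "0 = (\<Sum>e\<in>S. (\<Sum>v\<in>N. ?D v e) * q e)" by simp
  also have "\<dots> = (\<Sum>v\<in>N. \<Sum>e\<in>S. ?D v e * q e)"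
    by (subst sum.swap) (simp add: sum_distrib_right)
  also have "\<dots> = (\<Sum>e\<in>S. ?D v0 e * q e) + (\<Sum>v\<in>N - {v0}. \<Sum>e\<in>S. ?D v e * q e)"
    using v0 fN by (simp add: sum.remove)
  finally have "(\<Sum>e\<in>S. ?D v0 e * q e) = 0" using q(2) by simp
  moreover have "(\<Sum>e\<in>S. ?D v e * q e) = 0" if "v \<notin> N" for v
  proof (rule sum.neutral, rule ballI)
    fix e assume "e \<in> S"
    then have "tail e \<noteq> v" "head e \<noteq> v" using that by (auto simp: N_def)
    then show "?D v e * q e = 0" by (simp add: incidence_def)
  qed
  ultimately show ?thesis using q by (intro exI[of _ q]) blast
qed

text \<open>Integral net outflow forbids a vertex with just one fractional edge, so the fractional
  edges carry a nonzero circulation. Moving along it as far as floors and ceilings allow makes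
  another edge integral; the induction is on the number of fractional edges.\<close>

lemma flow_rounding:
  fixes f :: "'e \<Rightarrow> real" and tail head :: "'e \<Rightarrow> 'n"
  assumes E: "finite E" and ne: "\<And>e. e \<in> E \<Longrightarrow> tail e \<noteq> head e"
    and ex: "\<And>v. (\<Sum>e\<in>E. incidence tail head v e * f e) \<in> \<int>"
  shows "\<exists>g. (\<forall>e\<in>E. g e \<in> \<int> \<and> of_int \<lfloor>f e\<rfloor> \<le> g e \<and> g e \<le> of_int \<lceil>f e\<rceil>) \<and>
    (\<forall>v. (\<Sum>e\<in>E. incidence tail head v e * g e) = (\<Sum>e\<in>E. incidence tail head v e * f e))"
  using ex
proof (induction "card {e\<in>E. f e \<notin> \<int>}" arbitrary: f rule: less_induct)
  case less
  let ?D = "incidence tail head"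
  define S where "S = {e\<in>E. f e \<notin> \<int>}"
  have fS: "finite S" and SE: "S \<subseteq> E" using E by (auto simp: S_def)
  show ?case
  proof (cases "S = {}")
    case True
    then show ?thesis by (intro exI[of _ f]) (auto simp: S_def)
  next
    case False
    have Dint: "?D v e \<in> \<int>" for v e by (auto simp: incidence_def of_bool_def)
    have two: "\<exists>e'\<in>S. e' \<noteq> e \<and> ?D v e' \<noteq> 0" if e: "e \<in> S" "?D v e \<noteq> 0" for v e
    proof (rule ccontr)
      assume no: "\<not> ?thesis"
      have "?D v e' * f e' \<in> \<int>" if "e' \<in> E - {e}" for e'
        using that no Dint[of v e'] by (cases "e' \<in> S") (auto simp: S_def)
      then have "(\<Sum>e'\<in>E - {e}. ?D v e' * f e') \<in> \<int>" by (rule Ints_sum)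
      moreover have "(\<Sum>e'\<in>E. ?D v e' * f e') = ?D v e * f e + (\<Sum>e'\<in>E - {e}. ?D v e' * f e')"
        using e SE E by (intro sum.remove) auto
      ultimately have "?D v e * f e \<in> \<int>"
        using less.prems[of v] by (metis Ints_diff add_diff_cancel_right')
      moreover have "?D v e = 1 \<or> ?D v e = - 1" using e(2) by (auto simp: incidence_def of_bool_def split: if_splits)
      ultimately have "f e \<in> \<int>" by (auto simp: minus_in_Ints_iff)
      then show False using e by (simp add: S_def)
    qed
    from incidence_circulation_exists[OF fS False ne two] SE
    obtain q where q: "\<exists>e\<in>S. q e \<noteq> 0" "\<And>v. (\<Sum>e\<in>S. ?D v e * q e) = 0" by blast
    define Q where "Q = {e\<in>S. q e \<noteq> 0}"
    \<comment> \<open>\<open>\<tau> e\<close> is the step length along \<open>q\<close> at which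
      edge \<open>e\<close> reaches the floor or ceiling it moves towards. The minimum
      \<open>s\<close> keeps all edges within bounds and makes the minimiser integral.\<close>
    define \<tau> where "\<tau> e = (if q e > 0 then (of_int \<lceil>f e\<rceil> - f e) / q e else (of_int \<lfloor>f e\<rfloor> - f e) / q e)" for e
    define s where "s = Min (\<tau> ` Q)"
    have Q: "finite Q" "Q \<noteq> {}" using fS q by (auto simp: Q_def)
    have \<tau>pos: "\<tau> e > 0" if "e \<in> Q" for e
    proof -
      have "f e \<notin> \<int>" "q e \<noteq> 0" using that by (auto simp: Q_def S_def)
      then have "of_int \<lceil>f e\<rceil> \<noteq> f e" "of_int \<lfloor>f e\<rfloor> \<noteq> f e" by (metis Ints_of_int)+
      then have "f e < of_int \<lceil>f e\<rceil>" "of_int \<lfloor>f e\<rfloor> < f e"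
        by (simp_all add: order_less_le) 
      then show ?thesis using \<open>q e \<noteq> 0\<close>
        by (auto simp: \<tau>_def divide_neg_neg)
    qed
    have s0: "s > 0" using \<tau>pos Q by (simp add: s_def)
    have s_le: "s \<le> \<tau> e" if "e \<in> Q" for e using that Q by (simp add: s_def)
    obtain e0 where e0: "e0 \<in> Q" "s = \<tau> e0"
    proof -
      have "s \<in> \<tau> ` Q" unfolding s_def by (rule Min_in) (use Q in auto)
      then show thesis using that by blast
    qed
    define f' where "f' e = (if e \<in> Q then f e + s * q e else f e)" for e
    have bd: "of_int \<lfloor>f e\<rfloor> \<le> f' e \<and> f' e \<le> of_int \<lceil>f e\<rceil>" for e
    proof (cases "e \<in> Q")
      case True
      show ?thesis
      proof (cases "q e > 0")
        case pos: True
        have "s * q e \<le> of_int \<lceil>f e\<rceil> - f e"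
          using s_le[OF True] pos by (simp add: \<tau>_def field_simps)
        moreover have "s * q e \<ge> 0" using s0 pos by simp
        moreover have "f' e = f e + s * q e" using True by (simp add: f'_def)
        ultimately show ?thesis by linarith
      next
        case neg: False
        then have neg: "q e < 0" using True by (simp add: Q_def)
        have "of_int \<lfloor>f e\<rfloor> - f e \<le> s * q e"
          using s_le[OF True] neg by (simp add: \<tau>_def field_simps)
        moreover have "s * q e \<le> 0" using s0 neg by (simp add: mult_nonneg_nonpos)
        moreover have "f' e = f e + s * q e" using True by (simp add: f'_def)
        ultimately show ?thesis by linarith
      qed
    qed (simp add: f'_def)
    have exc: "(\<Sum>e\<in>E. ?D v e * f' e) = (\<Sum>e\<in>E. ?D v e * f e)" for v
    proof -
      have "(\<Sum>e\<in>E. ?D v e * f' e) = (\<Sum>e\<in>E. ?D v e * f e + s * (if e \<in> S then ?D v e * q e else 0))"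
        by (rule sum.cong) (auto simp: f'_def Q_def algebra_simps)
      also have "\<dots> = (\<Sum>e\<in>E. ?D v e * f e) + s * (\<Sum>e\<in>E. if e \<in> S then ?D v e * q e else 0)"
        by (simp add: sum.distrib sum_distrib_left)
      also have "(\<Sum>e\<in>E. if e \<in> S then ?D v e * q e else 0) = (\<Sum>e\<in>S. ?D v e * q e)"
        using E SE by (simp add: sum.inter_restrict[symmetric] Int_absorb1)
      finally show ?thesis using q(2) by simp
    qed
    have "f' e0 \<in> \<int>"
      using e0 by (auto simp: f'_def \<tau>_def Q_def)
    moreover have "f' e \<in> \<int>" if "e \<in> E" "f e \<in> \<int>" for e
      using that by (auto simp: f'_def Q_def S_def)
    ultimately have "{e\<in>E. f' e \<notin> \<int>} \<subset> {e\<in>E. f e \<notin> \<int>}"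
      using e0 by (auto simp: Q_def S_def)
    then have less_card: "card {e\<in>E. f' e \<notin> \<int>} < card {e\<in>E. f e \<notin> \<int>}"
      using E by (intro psubset_card_mono) auto
    have "(\<Sum>e\<in>E. ?D v e * f' e) \<in> \<int>" for v using less.prems exc by simp
    from less.hyps[OF less_card this] obtain g where g: "\<forall>e\<in>E. g e \<in> \<int> \<and> of_int \<lfloor>f' e\<rfloor> \<le> g e \<and> g e \<le> of_int \<lceil>f' e\<rceil>"
       "\<forall>v. (\<Sum>e\<in>E. ?D v e * g e) = (\<Sum>e\<in>E. ?D v e * f' e)"
      by blast
    have "of_int \<lfloor>f e\<rfloor> \<le> g e \<and> g e \<le> of_int \<lceil>f e\<rceil>" if "e \<in> E" for e
    proof -
      \<comment> \<open>\<open>f' e\<close> lies between the integers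
        \<open>\<lfloor>f e\<rfloor>\<close> and \<open>\<lceil>f e\<rceil>\<close>, so rounding it
        later does not leave the interval allowed for \<open>f e\<close>.\<close>
      have "\<lfloor>f e\<rfloor> \<le> \<lfloor>f' e\<rfloor>" "\<lceil>f' e\<rceil> \<le> \<lceil>f e\<rceil>"
        using bd[of e] by (auto simp: le_floor_iff ceiling_le_iff)
      then have "(of_int \<lfloor>f e\<rfloor> :: real) \<le> of_int \<lfloor>f' e\<rfloor>" "(of_int \<lceil>f' e\<rceil> :: real) \<le> of_int \<lceil>f e\<rceil>"
        by simp_all
      then show ?thesis using g(1) that by force
    qed
    then show ?thesis using g exc by (intro exI[of _ g]) simp
  qed
qed

text \<open>Flow runs from rows through blocks to columns. A block node carries its row index
  because the partition of the columns into blocks depends on \<open>j\<close>.\<close>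

datatype ('j, 'b, 'x) flow_node = Row 'j | Block 'j 'b | Col 'x

text \<open>For each \<open>j\<close> the blocks partition the row, so block sums are nested in row
  sums, and together with the column sums they are flow values in a layered network. The arc from
  \<open>Row j\<close> to \<open>Block j b\<close> carries the block sum; rounding on that arc gives
  the last bound.\<close>

lemma matrix_rounding:
  fixes z :: "'j \<Rightarrow> 'x \<Rightarrow> real" and blk :: "'j \<Rightarrow> 'x \<Rightarrow> 'b"
  assumes J: "finite J" and X: "finite X"
    and row: "\<And>j. j \<in> J \<Longrightarrow> (\<Sum>x\<in>X. z j x) \<in> \<int>"
    and col: "\<And>x. x \<in> X \<Longrightarrow> (\<Sum>j\<in>J. z j x) \<in> \<int>"
  obtains t :: "'j \<Rightarrow> 'x \<Rightarrow> real" where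
    "\<And>j x. j \<in> J \<Longrightarrow> x \<in> X \<Longrightarrow> t j x \<in> \<int>"
    "\<And>j x. j \<in> J \<Longrightarrow> x \<in> X \<Longrightarrow> of_int \<lfloor>z j x\<rfloor> \<le> t j x \<and> t j x \<le> of_int \<lceil>z j x\<rceil>"
    "\<And>j. j \<in> J \<Longrightarrow> (\<Sum>x\<in>X. t j x) = (\<Sum>x\<in>X. z j x)"
    "\<And>x. x \<in> X \<Longrightarrow> (\<Sum>j\<in>J. t j x) = (\<Sum>j\<in>J. z j x)"
    "\<And>j b. j \<in> J \<Longrightarrow> b \<in> blk j ` X \<Longrightarrow>
      (\<Sum>x | x \<in> X \<and> blk j x = b. t j x) \<le> of_int \<lceil>\<Sum>x | x \<in> X \<and> blk j x = b. z j x\<rceil>"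
proof -
  define P where "P = (SIGMA j:J. blk j ` X)"
  define E where "E = Inl ` P \<union> Inr ` (J \<times> X)"
  define tail :: "'j \<times> 'b + 'j \<times> 'x \<Rightarrow> ('j, 'b, 'x) flow_node"
    where "tail = case_sum (\<lambda>(j, b). Row j) (\<lambda>(j, x). Block j (blk j x))"
  define head :: "'j \<times> 'b + 'j \<times> 'x \<Rightarrow> ('j, 'b, 'x) flow_node"
    where "head = case_sum (\<lambda>(j, b). Block j b) (\<lambda>(j, x). Col x)"
  \<comment> \<open>The block sum on the first kind of arc makes the net outflow 0 at every block
    node.\<close>
  define f where "f = case_sum (\<lambda>(j, b). \<Sum>x | x \<in> X \<and> blk j x = b. z j x) (\<lambda>(j, x). z j x)"
  let ?D = "incidence tail head :: ('j, 'b, 'x) flow_node \<Rightarrow> _"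
  have fP: "finite P" using J X by (auto simp: P_def)
  have fE: "finite E" using fP J X by (simp add: E_def)
  have sumE: "(\<Sum>e\<in>E. ?D v e * g e) =
      (\<Sum>j\<in>J. \<Sum>b\<in>blk j ` X. (of_bool (Row j = v) - of_bool (Block j b = v)) * g (Inl (j, b)))
    + (\<Sum>j\<in>J. \<Sum>x\<in>X. (of_bool (Block j (blk j x) = v) - of_bool (Col x = v)) * g (Inr (j, x)))"
    for v and g :: "'j \<times> 'b + 'j \<times> 'x \<Rightarrow> real"
  proof -
    have "(\<Sum>e\<in>E. ?D v e * g e) = (\<Sum>e\<in>Inl ` P. ?D v e * g e) + (\<Sum>e\<in>Inr ` (J \<times> X). ?D v e * g e)"
      unfolding E_def using fP J X by (intro sum.union_disjoint) auto
    also have "(\<Sum>e\<in>Inl ` P. ?D v e * g e) = (\<Sum>e\<in>P. ?D v (Inl e) * g (Inl e))"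
      by (simp add: sum.reindex)
    also have "\<dots> = (\<Sum>j\<in>J. \<Sum>b\<in>blk j ` X. ?D v (Inl (j, b)) * g (Inl (j, b)))"
      unfolding P_def using J X by (simp add: sum.Sigma)
    also have "(\<Sum>e\<in>Inr ` (J \<times> X). ?D v e * g e) = (\<Sum>e\<in>J \<times> X. ?D v (Inr e) * g (Inr e))"
      by (simp add: sum.reindex)
    also have "\<dots> = (\<Sum>j\<in>J. \<Sum>x\<in>X. ?D v (Inr (j, x)) * g (Inr (j, x)))"
      by (simp add: sum.cartesian_product)
    finally show ?thesis by (simp add: incidence_def tail_def head_def)
  qed
  have exRow: "(\<Sum>e\<in>E. ?D (Row j) e * g e) = (\<Sum>b\<in>blk j ` X. g (Inl (j, b)))" if "j \<in> J" for j g
  proof -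
    have "(\<Sum>j'\<in>J. \<Sum>b\<in>blk j' ` X. (of_bool (Row j' = Row j) - of_bool (Block j' b = Row j)) * g (Inl (j', b)))
       = (\<Sum>j'\<in>J. if j' = j then \<Sum>b\<in>blk j ` X. g (Inl (j, b)) else 0)"
      by (rule sum.cong) auto
    then show ?thesis unfolding sumE using that J by simp
  qed
  have exCol: "(\<Sum>e\<in>E. ?D (Col x) e * g e) = - (\<Sum>j\<in>J. g (Inr (j, x)))" if "x \<in> X" for x g
  proof -
    have "(\<Sum>j\<in>J. \<Sum>x'\<in>X. (of_bool (Block j (blk j x') = Col x) - of_bool (Col x' = Col x)) * g (Inr (j, x')))
       = (\<Sum>j\<in>J. \<Sum>x'\<in>X. if x' = x then - g (Inr (j, x)) else 0)"
      by (intro sum.cong) auto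
    also have "\<dots> = - (\<Sum>j\<in>J. g (Inr (j, x)))" using that X by (simp add: sum_negf)
    finally show ?thesis unfolding sumE by simp
  qed
  have exBlock: "(\<Sum>e\<in>E. ?D (Block j b) e * g e) =
      (\<Sum>x | x \<in> X \<and> blk j x = b. g (Inr (j, x))) - g (Inl (j, b))" if "j \<in> J" "b \<in> blk j ` X" for j b g
  proof -
    have "(\<Sum>j'\<in>J. \<Sum>b'\<in>blk j' ` X. (of_bool (Row j' = Block j b) - of_bool (Block j' b' = Block j b)) * g (Inl (j', b')))
       = (\<Sum>j'\<in>J. if j' = j then \<Sum>b'\<in>blk j ` X. if b' = b then - g (Inl (j, b)) else 0 else 0)"
      by (intro sum.cong) (auto intro!: sum.cong)
    moreover have "(\<Sum>j'\<in>J. \<Sum>x\<in>X. (of_bool (Block j' (blk j' x) = Block j b) - of_bool (Col x = Block j b)) * g (Inr (j', x)))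
       = (\<Sum>j'\<in>J. if j' = j then \<Sum>x\<in>X. if blk j x = b then g (Inr (j, x)) else 0 else 0)"
      by (intro sum.cong) (auto intro!: sum.cong)
    ultimately show ?thesis unfolding sumE using that J X
      by (simp add: sum.inter_filter)
  qed
  have split: "(\<Sum>b\<in>blk j ` X. \<Sum>x | x \<in> X \<and> blk j x = b. w x) = (\<Sum>x\<in>X. w x)" for j and w :: "'x \<Rightarrow> real"
    using X by (rule sum.image_gen[symmetric])
  have ex: "(\<Sum>e\<in>E. ?D v e * f e) \<in> \<int>" for v
  proof (cases v)
    case (Row j)
    show ?thesis
    proof (cases "j \<in> J")
      case True
      have "(\<Sum>e\<in>E. ?D v e * f e) = (\<Sum>x\<in>X. z j x)"
        unfolding Row exRow[OF True] by (simp add: f_def split)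
      then show ?thesis using row[OF True] by simp
    next
      case False
      then have "(\<Sum>e\<in>E. ?D v e * f e) = 0" 
        unfolding sumE Row by (auto intro!: sum.neutral)
      then show ?thesis by simp
    qed
  next
    case (Block j b)
    show ?thesis
    proof (cases "j \<in> J \<and> b \<in> blk j ` X")
      case True
      then have "(\<Sum>e\<in>E. ?D v e * f e) = 0"
        unfolding Block by (subst exBlock) (auto simp: f_def)
      then show ?thesis by simp
    next
      case False
      then have "(\<Sum>e\<in>E. ?D v e * f e) = 0" 
        unfolding sumE Block
        by (intro trans[OF arg_cong2[where f = "(+)"] add_0_left] sum.neutral ballI) auto
      then show ?thesis by simp
    qed
  next
    case (Col x)
    show ?thesis
    proof (cases "x \<in> X")
      case True
      have "(\<Sum>e\<in>E. ?D v e * f e) = - (\<Sum>j\<in>J. z j x)"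
        unfolding Col exCol[OF True] by (simp add: f_def)
      then show ?thesis using col[OF True] by simp
    next
      case False
      then have "(\<Sum>e\<in>E. ?D v e * f e) = 0" 
        unfolding sumE Col by (auto intro!: sum.neutral)
      then show ?thesis by simp
    qed
  qed
  have ne: "tail e \<noteq> head e" for e
    by (auto simp: tail_def head_def split: sum.splits)
  from flow_rounding[where tail = tail and head = head, OF fE ne ex]
  obtain g where g: "\<And>e. e \<in> E \<Longrightarrow> g e \<in> \<int> \<and> of_int \<lfloor>f e\<rfloor> \<le> g e \<and> g e \<le> of_int \<lceil>f e\<rceil>"
    and gex: "\<And>v. (\<Sum>e\<in>E. ?D v e * g e) = (\<Sum>e\<in>E. ?D v e * f e)" by blast
  \<comment> \<open>Conservation at the block node turns a bound on one arc into a bound on the sum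
    over the block.\<close>
  have blkg: "g (Inl (j, b)) = (\<Sum>x | x \<in> X \<and> blk j x = b. g (Inr (j, x)))"
    if "j \<in> J" "b \<in> blk j ` X" for j b
    using gex[of "Block j b"] unfolding exBlock[OF that] by (simp add: f_def)
  show thesis
  proof (rule that[of "\<lambda>j x. g (Inr (j, x))"])
    fix j x assume "j \<in> J" "x \<in> X"
    then have "Inr (j, x) \<in> E" by (simp add: E_def)
    from g[OF this] show "g (Inr (j, x)) \<in> \<int>"
      "of_int \<lfloor>z j x\<rfloor> \<le> g (Inr (j, x)) \<and> g (Inr (j, x)) \<le> of_int \<lceil>z j x\<rceil>" by (simp_all add: f_def)
  next
    fix j assume j: "j \<in> J"
    have "(\<Sum>x\<in>X. g (Inr (j, x))) = (\<Sum>b\<in>blk j ` X. g (Inl (j, b)))"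
      by (simp add: blkg[OF j] split)
    also have "\<dots> = (\<Sum>b\<in>blk j ` X. f (Inl (j, b)))"
      using gex[of "Row j"] unfolding exRow[OF j] .
    finally show "(\<Sum>x\<in>X. g (Inr (j, x))) = (\<Sum>x\<in>X. z j x)" by (simp add: f_def split)
  next
    fix x assume x: "x \<in> X"
    show "(\<Sum>j\<in>J. g (Inr (j, x))) = (\<Sum>j\<in>J. z j x)"
      using gex[of "Col x"] unfolding exCol[OF x] by (simp add: f_def)
  next
    fix j b assume jb: "j \<in> J" "b \<in> blk j ` X"
    then have "Inl (j, b) \<in> E" by (auto simp: E_def P_def)
    from g[OF this] show "(\<Sum>x | x \<in> X \<and> blk j x = b. g (Inr (j, x))) \<le> of_int \<lceil>\<Sum>x | x \<in> X \<and> blk j x = b. z j x\<rceil>"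
      unfolding blkg[OF jb] by (simp add: f_def)
  qed
qed

section \<open>Splitting a vertex of an edge-coloured multigraph\<close>

definition linked :: "('v \<Rightarrow> 'v \<Rightarrow> nat) \<Rightarrow> 'v set \<Rightarrow> ('v \<times> 'v) set" where
  "linked B Y = {(x, y). x \<in> Y \<and> y \<in> Y \<and> 0 < B x y}"

definition connected_on :: "('v \<Rightarrow> 'v \<Rightarrow> nat) \<Rightarrow> 'v set \<Rightarrow> bool" where
  "connected_on B Y \<longleftrightarrow> (\<forall>x\<in>Y. \<forall>y\<in>Y. (x, y) \<in> (linked B Y)\<^sup>*)"

text \<open>\<open>B j x y\<close> is the number of edges of colour \<open>j\<close> between \<open>x\<close> and \<open>y\<close>; the diagonal entry
  \<open>B j x x\<close> counts every loop twice, so that row sums are degrees.\<close>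

definition even_system :: "'j set \<Rightarrow> 'v set \<Rightarrow> ('j \<Rightarrow> 'v \<Rightarrow> 'v \<Rightarrow> nat) \<Rightarrow> bool" where
  "even_system J Y B \<longleftrightarrow> finite J \<and> finite Y \<and> (\<forall>j\<in>J.
     (\<forall>x\<in>Y. \<forall>y\<in>Y. B j x y = B j y x) \<and> (\<forall>x\<in>Y. even (B j x x)) \<and>
     (\<forall>x\<in>Y. even (\<Sum>y\<in>Y. B j x y)) \<and> connected_on (B j) Y)"

lemma connected_onI:
  assumes "sym (linked B Y)" "\<And>x. x \<in> Y \<Longrightarrow> (x, u) \<in> (linked B Y)\<^sup>*"
  shows "connected_on B Y"
  unfolding connected_on_def using assms
  by (meson rtrancl_trans sym_rtrancl symD)

text \<open>Off-diagonal entries occur in equal pairs.\<close>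

lemma even_sum_symmetric:
  fixes B :: "'v \<Rightarrow> 'v \<Rightarrow> nat"
  assumes "finite K" "\<And>x y. x \<in> K \<Longrightarrow> y \<in> K \<Longrightarrow> B x y = B y x" "\<And>x. x \<in> K \<Longrightarrow> even (B x x)"
  shows "even (\<Sum>x\<in>K. \<Sum>y\<in>K. B x y)"
  using assms
proof (induction K rule: finite_induct)
  case (insert a K)
  have "(\<Sum>x\<in>insert a K. \<Sum>y\<in>insert a K. B x y) =
      B a a + (\<Sum>y\<in>K. B a y) + (\<Sum>x\<in>K. B x a) + (\<Sum>x\<in>K. \<Sum>y\<in>K. B x y)"
    using insert.hyps by (simp add: sum.distrib)
  also have "(\<Sum>x\<in>K. B x a) = (\<Sum>y\<in>K. B a y)" using insert.prems by (intro sum.cong) auto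
  finally show ?case using insert by simp
qed simp

text \<open>For even \<open>s\<close> the bound \<open>s / 2\<close> is itself an integer, so
  rounding up cannot exceed it.\<close>

lemma ceiling_divide_le_half:
  fixes s n :: nat
  assumes "even s" "2 \<le> n"
  shows "\<lceil>real s / real n\<rceil> \<le> int (s div 2)"
proof -
  have "real s / real n \<le> real s / 2" using assms by (intro divide_left_mono) auto
  also have "\<dots> = real (s div 2)" using assms by (simp add: real_of_nat_div)
  finally show ?thesis by (simp add: ceiling_le_iff)
qed

text \<open>The new vertex \<open>w\<close> takes the share \<open>1 / n\<close> of the edges at \<open>u\<close>, suitably rounded. By
  evenness of all degrees, each component of colour \<open>j\<close> without \<open>u\<close> is attached to \<open>u\<close> by an even
  number of edges; at most half of them are moved, so the colour stays connected.\<close>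

lemma split_vertex:
  fixes B :: "'j \<Rightarrow> 'v \<Rightarrow> 'v \<Rightarrow> nat"
  assumes sys: "even_system J Y B" and u: "u \<in> Y" and w: "w \<notin> Y" and n: "2 \<le> n"
    and row: "\<And>j. j \<in> J \<Longrightarrow> (\<Sum>y\<in>Y. B j u y) = n * d j"
    and d: "\<And>j. j \<in> J \<Longrightarrow> even (d j) \<and> 0 < d j"
    and col: "\<And>x. x \<in> Y \<Longrightarrow> (\<Sum>j\<in>J. B j x u) = n * \<tau> x"
  obtains B' where "even_system J (insert w Y) B'"
    "\<And>j x y. j \<in> J \<Longrightarrow> x \<in> Y - {u} \<Longrightarrow> y \<in> Y - {u} \<Longrightarrow> B' j x y = B j x y"
    "\<And>j x. j \<in> J \<Longrightarrow> x \<in> Y - {u} \<Longrightarrow> (\<Sum>y\<in>insert w Y. B' j x y) = (\<Sum>y\<in>Y. B j x y)"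
    "\<And>j. j \<in> J \<Longrightarrow> (\<Sum>y\<in>insert w Y. B' j w y) = d j"
    "\<And>j. j \<in> J \<Longrightarrow> (\<Sum>y\<in>insert w Y. B' j u y) = (n - 1) * d j"
    "\<And>x. x \<in> Y - {u} \<Longrightarrow> (\<Sum>j\<in>J. B' j x u) = (n - 1) * \<tau> x"
    "\<And>x. x \<in> Y \<Longrightarrow> (\<Sum>j\<in>J. B' j x w) = \<tau> x"
    "(\<Sum>j\<in>J. B' j u u) = (n - 2) * \<tau> u"
    "\<And>j. j \<in> J \<Longrightarrow> B' j w w = 0"
proof -
  have fJ: "finite J" and fY: "finite Y" using sys by (auto simp: even_system_def)
  have sym: "B j x y = B j y x" if "j \<in> J" "x \<in> Y" "y \<in> Y" for j x y
    using sys that by (auto simp: even_system_def)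
  have diag: "even (B j x x)" if "j \<in> J" "x \<in> Y" for j x
    using sys that by (auto simp: even_system_def)
  have even_row: "even (\<Sum>y\<in>Y. B j x y)" if "j \<in> J" "x \<in> Y" for j x
    using sys that unfolding even_system_def by blast
  have conn: "connected_on (B j) Y" if "j \<in> J" for j
    using sys that by (auto simp: even_system_def)
  have row': "(\<Sum>y\<in>Y. B j y u) = n * d j" if "j \<in> J" for j
    using row[OF that] sym[OF that u] by simp
  \<comment> \<open>The fractional solution: \<open>w\<close> is offered the share
    \<open>1 / n\<close> of every entry in the column of \<open>u\<close>. Its row sums
    \<open>d j\<close> and column sums \<open>\<tau> x\<close> are integers, so rounding preserves
    them exactly.\<close>
  define z where "z j x = real (B j x u) / real n" for j x
  define R where "R j = linked (B j) (Y - {u})" for j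
  \<comment> \<open>Blocks of colour \<open>j\<close> are its components after removal of
    \<open>u\<close>. No pair in \<open>R j\<close> involves \<open>u\<close>, so \<open>u\<close>
    is a block by itself.\<close>
  define blk where "blk j x = (R j)\<^sup>* `` {x}" for j x
  have n0: "real n \<noteq> 0" using n by simp
  have z_row: "(\<Sum>x\<in>Y. z j x) = real (d j)" if "j \<in> J" for j
  proof -
    have "(\<Sum>x\<in>Y. z j x) = real (\<Sum>x\<in>Y. B j x u) / real n"
      by (simp add: z_def sum_divide_distrib)
    then show ?thesis using row'[OF that] n0 by simp
  qed
  have z_col: "(\<Sum>j\<in>J. z j x) = real (\<tau> x)" if "x \<in> Y" for x
  proof -
    have "(\<Sum>j\<in>J. z j x) = real (\<Sum>j\<in>J. B j x u) / real n"
      by (simp add: z_def sum_divide_distrib)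
    then show ?thesis using col[OF that] n0 by simp
  qed
  obtain t0 :: "'j \<Rightarrow> 'v \<Rightarrow> real" where
    t_int: "\<And>j x. j \<in> J \<Longrightarrow> x \<in> Y \<Longrightarrow> t0 j x \<in> \<int>" and
    t_bd: "\<And>j x. j \<in> J \<Longrightarrow> x \<in> Y \<Longrightarrow> of_int \<lfloor>z j x\<rfloor> \<le> t0 j x \<and> t0 j x \<le> of_int \<lceil>z j x\<rceil>" and
    t_row: "\<And>j. j \<in> J \<Longrightarrow> (\<Sum>x\<in>Y. t0 j x) = (\<Sum>x\<in>Y. z j x)" and
    t_col: "\<And>x. x \<in> Y \<Longrightarrow> (\<Sum>j\<in>J. t0 j x) = (\<Sum>j\<in>J. z j x)" and
    t_blk: "\<And>j b. j \<in> J \<Longrightarrow> b \<in> blk j ` Y \<Longrightarrow>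
      (\<Sum>x | x \<in> Y \<and> blk j x = b. t0 j x) \<le> of_int \<lceil>\<Sum>x | x \<in> Y \<and> blk j x = b. z j x\<rceil>"
    by (rule matrix_rounding[OF fJ fY, of z blk]) (use z_row z_col in auto)
  define t where "t j x = nat \<lfloor>t0 j x\<rfloor>" for j x
  have t: "real (t j x) = t0 j x" if "j \<in> J" "x \<in> Y" for j x
  proof -
    have "0 \<le> \<lfloor>z j x\<rfloor>" by (simp add: z_def)
    then have "(0::real) \<le> of_int \<lfloor>z j x\<rfloor>" by simp
    then have "0 \<le> t0 j x" using t_bd[OF that] by linarith
    then show ?thesis using t_int[OF that] by (auto simp: t_def elim!: Ints_cases)
  qed
  have t_row': "(\<Sum>x\<in>Y. t j x) = d j" if "j \<in> J" for j
  proof -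
    have "real (\<Sum>x\<in>Y. t j x) = (\<Sum>x\<in>Y. t0 j x)" using t that by simp
    also have "\<dots> = real (d j)" using t_row[OF that] z_row[OF that] by simp
    finally show ?thesis by (simp only: of_nat_eq_iff)
  qed
  have t_col': "(\<Sum>j\<in>J. t j x) = \<tau> x" if "x \<in> Y" for x
  proof -
    have "real (\<Sum>j\<in>J. t j x) = (\<Sum>j\<in>J. t0 j x)" using t that by simp
    also have "\<dots> = real (\<tau> x)" using t_col[OF that] z_col[OF that] by simp
    finally show ?thesis by (simp only: of_nat_eq_iff)
  qed
  have t_le: "t j x \<le> B j x u" if "j \<in> J" "x \<in> Y" for j x
  proof -
    have "real (B j x u) / real n \<le> real (B j x u) / 1" using n by (intro divide_left_mono) auto
    then have "z j x \<le> real (B j x u)" by (simp add: z_def)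
    then have "\<lceil>z j x\<rceil> \<le> int (B j x u)" by (simp add: ceiling_le_iff)
    then have "real_of_int \<lceil>z j x\<rceil> \<le> real (B j x u)" by linarith
    then show ?thesis using t_bd[OF that] t[OF that] by linarith
  qed
  \<comment> \<open>A loop counts 2 in \<open>B j u u\<close> and only one of its ends is moved, so
    at most half of this entry may be taken.\<close>
  have t_le_half: "2 * t j u \<le> B j u u" if "j \<in> J" for j
  proof -
    have "\<lceil>z j u\<rceil> \<le> int (B j u u div 2)"
      unfolding z_def by (rule ceiling_divide_le_half[OF diag[OF that u] n])
    then have "real_of_int \<lceil>z j u\<rceil> \<le> real (B j u u div 2)" by linarith
    then have "t j u \<le> B j u u div 2" using t_bd[OF that u] t[OF that u] by linarith
    then show ?thesis by simp
  qed
  \<comment> \<open>Moving one end of a loop at \<open>u\<close> to \<open>w\<close> makes it an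
    edge between \<open>u\<close> and \<open>w\<close>. Hence \<open>B j u u\<close> loses 2 for
    each moved end, and \<open>w\<close> gets no loop.\<close>
  define B' where "B' j x y =
    (if x = w then (if y = w then 0 else t j y)
     else if y = w then t j x
     else if x = u then (if y = u then B j u u - 2 * t j u else B j y u - t j y)
     else if y = u then B j x u - t j x else B j x y)" for j x y
  have uw: "u \<noteq> w" using u w by auto
  have Yw: "x \<noteq> w" if "x \<in> Y" for x using that w by auto
  have B'_simps:
    "B' j w w = 0" "B' j u w = t j u" "B' j w u = t j u" "B' j u u = B j u u - 2 * t j u"
    "x \<in> Y \<Longrightarrow> B' j w x = t j x" "x \<in> Y \<Longrightarrow> B' j x w = t j x"
    "x \<in> Y - {u} \<Longrightarrow> B' j u x = B j x u - t j x"
    "x \<in> Y - {u} \<Longrightarrow> B' j x u = B j x u - t j x"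
    "x \<in> Y - {u} \<Longrightarrow> y \<in> Y - {u} \<Longrightarrow> B' j x y = B j x y" for j x y
    using w uw by (simp_all add: B'_def Yw)
  have rowx: "(\<Sum>y\<in>insert w Y. B' j x y) = (\<Sum>y\<in>Y. B j x y)" if j: "j \<in> J" and x: "x \<in> Y - {u}" for j x
  proof -
    have "(\<Sum>y\<in>insert w Y. B' j x y) = B' j x w + (B' j x u + (\<Sum>y\<in>Y - {u}. B' j x y))"
      using fY w u by (simp add: sum.remove)
    also have "(\<Sum>y\<in>Y - {u}. B' j x y) = (\<Sum>y\<in>Y - {u}. B j x y)"
      using x by (intro sum.cong refl) (rule B'_simps)
    also have "B' j x w + (B' j x u + (\<Sum>y\<in>Y - {u}. B j x y)) = B j x u + (\<Sum>y\<in>Y - {u}. B j x y)"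
      using x t_le[OF j, of x] by (simp add: B'_simps)
    also have "\<dots> = (\<Sum>y\<in>Y. B j x y)" using fY u by (simp add: sum.remove)
    finally show ?thesis .
  qed
  have roww: "(\<Sum>y\<in>insert w Y. B' j w y) = d j" if j: "j \<in> J" for j
  proof -
    have "(\<Sum>y\<in>insert w Y. B' j w y) = (\<Sum>y\<in>Y. t j y)"
      using fY w by (simp add: B'_simps)
    then show ?thesis using t_row'[OF j] by simp
  qed
  have rowu: "(\<Sum>y\<in>insert w Y. B' j u y) = (n - 1) * d j" if j: "j \<in> J" for j
  proof -
    have "(\<Sum>y\<in>insert w Y. B' j u y) = t j u + ((B j u u - 2 * t j u) + (\<Sum>y\<in>Y - {u}. B j y u - t j y))"
    proof -
      have "(\<Sum>y\<in>insert w Y. B' j u y) = B' j u w + (B' j u u + (\<Sum>y\<in>Y - {u}. B' j u y))"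
        using fY w u by (simp add: sum.remove)
      also have "(\<Sum>y\<in>Y - {u}. B' j u y) = (\<Sum>y\<in>Y - {u}. B j y u - t j y)"
        by (intro sum.cong refl) (rule B'_simps)
      finally show ?thesis by (simp only: B'_simps)
    qed
    moreover have "(\<Sum>y\<in>Y - {u}. B j y u - t j y) = (\<Sum>y\<in>Y - {u}. B j y u) - (\<Sum>y\<in>Y - {u}. t j y)"
      using t_le[OF j] by (intro sum_subtractf_nat) auto
    moreover have "(\<Sum>y\<in>Y - {u}. t j y) \<le> (\<Sum>y\<in>Y - {u}. B j y u)"
      using t_le[OF j] by (intro sum_mono) auto
    moreover have "(\<Sum>y\<in>Y. B j y u) = B j u u + (\<Sum>y\<in>Y - {u}. B j y u)"
      "(\<Sum>y\<in>Y. t j y) = t j u + (\<Sum>y\<in>Y - {u}. t j y)"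
      using fY u by (simp_all add: sum.remove)
    ultimately have "(\<Sum>y\<in>insert w Y. B' j u y) + d j = n * d j"
      using row'[OF j] t_row'[OF j] t_le_half[OF j] by linarith
    then show ?thesis by (simp add: diff_mult_distrib)
  qed
  have sym': "B' j x y = B' j y x" if "j \<in> J" "x \<in> insert w Y" "y \<in> insert w Y" for j x y
  proof -
    note xy = that
    show ?thesis
    proof (cases "x \<in> Y \<and> y \<in> Y")
      case True
      then show ?thesis using sym[OF xy(1), of x y]
        by (cases "x = u"; cases "y = u") (simp_all add: B'_simps)
    next
      case False
      then consider "x = w" "y = w" | "x = w" "y \<in> Y" | "x \<in> Y" "y = w" using xy by blast
      then show ?thesis by cases (simp_all add: B'_simps)
    qed
  qed
  have diag': "even (B' j x x)" if "j \<in> J" "x \<in> insert w Y" for j x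
    using diag[OF that(1)] that by (cases "x = w"; cases "x = u") (auto simp: B'_simps)
  have even': "even (\<Sum>y\<in>insert w Y. B' j x y)" if "j \<in> J" "x \<in> insert w Y" for j x
  proof -
    note xj = that
    consider "x = w" | "x = u" | "x \<in> Y - {u}" using xj by blast
    then show ?thesis
    proof cases
      case 1 then show ?thesis using roww d xj by simp
    next
      case 2 then show ?thesis using rowu d xj by simp
    next
      case 3 then show ?thesis using rowx even_row xj by simp
    qed
  qed
  have conn': "connected_on (B' j) (insert w Y)" if j: "j \<in> J" for j
  proof -
    let ?R' = "linked (B' j) (insert w Y)"
    have symR': "sym ?R'" using sym'[OF j] by (auto simp: sym_def linked_def)
    have symR: "sym (R j)" using sym[OF j] by (auto simp: sym_def linked_def R_def)
    have RR': "R j \<subseteq> ?R'" using w by (auto simp: R_def linked_def B'_simps)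
    \<comment> \<open>Edges inside the component \<open>K\<close> of \<open>x\<close> without
      \<open>u\<close> are untouched, so it is enough that one edge from \<open>K\<close> to
      \<open>u\<close> is not moved to \<open>w\<close>.\<close>
    have reach: "(x, u) \<in> ?R'\<^sup>*" if x: "x \<in> Y - {u}" for x
    proof -
      define K where "K = blk j x"
      have xK: "x \<in> K" by (simp add: K_def blk_def)
      have KY: "K \<subseteq> Y - {u}"
      proof
        fix y assume "y \<in> K"
        then have "(x, y) \<in> (R j)\<^sup>*" by (simp add: K_def blk_def)
        then show "y \<in> Y - {u}" by (induction) (use x in \<open>auto simp: R_def linked_def\<close>)
      qed
      have fK: "finite K" using KY fY finite_subset by blast
      have closed: "v \<in> K" if "y \<in> K" "v \<in> Y - {u}" "0 < B j y v" for y v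
        using that KY by (auto simp: K_def blk_def R_def linked_def intro: rtrancl_into_rtrancl)
      have Kblk: "{y. y \<in> Y \<and> blk j y = blk j x} = K"
      proof (intro set_eqI iffI)
        fix y assume "y \<in> {y. y \<in> Y \<and> blk j y = blk j x}"
        then show "y \<in> K" unfolding K_def by (auto simp: blk_def)
      next
        fix y assume y: "y \<in> K"
        then have "(x, y) \<in> (R j)\<^sup>*" by (simp add: K_def blk_def)
        moreover from this have "(y, x) \<in> (R j)\<^sup>*" using symR by (meson sym_rtrancl symD)
        ultimately have "blk j y = blk j x" by (auto simp: blk_def intro: rtrancl_trans)
        then show "y \<in> {y. y \<in> Y \<and> blk j y = blk j x}" using y KY by auto
      qed
      \<comment> \<open>Otherwise \<open>K\<close> would be closed under adjacency in a connected
        colour class that also contains \<open>u\<close>.\<close>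
      have "\<exists>y\<in>K. 0 < B j y u"
      proof (rule ccontr)
        assume no: "\<not> (\<exists>y\<in>K. 0 < B j y u)"
        have "linked (B j) Y `` K \<subseteq> K"
        proof
          fix v assume "v \<in> linked (B j) Y `` K"
          then obtain y where "y \<in> K" "v \<in> Y" "0 < B j y v" by (auto simp: linked_def)
          then show "v \<in> K" using no closed[of y v] by (cases "v = u") auto
        qed
        then have "(linked (B j) Y)\<^sup>* `` K = K" by (rule Image_closed_trancl)
        moreover have "(x, u) \<in> (linked (B j) Y)\<^sup>*"
          using conn[OF j] x u by (auto simp: connected_on_def)
        ultimately have "u \<in> K" using xK by blast
        then show False using KY by auto
      qed
      then obtain y0 where y0: "y0 \<in> K" "0 < B j y0 u" by blast
      define s where "s = (\<Sum>y\<in>K. B j y u)"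
      have "0 < s" using y0 fK member_le_sum[of y0 K "\<lambda>y. B j y u"] by (simp add: s_def)
      \<comment> \<open>The degrees in \<open>K\<close> have an even sum, to which edges inside
        \<open>K\<close> contribute an even amount; the rest is \<open>s\<close>.\<close>
      have "even s"
      proof -
        have "(\<Sum>v\<in>Y. B j y v) = (\<Sum>v\<in>K. B j y v) + B j y u" if y: "y \<in> K" for y
        proof -
          have "(\<Sum>v\<in>Y. B j y v) = B j y u + (\<Sum>v\<in>Y - {u}. B j y v)"
            using fY u by (simp add: sum.remove)
          also have "(\<Sum>v\<in>Y - {u}. B j y v) = (\<Sum>v\<in>K. B j y v)"
            using fY KY closed[OF y] by (intro sum.mono_neutral_right) auto
          finally show ?thesis by simp
        qed
        then have "(\<Sum>y\<in>K. \<Sum>v\<in>Y. B j y v) = (\<Sum>y\<in>K. \<Sum>v\<in>K. B j y v) + s"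
          by (simp add: sum.distrib s_def)
        moreover have "even (\<Sum>y\<in>K. \<Sum>v\<in>Y. B j y v)"
          by (rule dvd_sum) (use even_row[OF j] KY in blast)
        moreover have "even (\<Sum>y\<in>K. \<Sum>v\<in>K. B j y v)"
          using sym[OF j] diag[OF j] KY fK by (intro even_sum_symmetric) blast+
        ultimately show ?thesis by presburger
      qed
      have "(\<Sum>y\<in>K. z j y) = real s / real n"
        by (simp add: z_def s_def sum_divide_distrib)
      then have "\<lceil>\<Sum>y\<in>K. z j y\<rceil> \<le> int (s div 2)"
        using ceiling_divide_le_half[OF \<open>even s\<close> n] by simp
      then have "real_of_int \<lceil>\<Sum>y\<in>K. z j y\<rceil> \<le> real (s div 2)" by linarith
      moreover have "(\<Sum>y\<in>K. t0 j y) \<le> of_int \<lceil>\<Sum>y\<in>K. z j y\<rceil>"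
        using t_blk[OF j, of "blk j x"] x unfolding Kblk by blast
      moreover have "(\<Sum>y\<in>K. t0 j y) = real (\<Sum>y\<in>K. t j y)"
        using t[OF j] KY by (auto intro!: sum.cong)
      ultimately have "(\<Sum>y\<in>K. t j y) \<le> s div 2" by linarith
      then have lt: "(\<Sum>y\<in>K. t j y) < s" using \<open>0 < s\<close> \<open>even s\<close> by linarith
      have "\<exists>y\<in>K. t j y < B j y u"
      proof (rule ccontr)
        assume "\<not> ?thesis"
        then have "s \<le> (\<Sum>y\<in>K. t j y)" unfolding s_def by (intro sum_mono) force
        then show False using lt by simp
      qed
      then obtain y where y: "y \<in> K" "t j y < B j y u" by blast
      have "(x, y) \<in> ?R'\<^sup>*"
        using y(1) rtrancl_mono[OF RR'] by (auto simp: K_def blk_def)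
      moreover have "(y, u) \<in> ?R'"
      proof -
        have "y \<in> Y - {u}" using y KY by blast
        then show ?thesis using y u by (simp add: linked_def B'_simps)
      qed
      ultimately show ?thesis by simp
    qed
    \<comment> \<open>Since \<open>d j\<close> is positive, \<open>w\<close> has an edge in colour
      \<open>j\<close>, and the other end of that edge already reaches \<open>u\<close>.\<close>
    have reach_w: "(w, u) \<in> ?R'\<^sup>*"
    proof -
      have "(\<Sum>x\<in>Y. t j x) \<noteq> 0" using t_row'[OF j] d[OF j] by simp
      then obtain x where x: "x \<in> Y" "t j x \<noteq> 0" by (meson sum.neutral)
      then have "(w, x) \<in> ?R'" using B'_simps(5)[of x j] by (simp add: linked_def)
      moreover have "(x, u) \<in> ?R'\<^sup>*" using reach[of x] x by (cases "x = u") auto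
      ultimately show ?thesis by (rule converse_rtrancl_into_rtrancl)
    qed
    show ?thesis
    proof (rule connected_onI[OF symR'])
      fix x assume "x \<in> insert w Y"
      then show "(x, u) \<in> ?R'\<^sup>*" using reach[of x] reach_w by (cases "x = u") auto
    qed
  qed
  show thesis
  proof (rule that[of B'])
    show "even_system J (insert w Y) B'"
    proof -
      have "finite (insert w Y)" using fY by simp
      then show ?thesis
        unfolding even_system_def
        by (intro conjI ballI fJ) (assumption | rule sym' diag' even' conn'; assumption)+
    qed
  next
    fix x assume x: "x \<in> Y - {u}"
    have "(\<Sum>j\<in>J. B' j x u) = (\<Sum>j\<in>J. B j x u - t j x)"
      using x by (intro sum.cong refl) (rule B'_simps)
    also have "\<dots> = (\<Sum>j\<in>J. B j x u) - (\<Sum>j\<in>J. t j x)"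
      using t_le x by (intro sum_subtractf_nat) auto
    finally show "(\<Sum>j\<in>J. B' j x u) = (n - 1) * \<tau> x"
      using col[of x] t_col'[of x] x by (simp add: diff_mult_distrib)
  next
    fix x assume x: "x \<in> Y"
    then show "(\<Sum>j\<in>J. B' j x w) = \<tau> x" using t_col'[of x] by (simp add: B'_simps)
  next
    have "(\<Sum>j\<in>J. B' j u u) = (\<Sum>j\<in>J. B j u u - 2 * t j u)"
      by (simp add: B'_simps)
    also have "\<dots> = (\<Sum>j\<in>J. B j u u) - (\<Sum>j\<in>J. 2 * t j u)"
      using t_le_half by (intro sum_subtractf_nat) auto
    also have "(\<Sum>j\<in>J. 2 * t j u) = 2 * \<tau> u"
      using t_col'[OF u] by (simp add: sum_distrib_left[symmetric])
    finally show "(\<Sum>j\<in>J. B' j u u) = (n - 2) * \<tau> u"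
      using col[OF u] by (simp add: diff_mult_distrib)
  qed (rule B'_simps(1,9) rowx roww rowu; assumption)+
qed

lemma even_system_sym:
  "even_system J Y B \<Longrightarrow> j \<in> J \<Longrightarrow> x \<in> Y \<Longrightarrow> y \<in> Y \<Longrightarrow> B j x y = B j y x"
  unfolding even_system_def by blast

lemma even_system_sum_sym:
  "even_system J Y B \<Longrightarrow> x \<in> Y \<Longrightarrow> y \<in> Y \<Longrightarrow> (\<Sum>j\<in>J. B j x y) = (\<Sum>j\<in>J. B j y x)"
  by (intro sum.cong refl) (rule even_system_sym)

text \<open>The vertices of \<open>W\<close> are split off one at a time; once split off,
  \<open>w\<close> is an ordinary vertex that must send \<open>L\<close> edges to each remaining
  piece of \<open>u\<close>. With \<open>n\<close> pieces in all, the loop entry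
  \<open>n * (n - 1) * L\<close> provides \<open>L\<close> edges for every ordered pair of pieces,
  as each loop is counted twice.\<close>

lemma detach_vertex:
  fixes B :: "'j \<Rightarrow> 'v \<Rightarrow> 'v \<Rightarrow> nat"
  assumes "finite W" and sys: "even_system J Y B" and u: "u \<in> Y" and W: "W \<inter> Y = {}"
    and row: "\<And>j. j \<in> J \<Longrightarrow> (\<Sum>y\<in>Y. B j u y) = Suc (card W) * d j"
    and d: "\<And>j. j \<in> J \<Longrightarrow> even (d j) \<and> 0 < d j"
    and col: "\<And>x. x \<in> Y - {u} \<Longrightarrow> (\<Sum>j\<in>J. B j x u) = Suc (card W) * \<tau> x"
    and loops: "(\<Sum>j\<in>J. B j u u) = Suc (card W) * card W * L"
  shows "\<exists>B'. even_system J (Y \<union> W) B'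
    \<and> (\<forall>j\<in>J. \<forall>x\<in>Y - {u}. \<forall>y\<in>Y - {u}. B' j x y = B j x y)
    \<and> (\<forall>j\<in>J. \<forall>x\<in>Y - {u}. (\<Sum>y\<in>Y \<union> W. B' j x y) = (\<Sum>y\<in>Y. B j x y))
    \<and> (\<forall>j\<in>J. \<forall>i\<in>insert u W. (\<Sum>y\<in>Y \<union> W. B' j i y) = d j)
    \<and> (\<forall>x\<in>Y - {u}. \<forall>i\<in>insert u W. (\<Sum>j\<in>J. B' j x i) = \<tau> x)
    \<and> (\<forall>i\<in>insert u W. \<forall>i'\<in>insert u W. (\<Sum>j\<in>J. B' j i i') = (if i = i' then 0 else L))"
  using assms
proof (induction W arbitrary: Y B \<tau> rule: finite_induct)
  case empty
  then show ?case by (intro exI[of _ B]) simp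
next
  case (insert w W)
  define n where "n = Suc (Suc (card W))"
  have n: "card (insert w W) = Suc (card W)" "2 \<le> n" using insert.hyps by (auto simp: n_def)
  have w: "w \<notin> Y" and W: "W \<inter> insert w Y = {}" and wu: "w \<noteq> u"
    using insert by auto
  have row: "(\<Sum>y\<in>Y. B j u y) = n * d j" if "j \<in> J" for j
    using insert.prems(4)[OF that] unfolding n n_def .
  \<comment> \<open>At \<open>x = u\<close> the sum counts loop ends: the share of
    \<open>n * (n - 1) * L\<close> that falls to \<open>w\<close> is \<open>(n - 1) * L\<close>,
    exactly what \<open>w\<close> needs for \<open>L\<close> edges to each of the other
    \<open>n - 1\<close> pieces.\<close>
  have col: "(\<Sum>j\<in>J. B j x u) = n * (if x = u then Suc (card W) * L else \<tau> x)" if "x \<in> Y" for x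
    using insert.prems(6)[of x] insert.prems(7) that unfolding n n_def by (auto simp: algebra_simps)
  obtain B1 where B1: "even_system J (insert w Y) B1"
    "\<And>j x y. j \<in> J \<Longrightarrow> x \<in> Y - {u} \<Longrightarrow> y \<in> Y - {u} \<Longrightarrow> B1 j x y = B j x y"
    "\<And>j x. j \<in> J \<Longrightarrow> x \<in> Y - {u} \<Longrightarrow> (\<Sum>y\<in>insert w Y. B1 j x y) = (\<Sum>y\<in>Y. B j x y)"
    "\<And>j. j \<in> J \<Longrightarrow> (\<Sum>y\<in>insert w Y. B1 j w y) = d j"
    "\<And>j. j \<in> J \<Longrightarrow> (\<Sum>y\<in>insert w Y. B1 j u y) = (n - 1) * d j"
    "\<And>x. x \<in> Y - {u} \<Longrightarrow> (\<Sum>j\<in>J. B1 j x u) = (n - 1) * (if x = u then Suc (card W) * L else \<tau> x)"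
    "\<And>x. x \<in> Y \<Longrightarrow> (\<Sum>j\<in>J. B1 j x w) = (if x = u then Suc (card W) * L else \<tau> x)"
    "(\<Sum>j\<in>J. B1 j u u) = (n - 2) * (if u = u then Suc (card W) * L else \<tau> u)"
    "\<And>j. j \<in> J \<Longrightarrow> B1 j w w = 0"
    using split_vertex[where B = B and n = n and d = d, OF insert.prems(1,2) w n(2) row insert.prems(5) col] by blast
  have n1: "n - 1 = Suc (card W)" "n - 2 = card W" by (simp_all add: n_def)
  have u1: "u \<in> insert w Y" using insert.prems by simp
  have col1: "(\<Sum>j\<in>J. B1 j x u) = Suc (card W) * (\<tau>(w := L)) x" if "x \<in> insert w Y - {u}" for x
  proof (cases "x = w")
    case True
    have "(\<Sum>j\<in>J. B1 j w u) = (\<Sum>j\<in>J. B1 j u w)" using B1(1) u1 by (intro even_system_sum_sym) auto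
    then show ?thesis using True B1(7)[of u] insert.prems(2) by simp
  next
    case False
    then show ?thesis using B1(6)[of x] that n1 by simp
  qed
  have loops1: "(\<Sum>j\<in>J. B1 j u u) = Suc (card W) * card W * L"
    using B1(8) n1 by (simp add: algebra_simps)
  have "\<exists>B2. even_system J (insert w Y \<union> W) B2
    \<and> (\<forall>j\<in>J. \<forall>x\<in>insert w Y - {u}. \<forall>y\<in>insert w Y - {u}. B2 j x y = B1 j x y)
    \<and> (\<forall>j\<in>J. \<forall>x\<in>insert w Y - {u}. (\<Sum>y\<in>insert w Y \<union> W. B2 j x y) = (\<Sum>y\<in>insert w Y. B1 j x y))
    \<and> (\<forall>j\<in>J. \<forall>i\<in>insert u W. (\<Sum>y\<in>insert w Y \<union> W. B2 j i y) = d j)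
    \<and> (\<forall>x\<in>insert w Y - {u}. \<forall>i\<in>insert u W. (\<Sum>j\<in>J. B2 j x i) = (\<tau>(w := L)) x)
    \<and> (\<forall>i\<in>insert u W. \<forall>i'\<in>insert u W. (\<Sum>j\<in>J. B2 j i i') = (if i = i' then 0 else L))"
    (is "\<exists>B2. ?P B2") by (rule insert.IH[OF B1(1) u1 W B1(5)[unfolded n1] insert.prems(5) col1 loops1])
  then obtain B2 where P: "?P B2" by blast
  note B2 = P[THEN conjunct1]
    P[THEN conjunct2, THEN conjunct1, rule_format]
    P[THEN conjunct2, THEN conjunct2, THEN conjunct1, rule_format]
    P[THEN conjunct2, THEN conjunct2, THEN conjunct2, THEN conjunct1, rule_format]
    P[THEN conjunct2, THEN conjunct2, THEN conjunct2, THEN conjunct2, THEN conjunct1, rule_format]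
    P[THEN conjunct2, THEN conjunct2, THEN conjunct2, THEN conjunct2, THEN conjunct2, rule_format]
  have Yw: "Y \<union> insert w W = insert w Y \<union> W" by auto
  have wW: "w \<notin> insert u W" using insert.hyps wu by auto
  have ww: "(\<Sum>j\<in>J. B2 j w w) = 0"
    using B2(2)[of _ w w] B1(9) wu by simp
  show ?case unfolding Yw
  proof (intro exI[of _ B2] conjI ballI)
    show "even_system J (insert w Y \<union> W) B2" by (rule B2(1))
  next
    fix j x y assume "j \<in> J" "x \<in> Y - {u}" "y \<in> Y - {u}"
    then show "B2 j x y = B j x y" using B2(2)[of j x y] B1(2)[of j x y] by simp
  next
    fix j x assume "j \<in> J" "x \<in> Y - {u}"
    then show "(\<Sum>y\<in>insert w Y \<union> W. B2 j x y) = (\<Sum>y\<in>Y. B j x y)"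
      using B2(3)[of j x] B1(3)[of j x] by auto
  next
    fix j i assume "j \<in> J" "i \<in> insert u (insert w W)"
    then show "(\<Sum>y\<in>insert w Y \<union> W. B2 j i y) = d j"
      using B2(4)[of j i] B2(3)[of j w] B1(4)[of j] wu by (cases "i = w") auto
  next
    fix x i assume x: "x \<in> Y - {u}" and i: "i \<in> insert u (insert w W)"
    show "(\<Sum>j\<in>J. B2 j x i) = \<tau> x"
    proof (cases "i = w")
      case True
      have "(\<Sum>j\<in>J. B2 j x w) = (\<Sum>j\<in>J. B1 j x w)"
        using x wu by (intro sum.cong refl B2(2)) auto
      then show ?thesis using B1(7)[of x] x True by simp
    next
      case False
      then show ?thesis using B2(5)[of x i] x i w by auto
    qed
  next
    fix i i' assume i: "i \<in> insert u (insert w W)" "i' \<in> insert u (insert w W)"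
    have wi: "(\<Sum>j\<in>J. B2 j w i) = L" "(\<Sum>j\<in>J. B2 j i w) = L" if "i \<in> insert u W" for i
    proof -
      show "(\<Sum>j\<in>J. B2 j w i) = L" using B2(5)[OF _ that, of w] wu by simp
      then show "(\<Sum>j\<in>J. B2 j i w) = L"
        using even_system_sum_sym[OF B2(1), of i w] that u1 by auto
    qed
    consider "i = w" "i' = w" | "i = w" "i' \<in> insert u W" | "i' = w" "i \<in> insert u W"
      | "i \<in> insert u W" "i' \<in> insert u W" using i by blast
    then show "(\<Sum>j\<in>J. B2 j i i') = (if i = i' then 0 else L)"
    proof cases
      case 1 then show ?thesis using ww by simp
    next
      case 2 then show ?thesis using wi(1)[of i'] wW by auto
    next
      case 3 then show ?thesis using wi(2)[of i] wW by auto
    next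
      case 4 then show ?thesis by (rule B2(6))
    qed
  qed
qed

text \<open>\<open>Z u\<close> is the set of pieces of \<open>u\<close>, containing \<open>u\<close>
  itself. The vertices of \<open>U\<close> are detached in turn: while one is split, the unsplit
  ones count as ordinary vertices, and its pieces count as ordinary vertices afterwards. The demands
  \<open>M\<close> therefore change along the induction.\<close>

lemma detach_vertices:
  fixes B :: "'j \<Rightarrow> 'v \<Rightarrow> 'v \<Rightarrow> nat"
  assumes "finite U" and sys: "even_system J Y B" and U: "U \<subseteq> Y"
    and Z: "\<And>u. u \<in> U \<Longrightarrow> card (Z u) = a \<and> Z u \<inter> Y = {u}"
    and disj: "\<And>u u'. u \<in> U \<Longrightarrow> u' \<in> U \<Longrightarrow> u \<noteq> u' \<Longrightarrow> Z u \<inter> Z u' = {}"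
    and a: "0 < a"
    and d: "\<And>j. j \<in> J \<Longrightarrow> even (d j) \<and> 0 < d j"
    and row: "\<And>j u. j \<in> J \<Longrightarrow> u \<in> U \<Longrightarrow> (\<Sum>y\<in>Y. B j u y) = a * d j"
    and col: "\<And>x u. x \<in> Y - U \<Longrightarrow> u \<in> U \<Longrightarrow> (\<Sum>j\<in>J. B j x u) = a * M x"
    and cross: "\<And>u u'. u \<in> U \<Longrightarrow> u' \<in> U \<Longrightarrow> u \<noteq> u' \<Longrightarrow> (\<Sum>j\<in>J. B j u u') = a * (a * m)"
    and loops: "\<And>u. u \<in> U \<Longrightarrow> (\<Sum>j\<in>J. B j u u) = a * (a - 1) * L"
  shows "\<exists>B'. even_system J (Y \<union> (\<Union>u\<in>U. Z u)) B'
    \<and> (\<forall>j\<in>J. \<forall>x\<in>Y - U. \<forall>y\<in>Y - U. B' j x y = B j x y)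
    \<and> (\<forall>j\<in>J. \<forall>x\<in>Y - U. (\<Sum>y\<in>Y \<union> (\<Union>u\<in>U. Z u). B' j x y) = (\<Sum>y\<in>Y. B j x y))
    \<and> (\<forall>j\<in>J. \<forall>u\<in>U. \<forall>i\<in>Z u. (\<Sum>y\<in>Y \<union> (\<Union>u\<in>U. Z u). B' j i y) = d j)
    \<and> (\<forall>x\<in>Y - U. \<forall>u\<in>U. \<forall>i\<in>Z u. (\<Sum>j\<in>J. B' j x i) = M x)
    \<and> (\<forall>u\<in>U. \<forall>u'\<in>U. \<forall>i\<in>Z u. \<forall>i'\<in>Z u'.
        (\<Sum>j\<in>J. B' j i i') = (if u \<noteq> u' then m else if i = i' then 0 else L))"
  using assms
proof (induction U arbitrary: Y B M rule: finite_induct)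
  case empty
  then show ?case by (intro exI[of _ B]) simp
next
  case (insert u U)
  note prems = insert.prems
  define W where "W = Z u - {u}"
  \<comment> \<open>The \<open>a * (a * m)\<close> edges between two vertices of \<open>U\<close>
    first become \<open>a * m\<close> for each piece of \<open>u\<close>, then \<open>m\<close> for
    each pair of pieces once the other vertex is split too; \<open>M1\<close> records this second
    demand.\<close>
  define \<tau> where "\<tau> x = (if x \<in> U then a * m else M x)" for x
  define M1 where "M1 x = (if x \<in> Z u then m else M x)" for x
  have Zu: "card (Z u) = a" "Z u \<inter> Y = {u}" using prems(3)[of u] by auto
  have fZ: "finite (Z u)" using Zu(1) prems(5) by (metis card.infinite less_not_refl)
  have uZ: "u \<in> Z u" "insert u W = Z u" and fW: "finite W"
    using Zu fZ by (auto simp: W_def)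
  have cW: "Suc (card W) = a" unfolding W_def using card_Suc_Diff1[OF fZ uZ(1)] Zu by simp
  have cW': "card W = a - 1" using cW by simp
  have u: "u \<in> Y" using prems(2) by simp
  have W: "W \<inter> Y = {}" using Zu by (auto simp: W_def)
  have UY: "U \<subseteq> Y - {u}" using prems(2) insert.hyps by auto
  have "\<exists>B1. even_system J (Y \<union> W) B1
    \<and> (\<forall>j\<in>J. \<forall>x\<in>Y - {u}. \<forall>y\<in>Y - {u}. B1 j x y = B j x y)
    \<and> (\<forall>j\<in>J. \<forall>x\<in>Y - {u}. (\<Sum>y\<in>Y \<union> W. B1 j x y) = (\<Sum>y\<in>Y. B j x y))
    \<and> (\<forall>j\<in>J. \<forall>i\<in>insert u W. (\<Sum>y\<in>Y \<union> W. B1 j i y) = d j)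
    \<and> (\<forall>x\<in>Y - {u}. \<forall>i\<in>insert u W. (\<Sum>j\<in>J. B1 j x i) = \<tau> x)
    \<and> (\<forall>i\<in>insert u W. \<forall>i'\<in>insert u W. (\<Sum>j\<in>J. B1 j i i') = (if i = i' then 0 else L))"
    (is "\<exists>B1. ?P B1")
  proof (rule detach_vertex[OF fW prems(1) u W])
    show "(\<Sum>y\<in>Y. B j u y) = Suc (card W) * d j" if "j \<in> J" for j
      using prems(7)[OF that, of u] cW by simp
    show "even (d j) \<and> 0 < d j" if "j \<in> J" for j using prems(6) that by blast
    show "(\<Sum>j\<in>J. B j x u) = Suc (card W) * \<tau> x" if "x \<in> Y - {u}" for x
      using prems(8)[of x u] prems(9)[of x u] that insert.hyps(2) unfolding cW \<tau>_def by auto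
    show "(\<Sum>j\<in>J. B j u u) = Suc (card W) * card W * L"
    proof -
      have "(\<Sum>j\<in>J. B j u u) = a * (a - 1) * L" using prems(10)[of u] by blast
      then show ?thesis by (simp only: cW' Suc_diff_1[OF prems(5)])
    qed
  qed
  then obtain B1 where PB1: "?P B1" by blast
  note B1 = PB1[unfolded uZ(2), THEN conjunct1]
    PB1[unfolded uZ(2), THEN conjunct2, THEN conjunct1, rule_format]
    PB1[unfolded uZ(2), THEN conjunct2, THEN conjunct2, THEN conjunct1, rule_format]
    PB1[unfolded uZ(2), THEN conjunct2, THEN conjunct2, THEN conjunct2, THEN conjunct1, rule_format]
    PB1[unfolded uZ(2), THEN conjunct2, THEN conjunct2, THEN conjunct2, THEN conjunct2, THEN conjunct1, rule_format]
    PB1[unfolded uZ(2), THEN conjunct2, THEN conjunct2, THEN conjunct2, THEN conjunct2, THEN conjunct2, rule_format]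
  define Y1 where "Y1 = Y \<union> W"
  have Y1: "Y1 - U = (Y - insert u U) \<union> Z u"
  proof -
    have "Z u \<inter> U = {}" using Zu UY by auto
    then show ?thesis using uZ u by (auto simp: Y1_def W_def)
  qed
  have un: "Y \<union> (\<Union>u\<in>insert u U. Z u) = Y1 \<union> (\<Union>u\<in>U. Z u)"
    using uZ u by (auto simp: Y1_def)
  have sumB1: "(\<Sum>j\<in>J. B1 j x y) = (\<Sum>j\<in>J. B j x y)" if "x \<in> Y - {u}" "y \<in> Y - {u}" for x y
    using that by (intro sum.cong refl B1(2))
  have "\<exists>B2. even_system J (Y1 \<union> (\<Union>u\<in>U. Z u)) B2
    \<and> (\<forall>j\<in>J. \<forall>x\<in>Y1 - U. \<forall>y\<in>Y1 - U. B2 j x y = B1 j x y)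
    \<and> (\<forall>j\<in>J. \<forall>x\<in>Y1 - U. (\<Sum>y\<in>Y1 \<union> (\<Union>u\<in>U. Z u). B2 j x y) = (\<Sum>y\<in>Y1. B1 j x y))
    \<and> (\<forall>j\<in>J. \<forall>u\<in>U. \<forall>i\<in>Z u. (\<Sum>y\<in>Y1 \<union> (\<Union>u\<in>U. Z u). B2 j i y) = d j)
    \<and> (\<forall>x\<in>Y1 - U. \<forall>u\<in>U. \<forall>i\<in>Z u. (\<Sum>j\<in>J. B2 j x i) = M1 x)
    \<and> (\<forall>u\<in>U. \<forall>u'\<in>U. \<forall>i\<in>Z u. \<forall>i'\<in>Z u'.
        (\<Sum>j\<in>J. B2 j i i') = (if u \<noteq> u' then m else if i = i' then 0 else L))"
    (is "\<exists>B2. ?P B2")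
  proof (rule insert.IH)
    show "even_system J Y1 B1" unfolding Y1_def by (rule B1(1))
    show "U \<subseteq> Y1" using UY by (auto simp: Y1_def)
    show "card (Z v) = a \<and> Z v \<inter> Y1 = {v}" if "v \<in> U" for v
    proof -
      have "Z v \<inter> Z u = {}" using prems(4)[of v u] that insert.hyps(2) by auto
      then show ?thesis using prems(3)[of v] that by (auto simp: Y1_def W_def)
    qed
    show "Z v \<inter> Z v' = {}" if "v \<in> U" "v' \<in> U" "v \<noteq> v'" for v v'
      using prems(4)[of v v'] that by simp
    show "0 < a" by (rule prems(5))
    show "even (d j) \<and> 0 < d j" if "j \<in> J" for j using prems(6) that by blast
    show "(\<Sum>y\<in>Y1. B1 j v y) = a * d j" if "j \<in> J" "v \<in> U" for j v
      using B1(3)[OF that(1), of v] prems(7)[OF that(1), of v] that(2) UY by (auto simp: Y1_def)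
    show "(\<Sum>j\<in>J. B1 j x v) = a * M1 x" if x: "x \<in> Y1 - U" and v: "v \<in> U" for x v
    proof (cases "x \<in> Z u")
      case True
      have "(\<Sum>j\<in>J. B1 j x v) = (\<Sum>j\<in>J. B1 j v x)"
        using x v UY by (intro even_system_sum_sym[OF B1(1)]) (auto simp: Y1_def)
      also have "\<dots> = \<tau> v" using B1(5)[of v x] v UY True by blast
      finally show ?thesis using True v by (simp add: \<tau>_def M1_def)
    next
      case False
      then have xY: "x \<in> Y - insert u U" using x unfolding Y1 by blast
      then have "(\<Sum>j\<in>J. B1 j x v) = (\<Sum>j\<in>J. B j x v)" using v UY by (intro sumB1) auto
      then show ?thesis using prems(8)[OF xY, of v] v False by (simp add: M1_def)
    qed
    show "(\<Sum>j\<in>J. B1 j v v') = a * (a * m)" if "v \<in> U" "v' \<in> U" "v \<noteq> v'" for v v'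
      using sumB1[of v v'] prems(9)[of v v'] that UY by auto
    show "(\<Sum>j\<in>J. B1 j v v) = a * (a - 1) * L" if "v \<in> U" for v
      using sumB1[of v v] prems(10)[of v] that UY by auto
  qed
  then obtain B2 where PB2: "?P B2" by blast
  note B2 = PB2[THEN conjunct1]
    PB2[THEN conjunct2, THEN conjunct1, rule_format]
    PB2[THEN conjunct2, THEN conjunct2, THEN conjunct1, rule_format]
    PB2[THEN conjunct2, THEN conjunct2, THEN conjunct2, THEN conjunct1, rule_format]
    PB2[THEN conjunct2, THEN conjunct2, THEN conjunct2, THEN conjunct2, THEN conjunct1, rule_format]
    PB2[THEN conjunct2, THEN conjunct2, THEN conjunct2, THEN conjunct2, THEN conjunct2, rule_format]
  have sumB2: "(\<Sum>j\<in>J. B2 j x y) = (\<Sum>j\<in>J. B1 j x y)" if "x \<in> Y1 - U" "y \<in> Y1 - U" for x y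
    using that by (intro sum.cong refl B2(2))
  have Zu_sub: "i \<in> Y1 - U" if "i \<in> Z u" for i using that unfolding Y1 by blast
  show ?case unfolding un
  proof (intro exI[of _ B2] conjI ballI)
    show "even_system J (Y1 \<union> (\<Union>u\<in>U. Z u)) B2" by (rule B2(1))
  next
    fix j x y assume "j \<in> J" "x \<in> Y - insert u U" "y \<in> Y - insert u U"
    then show "B2 j x y = B j x y" using B2(2)[of j x y] B1(2)[of j x y] unfolding Y1 by simp
  next
    fix j x assume "j \<in> J" "x \<in> Y - insert u U"
    then show "(\<Sum>y\<in>Y1 \<union> (\<Union>u\<in>U. Z u). B2 j x y) = (\<Sum>y\<in>Y. B j x y)"
      using B2(3)[of j x] B1(3)[of j x] unfolding Y1 by (simp add: Y1_def)
  next
    fix j v i assume *: "j \<in> J" "v \<in> insert u U" "i \<in> Z v"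
    show "(\<Sum>y\<in>Y1 \<union> (\<Union>u\<in>U. Z u). B2 j i y) = d j"
    proof (cases "v = u")
      case True
      then show ?thesis using B2(3)[OF *(1) Zu_sub, of i] B1(4)[of j i] * by (simp add: Y1_def)
    next
      case False
      then show ?thesis using B2(4)[of j v i] * by simp
    qed
  next
    fix x v i assume *: "x \<in> Y - insert u U" "v \<in> insert u U" "i \<in> Z v"
    have x: "x \<in> Y1 - U" using * unfolding Y1 by blast
    have xZ: "x \<notin> Z u" using * Zu by auto
    show "(\<Sum>j\<in>J. B2 j x i) = M x"
    proof (cases "v = u")
      case True
      then show ?thesis using sumB2[OF x Zu_sub, of i] B1(5)[of x i] * by (auto simp: \<tau>_def)
    next
      case False
      then show ?thesis using B2(5)[OF x, of v i] * xZ by (simp add: M1_def)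
    qed
  next
    fix v v' i i' assume *: "v \<in> insert u U" "v' \<in> insert u U" "i \<in> Z v" "i' \<in> Z v'"
    have cross: "(\<Sum>j\<in>J. B2 j i i') = m" "(\<Sum>j\<in>J. B2 j i' i) = m"
      if "v \<in> U" "i \<in> Z v" "i' \<in> Z u" for v i i'
    proof -
      show "(\<Sum>j\<in>J. B2 j i' i) = m" using B2(5)[OF Zu_sub that(1,2), of i'] that by (simp add: M1_def)
      then show "(\<Sum>j\<in>J. B2 j i i') = m"
        using even_system_sum_sym[OF B2(1), of i i'] that Zu_sub by auto
    qed
    consider "v = u" "v' = u" | "v \<in> U" "v' = u" | "v = u" "v' \<in> U" | "v \<in> U" "v' \<in> U"
      using * by blast
    then show "(\<Sum>j\<in>J. B2 j i i') = (if v \<noteq> v' then m else if i = i' then 0 else L)"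
    proof cases
      case 1
      then show ?thesis using sumB2[OF Zu_sub Zu_sub, of i i'] B1(6)[of i i'] * by simp
    next
      case 2
      then show ?thesis using cross[of v i i'] * insert.hyps(2) by auto
    next
      case 3
      then show ?thesis using cross[of v' i' i] * insert.hyps(2) by auto
    next
      case 4
      then show ?thesis using B2(6)[of v v' i i'] * by blast
    qed
  qed
qed

section \<open>Paths and cycles in multigraphs\<close>

definition mdegree :: "('v, 'e) mgraph \<Rightarrow> 'v \<Rightarrow> nat" where
  "mdegree G v = card {e \<in> edges G. v \<in> ends G e}"

definition finite_mgraph :: "('v, 'e) mgraph \<Rightarrow> bool" where
  "finite_mgraph G \<longleftrightarrow> finite (verts G) \<and> finite (edges G) \<and> loopless_mgraph G"

definition connected_mgraph :: "('v, 'e) mgraph \<Rightarrow> bool" where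
  "connected_mgraph G \<longleftrightarrow> (\<forall>u\<in>verts G. \<forall>v\<in>verts G. (u, v) \<in> (adjacency G)\<^sup>*)"

definition path_in :: "('v, 'e) mgraph \<Rightarrow> 'v list \<Rightarrow> 'e list \<Rightarrow> bool" where
  "path_in G vs es \<longleftrightarrow> distinct vs \<and> set vs \<subseteq> verts G \<and> distinct es \<and> set es \<subseteq> edges G
     \<and> length vs = Suc (length es) \<and> (\<forall>i<length es. ends G (es ! i) = {vs ! i, vs ! Suc i})"

lemma card_le_mdegree:
  assumes "finite (edges G)" "A \<subseteq> edges G" "\<And>e. e \<in> A \<Longrightarrow> v \<in> ends G e"
  shows "card A \<le> mdegree G v"
  unfolding mdegree_def using assms by (intro card_mono) auto

lemma sum_mdegree:
  assumes "finite (edges G)" "finite A"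
  shows "(\<Sum>v\<in>A. mdegree G v) = (\<Sum>e\<in>edges G. card (ends G e \<inter> A))"
proof -
  have "(\<Sum>v\<in>A. mdegree G v) = (\<Sum>v\<in>A. \<Sum>e\<in>edges G. of_bool (v \<in> ends G e))"
    using assms by (simp add: mdegree_def Int_def)
  also have "\<dots> = (\<Sum>e\<in>edges G. \<Sum>v\<in>A. of_bool (v \<in> ends G e))" by (rule sum.swap)
  also have "\<dots> = (\<Sum>e\<in>edges G. card (ends G e \<inter> A))"
    using assms by (simp add: Int_commute)
  finally show ?thesis .
qed

lemma handshake:
  assumes "finite_mgraph G"
  shows "(\<Sum>v\<in>verts G. mdegree G v) = 2 * card (edges G)"
proof -
  have "card (ends G e \<inter> verts G) = 2" if "e \<in> edges G" for e
    using assms that by (auto simp: finite_mgraph_def loopless_mgraph_def Int_absorb2)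
  then show ?thesis using assms by (simp add: sum_mdegree finite_mgraph_def)
qed

lemma sym_adjacency: "sym (adjacency G)"
  by (auto simp: sym_def adjacency_def insert_commute)

lemma reachable_in_verts:
  assumes "(u, v) \<in> (adjacency G)\<^sup>*" "u \<in> verts G"
  shows "v \<in> verts G"
  using assms by (induction) (auto simp: adjacency_def)

lemma last_eq_nth: "length xs = Suc n \<Longrightarrow> last xs = xs ! n"
  by (subst last_conv_nth) auto

lemma path_in_extend:
  assumes "path_in G vs es" "e \<in> edges G" "e \<notin> set es" "x \<in> verts G" "x \<notin> set vs"
    "ends G e = {last vs, x}"
  shows "path_in G (vs @ [x]) (es @ [e])"
proof -
  have vs: "length vs = Suc (length es)" "\<And>i. i < length es \<Longrightarrow> ends G (es ! i) = {vs ! i, vs ! Suc i}"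
    using assms(1) by (auto simp: path_in_def)
  have "ends G ((es @ [e]) ! i) = {(vs @ [x]) ! i, (vs @ [x]) ! Suc i}"
    if "i < length (es @ [e])" for i
  proof (cases "i < length es")
    case True
    then show ?thesis using vs by (simp add: nth_append)
  next
    case False
    then have "i = length es" using that by simp
    then show ?thesis using assms(6) vs(1) last_eq_nth[OF vs(1)] by (simp add: nth_append)
  qed
  then show ?thesis using assms(1-5) unfolding path_in_def by simp
qed

lemma longest_path_from:
  assumes fin: "finite_mgraph G" and s: "s \<in> verts G"
    and deg: "\<And>v. v \<in> verts G \<Longrightarrow> mdegree G v \<le> 2"
  obtains vs es where "path_in G vs es" "vs ! 0 = s"
    "\<And>e v. e \<in> edges G \<Longrightarrow> e \<notin> set es \<Longrightarrow> v \<in> set vs \<Longrightarrow> v \<in> ends G e \<Longrightarrow>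
      es \<noteq> [] \<and> (v = s \<or> v = last vs \<and> ends G e = {last vs, s})"
proof -
  define P where "P n \<longleftrightarrow> (\<exists>vs es. path_in G vs es \<and> vs ! 0 = s \<and> length es = n)" for n
  have P0: "P 0" unfolding P_def path_in_def using s by (intro exI[of _ "[s]"] exI[of _ "[]"]) simp
  have bound: "\<forall>n. P n \<longrightarrow> n < Suc (card (verts G))"
  proof (intro allI impI)
    fix n assume "P n"
    then obtain vs es where p: "path_in G vs es" "length es = n" by (auto simp: P_def)
    then have "length vs = card (set vs)" by (simp add: path_in_def distinct_card)
    also have "\<dots> \<le> card (verts G)"
      using p fin by (intro card_mono) (auto simp: path_in_def finite_mgraph_def)
    finally show "n < Suc (card (verts G))" using p by (simp add: path_in_def)
  qed
  obtain n where n: "P n" "\<And>m. P m \<Longrightarrow> m \<le> n"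
    using ex_has_greatest_nat[where P = P and f = "\<lambda>n. n", OF P0 bound] by metis
  from n(1) obtain vs es where p: "path_in G vs es" and vs0: "vs ! 0 = s"
    and max: "\<And>m. P m \<Longrightarrow> m \<le> length es" using n(2) unfolding P_def by metis
  have len: "length vs = Suc (length es)" and dvs: "distinct vs" and des: "distinct es"
    and ends: "\<And>i. i < length es \<Longrightarrow> ends G (es ! i) = {vs ! i, vs ! Suc i}"
    and vsG: "set vs \<subseteq> verts G" and esG: "set es \<subseteq> edges G"
    using p by (auto simp: path_in_def)
  have lst: "last vs = vs ! length es" using len by (rule last_eq_nth)
  have inner: False if e: "e \<in> edges G" "e \<notin> set es" and i: "0 < i" "i < length es" and v: "vs ! i \<in> ends G e"
    for e i
  proof -
    have "es ! (i - 1) \<noteq> es ! i" using i des by (simp add: nth_eq_iff_index_eq)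
    moreover have mem: "es ! (i - 1) \<in> set es" "es ! i \<in> set es" using i by auto
    moreover from mem have "es ! (i - 1) \<noteq> e" "es ! i \<noteq> e" using e(2) by metis+
    ultimately have "card {es ! (i - 1), es ! i, e} = 3" by simp
    moreover have "card {es ! (i - 1), es ! i, e} \<le> mdegree G (vs ! i)"
    proof (rule card_le_mdegree)
      show "finite (edges G)" using fin by (simp add: finite_mgraph_def)
      show "{es ! (i - 1), es ! i, e} \<subseteq> edges G" using e mem esG by auto
      fix e' assume "e' \<in> {es ! (i - 1), es ! i, e}"
      then show "vs ! i \<in> ends G e'" using v ends[of i] ends[of "i - 1"] i by auto
    qed
    moreover have "vs ! i \<in> verts G" using vsG i len by auto
    ultimately show False using deg[of "vs ! i"] by simp
  qed
  have at_last: "es \<noteq> [] \<and> ends G e = {last vs, s}"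
    if e: "e \<in> edges G" "e \<notin> set es" and v: "last vs \<in> ends G e" for e
  proof -
    have "card (ends G e) = 2" and sub: "ends G e \<subseteq> verts G"
      using fin e by (auto simp: finite_mgraph_def loopless_mgraph_def)
    then obtain x where x: "ends G e = {last vs, x}" "x \<noteq> last vs"
      using v by (auto simp: card_2_iff doubleton_eq_iff)
    have "x \<in> set vs"
    proof (rule ccontr)
      assume "x \<notin> set vs"
      then have "path_in G (vs @ [x]) (es @ [e])" using path_in_extend[OF p e] x sub by auto
      then have "P (Suc (length es))" unfolding P_def using vs0 len
        by (intro exI[of _ "vs @ [x]"] exI[of _ "es @ [e]"]) (simp add: nth_append)
      then show False using max by fastforce
    qed
    then obtain i where i: "i < Suc (length es)" "x = vs ! i" using len by (auto simp: in_set_conv_nth)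
    then have "i \<noteq> length es" using x lst by auto
    then have "i < length es" using i by simp
    then have "i = 0" using inner[OF e, of i] x i by auto
    then show ?thesis using i x vs0 \<open>i < length es\<close> by auto
  qed
  show thesis
  proof (rule that[OF p vs0])
    fix e v assume e: "e \<in> edges G" "e \<notin> set es" and v: "v \<in> set vs" "v \<in> ends G e"
    then obtain i where i: "i < Suc (length es)" "v = vs ! i" using len by (auto simp: in_set_conv_nth)
    consider "i = length es" | "i = 0" "i < length es" | "0 < i" "i < length es" using i by linarith
    then show "es \<noteq> [] \<and> (v = s \<or> v = last vs \<and> ends G e = {last vs, s})"
    proof cases
      case 1
      then show ?thesis using at_last[OF e] i v lst by auto
    next
      case 2
      then show ?thesis using i vs0 by auto
    next
      case 3
      then show ?thesis using inner[OF e] i v by blast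
    qed
  qed
qed

text \<open>A nonempty vertex set that no edge leaves is everything in a connected graph.
  \<open>F\<close> is either the edge set of the path or that set with a closing edge added, so that
  paths and cycles are both served.\<close>

lemma path_in_spans:
  assumes fin: "finite_mgraph G" and conn: "connected_mgraph G" and p: "path_in G vs es"
    and F: "\<And>e v. e \<in> edges G \<Longrightarrow> v \<in> set vs \<Longrightarrow> v \<in> ends G e \<Longrightarrow> e \<in> F"
    and Fends: "\<And>e. e \<in> F \<Longrightarrow> ends G e \<subseteq> set vs" and FG: "F \<subseteq> edges G"
  shows "set vs = verts G \<and> F = edges G"
proof -
  have vs: "set vs \<subseteq> verts G" "vs \<noteq> []" using p by (auto simp: path_in_def)
  have "adjacency G `` set vs \<subseteq> set vs"
  proof
    fix y assume "y \<in> adjacency G `` set vs"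
    then obtain x e where "x \<in> set vs" "e \<in> edges G" "ends G e = {x, y}" by (auto simp: adjacency_def)
    then show "y \<in> set vs" using F[of e x] Fends[of e] by auto
  qed
  then have cl: "(adjacency G)\<^sup>* `` set vs = set vs" by (rule Image_closed_trancl)
  have "verts G \<subseteq> set vs"
  proof
    fix y assume "y \<in> verts G"
    moreover have "hd vs \<in> set vs" "hd vs \<in> verts G" using vs by auto
    ultimately have "(hd vs, y) \<in> (adjacency G)\<^sup>*" using conn by (simp add: connected_mgraph_def)
    then show "y \<in> set vs" using cl \<open>hd vs \<in> set vs\<close> by blast
  qed
  then have eq: "set vs = verts G" using vs by simp
  have "edges G \<subseteq> F"
  proof
    fix e assume e: "e \<in> edges G"
    then have "ends G e \<subseteq> verts G" "card (ends G e) = 2"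
      using fin by (auto simp: finite_mgraph_def loopless_mgraph_def)
    then obtain v where "v \<in> ends G e" "v \<in> set vs" using eq by (auto simp: card_2_iff)
    then show "e \<in> F" using F e by blast
  qed
  then show ?thesis using eq FG by simp
qed

lemma path_in_ends:
  assumes "path_in G vs es" "e \<in> set es"
  shows "ends G e \<subseteq> set vs"
proof -
  obtain i where i: "i < length es" "e = es ! i" using assms(2) by (metis in_set_conv_nth)
  then have "ends G e = {vs ! i, vs ! Suc i}" "Suc i < length vs"
    using assms(1) by (auto simp: path_in_def)
  then show ?thesis by simp
qed

lemma is_pathI:
  assumes fin: "finite_mgraph G" and conn: "connected_mgraph G"
    and deg: "\<And>v. v \<in> verts G \<Longrightarrow> mdegree G v \<le> 2" and s: "s \<in> verts G" "mdegree G s \<le> 1"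
  shows "is_path G"
proof -
  obtain vs es where p: "path_in G vs es" and vs0: "vs ! 0 = s" and
    unused: "\<And>e v. e \<in> edges G \<Longrightarrow> e \<notin> set es \<Longrightarrow> v \<in> set vs \<Longrightarrow> v \<in> ends G e \<Longrightarrow>
      es \<noteq> [] \<and> (v = s \<or> v = last vs \<and> ends G e = {last vs, s})"
    using longest_path_from[OF fin s(1) deg] by blast
  have used: "e \<in> set es" if e: "e \<in> edges G" "v \<in> set vs" "v \<in> ends G e" for e v
  proof (rule ccontr)
    assume "e \<notin> set es"
    with unused e have es: "es \<noteq> []" "s \<in> ends G e" by blast+
    then have "es ! 0 \<in> set es" "s \<in> ends G (es ! 0)" using p vs0 by (auto simp: path_in_def)
    then have "card {es ! 0, e} \<le> mdegree G s"
      using e es p fin by (intro card_le_mdegree) (auto simp: path_in_def finite_mgraph_def)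
    moreover have "es ! 0 \<noteq> e" using \<open>es ! 0 \<in> set es\<close> \<open>e \<notin> set es\<close> by metis
    then have "card {es ! 0, e} = 2" by simp
    ultimately show False using s by simp
  qed
  have "set vs = verts G \<and> set es = edges G"
    using p by (intro path_in_spans[OF fin conn p used path_in_ends[OF p]]) (auto simp: path_in_def)
  then show ?thesis using p unfolding is_path_def path_in_def
    by (intro exI[of _ vs] exI[of _ es]) simp
qed

text \<open>The last vertex of a longest path from \<open>s\<close> has degree 2 but only one path
  edge. Its other edge closes the path at \<open>s\<close>, and that uses up the degree of
  \<open>s\<close> as well.\<close>

lemma is_cycleI:
  assumes fin: "finite_mgraph G" and conn: "connected_mgraph G"
    and deg: "\<And>v. v \<in> verts G \<Longrightarrow> mdegree G v = 2" and s: "s \<in> verts G"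
  shows "is_cycle G"
proof -
  have deg': "\<And>v. v \<in> verts G \<Longrightarrow> mdegree G v \<le> 2" using deg by simp
  obtain vs es where p: "path_in G vs es" and vs0: "vs ! 0 = s" and
    unused: "\<And>e v. e \<in> edges G \<Longrightarrow> e \<notin> set es \<Longrightarrow> v \<in> set vs \<Longrightarrow> v \<in> ends G e \<Longrightarrow>
      es \<noteq> [] \<and> (v = s \<or> v = last vs \<and> ends G e = {last vs, s})"
    using longest_path_from[OF fin s deg'] by blast
  have fE: "finite (edges G)" using fin by (simp add: finite_mgraph_def)
  have len: "length vs = Suc (length es)" and dvs: "distinct vs" and des: "distinct es"
    and ends: "\<And>i. i < length es \<Longrightarrow> ends G (es ! i) = {vs ! i, vs ! Suc i}"
    and vsG: "set vs \<subseteq> verts G" and esG: "set es \<subseteq> edges G"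
    using p by (auto simp: path_in_def)
  have lst: "last vs = vs ! length es" using len by (rule last_eq_nth)
  have svs: "s \<in> set vs" "last vs \<in> set vs" using len vs0 lst by auto
  have es: "es \<noteq> []"
  proof
    assume "es = []"
    have "{e \<in> edges G. s \<in> ends G e} \<noteq> {}"
      using deg[OF s] unfolding mdegree_def by (metis card.empty zero_neq_numeral)
    then obtain e where "e \<in> edges G" "s \<in> ends G e" by blast
    then show False using unused[of e s] svs \<open>es = []\<close> by simp
  qed
  have last_s: "last vs \<noteq> s" using es dvs len by (simp add: lst vs0[symmetric] nth_eq_iff_index_eq)
  have "\<exists>e. e \<in> edges G \<and> e \<notin> set es \<and> last vs \<in> ends G e"
  proof (rule ccontr)
    assume no: "\<not> ?thesis"
    have "{e \<in> edges G. last vs \<in> ends G e} \<subseteq> {es ! (length es - 1)}"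
    proof
      fix e assume "e \<in> {e \<in> edges G. last vs \<in> ends G e}"
      then obtain i where i: "i < length es" "e = es ! i" "last vs \<in> ends G e"
        using no by (auto simp: in_set_conv_nth)
      then have "vs ! length es = vs ! i \<or> vs ! length es = vs ! Suc i" using ends lst by auto
      then have "Suc i = length es" using i dvs len by (auto simp: nth_eq_iff_index_eq)
      then have "length es - 1 = i" by simp
      then show "e \<in> {es ! (length es - 1)}" using i by simp
    qed
    then have "mdegree G (last vs) \<le> card {es ! (length es - 1)}"
      unfolding mdegree_def by (intro card_mono) auto
    then show False using deg[of "last vs"] svs vsG by auto
  qed
  then obtain e' where e': "e' \<in> edges G" "e' \<notin> set es" "last vs \<in> ends G e'" by blast
  then have e'_ends: "ends G e' = {last vs, s}" using unused svs last_s by blast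
  have used: "e \<in> insert e' (set es)" if e: "e \<in> edges G" "v \<in> set vs" "v \<in> ends G e" for e v
  proof (rule ccontr)
    assume ne: "e \<notin> insert e' (set es)"
    then have "s \<in> ends G e" using unused e by blast
    moreover have "s \<in> ends G (es ! 0)" "es ! 0 \<in> set es" using ends[of 0] es vs0 by auto
    ultimately have "card {es ! 0, e', e} \<le> mdegree G s"
      using e e' e'_ends esG fE by (intro card_le_mdegree) auto
    moreover have "es ! 0 \<noteq> e'" "es ! 0 \<noteq> e" "e' \<noteq> e" using ne e' \<open>es ! 0 \<in> set es\<close> by blast+
    then have "card {es ! 0, e', e} = 3" by simp
    ultimately show False using deg[OF s] by simp
  qed
  have "ends G e \<subseteq> set vs" if "e \<in> insert e' (set es)" for e
    using that path_in_ends[OF p] e'_ends svs by auto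
  from path_in_spans[OF fin conn p used this] e' esG
  have eq: "set vs = verts G" "set (es @ [e']) = edges G" by auto
  have "ends G ((es @ [e']) ! i) = {vs ! i, vs ! (Suc i mod length (es @ [e']))}"
    if "i < length (es @ [e'])" for i
  proof (cases "i < length es")
    case True
    then show ?thesis using ends by (simp add: nth_append)
  next
    case False
    then have "i = length es" using that by simp
    then show ?thesis using e'_ends lst vs0 by (simp add: nth_append)
  qed
  moreover have "distinct (es @ [e'])" "length vs = length (es @ [e'])" "length (es @ [e']) \<ge> 2"
    using des e' len es by (auto simp: Suc_le_eq)
  ultimately show ?thesis unfolding is_cycle_def using eq dvs
    by (intro exI[of _ vs] exI[of _ "es @ [e']"]) simp
qed

lemma is_path_properties:
  assumes P: "is_path P"
  shows "finite (edges P)" "card (verts P) = Suc (card (edges P))"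
    "\<And>v. v \<in> verts P \<Longrightarrow> mdegree P v \<le> 2" "\<exists>v\<in>verts P. mdegree P v \<le> 1"
proof -
  obtain vs es where vs: "distinct vs" "set vs = verts P" and es: "distinct es" "set es = edges P"
    and len: "length vs = Suc (length es)"
    and ends: "\<And>i. i < length es \<Longrightarrow> ends P (es ! i) = {vs ! i, vs ! Suc i}"
    using P unfolding is_path_def by blast
  show "finite (edges P)" using es by (metis List.finite_set)
  show "card (verts P) = Suc (card (edges P))" using vs es len by (metis distinct_card)
  have inc: "0 < i \<and> e = es ! (i - 1) \<or> e = es ! i"
    if i: "i < length vs" and e: "e \<in> edges P" "vs ! i \<in> ends P e" for i e
  proof -
    obtain l where l: "l < length es" "e = es ! l"
      using e(1) unfolding es(2)[symmetric] by (metis in_set_conv_nth)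
    then have "vs ! i = vs ! l \<or> vs ! i = vs ! Suc l" using ends e by auto
    then have "i = l \<or> i = Suc l" using l i vs len by (auto simp: nth_eq_iff_index_eq)
    then show ?thesis using l by auto
  qed
  show "mdegree P v \<le> 2" if v: "v \<in> verts P" for v
  proof -
    obtain i where i: "i < length vs" "v = vs ! i" using v unfolding vs(2)[symmetric] in_set_conv_nth by blast
    have "{e \<in> edges P. v \<in> ends P e} \<subseteq> {es ! (i - 1), es ! i}" using inc[OF i(1)] i by auto
    then have "mdegree P v \<le> card {es ! (i - 1), es ! i}" unfolding mdegree_def by (intro card_mono) auto
    also have "\<dots> \<le> 2" by (simp add: card_insert_if)
    finally show ?thesis .
  qed
  have "{e \<in> edges P. vs ! 0 \<in> ends P e} \<subseteq> {es ! 0}" using inc[of 0] len by auto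
  then have "mdegree P (vs ! 0) \<le> card {es ! 0}" unfolding mdegree_def by (intro card_mono) auto
  moreover have "vs ! 0 \<in> verts P" using vs len by (metis nth_mem zero_less_Suc)
  ultimately show "\<exists>v\<in>verts P. mdegree P v \<le> 1" by auto
qed

lemma is_cycle_properties:
  assumes C: "is_cycle C"
  shows "connected_mgraph C" "\<And>v. v \<in> verts C \<Longrightarrow> mdegree C v = 2"
proof -
  obtain vs es where vs: "distinct vs" "set vs = verts C" and es: "distinct es" "set es = edges C"
    and len: "length vs = length es" "length es \<ge> 2"
    and ends: "\<And>i. i < length es \<Longrightarrow> ends C (es ! i) = {vs ! i, vs ! (Suc i mod length es)}"
    using C unfolding is_cycle_def by blast
  define n where "n = length es"
  have n: "2 \<le> n" "length vs = n" "length es = n" using len by (auto simp: n_def)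
  have reach: "(vs ! 0, vs ! i) \<in> (adjacency C)\<^sup>*" if "i < n" for i
    using that
  proof (induction i)
    case (Suc i)
    then have "ends C (es ! i) = {vs ! i, vs ! Suc i}" using ends[of i] n by simp
    moreover have "es ! i \<in> edges C" using es Suc n by (metis Suc_lessD nth_mem)
    moreover have "vs ! i \<in> verts C" "vs ! Suc i \<in> verts C" using vs Suc n by (metis Suc_lessD nth_mem)+
    ultimately have "(vs ! i, vs ! Suc i) \<in> adjacency C" by (auto simp: adjacency_def)
    with Suc show ?case by (auto intro: rtrancl_into_rtrancl)
  qed simp
  have idx: "\<exists>i<n. v = vs ! i" if "v \<in> verts C" for v
    using that unfolding vs(2)[symmetric] in_set_conv_nth n(2) by blast
  have es_mem: "es ! i \<in> edges C" if "i < n" for i using es(2) n(3) that nth_mem by blast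
  show "connected_mgraph C" unfolding connected_mgraph_def
  proof (intro ballI)
    fix u v assume "u \<in> verts C" "v \<in> verts C"
    then obtain i i' where "i < n" "u = vs ! i" "i' < n" "v = vs ! i'"
      using idx by blast
    then show "(u, v) \<in> (adjacency C)\<^sup>*"
      using reach[of i] reach[of i'] sym_rtrancl[OF sym_adjacency[of C]]
      by (metis rtrancl_trans symD)
  qed
  show "mdegree C v = 2" if v: "v \<in> verts C" for v
  proof -
    obtain i where i: "i < n" "v = vs ! i" using idx[OF v] by blast
    \<comment> \<open>Cyclic predecessor of \<open>i\<close>: the edges at \<open>vs ! i\<close> are
      those with index \<open>i\<close> and \<open>i0\<close>, two different ones because
      \<open>n \<ge> 2\<close>.\<close>
    define i0 where "i0 = (if i = 0 then n - 1 else i - 1)"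
    have i0: "i0 < n" "i0 \<noteq> i" using i n by (auto simp: i0_def)
    have pred: "i = Suc l mod n \<longleftrightarrow> l = i0" if "l < n" for l
    proof (cases "Suc l = n")
      case True then show ?thesis using n i by (auto simp: i0_def)
    next
      case False then show ?thesis using that n i by (auto simp: i0_def)
    qed
    have "e \<in> edges C \<and> v \<in> ends C e \<longleftrightarrow> e \<in> {es ! i, es ! i0}" for e
    proof
      assume "e \<in> edges C \<and> v \<in> ends C e"
      then obtain l where l: "l < n" "e = es ! l" "v \<in> ends C e"
        unfolding es(2)[symmetric] in_set_conv_nth n(3) by blast
      then have "vs ! i = vs ! l \<or> vs ! i = vs ! (Suc l mod n)" using ends[of l] i n by auto
      moreover have "Suc l mod n < n" using n by (intro mod_less_divisor) simp
      ultimately have "i = l \<or> i = Suc l mod n" using l i vs n by (auto simp: nth_eq_iff_index_eq)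
      then show "e \<in> {es ! i, es ! i0}" using pred l by auto
    next
      assume "e \<in> {es ! i, es ! i0}"
      moreover have "es ! i \<in> edges C" "es ! i0 \<in> edges C" using es_mem i i0 by blast+
      moreover have "v \<in> ends C (es ! i)" using ends[of i] i n by simp
      moreover have "v \<in> ends C (es ! i0)" using ends[of i0] i0 pred[of i0] i n by simp
      ultimately show "e \<in> edges C \<and> v \<in> ends C e" by blast
    qed
    then have "{e \<in> edges C. v \<in> ends C e} = {es ! i, es ! i0}" by blast
    then have "mdegree C v = card {es ! i, es ! i0}" by (simp only: mdegree_def)
    also have "es ! i \<noteq> es ! i0" using i i0 es n by (simp add: nth_eq_iff_index_eq)
    then have "card {es ! i, es ! i0} = 2" by simp
    finally show ?thesis .
  qed
qed

section \<open>Subgraphs and their components\<close>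

lemma finite_mgraph_induced:
  assumes "finite_mgraph G" "V \<subseteq> verts G"
  shows "finite_mgraph (induced_subgraph G V)"
  using assms finite_subset
  by (auto simp: finite_mgraph_def loopless_mgraph_def induced_subgraph_def)

lemma finite_mgraph_color_subgraph:
  "finite_mgraph G \<Longrightarrow> finite_mgraph (color_subgraph G c j)"
  by (auto simp: finite_mgraph_def loopless_mgraph_def color_subgraph_def)

lemma incident_edge_neighbour:
  assumes "finite_mgraph G" "e \<in> edges G" "v \<in> ends G e"
  obtains x where "ends G e = {v, x}" "v \<noteq> x" "(v, x) \<in> adjacency G"
proof -
  have "card (ends G e) = 2" "ends G e \<subseteq> verts G"
    using assms by (auto simp: finite_mgraph_def loopless_mgraph_def)
  then obtain y z where yz: "ends G e = {y, z}" "y \<noteq> z" by (meson card_2_iff)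
  then have "v = y \<or> v = z" using assms(3) by simp
  then have "ends G e = {v, if v = y then z else y}" "v \<noteq> (if v = y then z else y)"
    using yz by (auto simp: insert_commute)
  then obtain x where x: "ends G e = {v, x}" "v \<noteq> x" by metis
  moreover have "(v, x) \<in> adjacency G"
    using x assms(2) \<open>ends G e \<subseteq> verts G\<close> unfolding adjacency_def by auto
  ultimately show thesis by (rule that)
qed

lemma component_mdegree:
  assumes fin: "finite_mgraph G" and v: "(u, v) \<in> (adjacency G)\<^sup>*"
  shows "mdegree (induced_subgraph G ((adjacency G)\<^sup>* `` {u})) v = mdegree G v"
proof -
  have "ends G e \<subseteq> (adjacency G)\<^sup>* `` {u}" if e: "e \<in> edges G" "v \<in> ends G e" for e
  proof -
    obtain x where "ends G e = {v, x}" "(v, x) \<in> adjacency G"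
      using incident_edge_neighbour[OF fin e] by blast
    then show ?thesis using v by (auto intro: rtrancl_into_rtrancl)
  qed
  then have "{e \<in> edges G. ends G e \<subseteq> (adjacency G)\<^sup>* `` {u} \<and> v \<in> ends G e} = {e \<in> edges G. v \<in> ends G e}"
    by blast
  then show ?thesis by (simp add: mdegree_def induced_subgraph_def conj_assoc)
qed

text \<open>A path with \<open>n\<close> vertices has degree sum \<open>2 * n - 2\<close>. Adding up
  over the components expresses their number by the total amount by which degrees fall short of
  2.\<close>

lemma path_components:
  assumes fin: "finite_mgraph G" and paths: "\<And>C. C \<in> components G \<Longrightarrow> is_path C"
  shows "v \<in> verts G \<Longrightarrow> mdegree G v \<le> 2"
    "v \<in> verts G \<Longrightarrow> \<exists>x\<in>verts G. (v, x) \<in> (adjacency G)\<^sup>* \<and> mdegree G x \<le> 1"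
    "(\<Sum>v\<in>verts G. mdegree G v) + 2 * num_components G = 2 * card (verts G)"
    "verts G \<noteq> {} \<Longrightarrow> 1 \<le> num_components G"
proof -
  define comp where "comp u = induced_subgraph G ((adjacency G)\<^sup>* `` {u})" for u
  have fV: "finite (verts G)" using fin by (simp add: finite_mgraph_def)
  have comps: "components G = comp ` verts G" by (simp add: components_def comp_def)
  have vcomp: "verts (comp u) = (adjacency G)\<^sup>* `` {u}" for u
    by (simp add: comp_def induced_subgraph_def)
  have sub: "verts (comp u) \<subseteq> verts G" if "u \<in> verts G" for u
    using that reachable_in_verts unfolding vcomp by fastforce
  have path: "is_path (comp u)" if "u \<in> verts G" for u using paths comps that by blast
  have deg: "mdegree (comp u) v = mdegree G v" if "v \<in> verts (comp u)" for u v
    using component_mdegree[OF fin] that unfolding comp_def[symmetric] vcomp by blast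
  have self: "u \<in> verts (comp u)" for u unfolding vcomp by blast
  show "mdegree G v \<le> 2" if "v \<in> verts G"
    using is_path_properties(3)[OF path[OF that] self] deg[OF self] by simp
  show "\<exists>x\<in>verts G. (v, x) \<in> (adjacency G)\<^sup>* \<and> mdegree G x \<le> 1" if v: "v \<in> verts G"
  proof -
    obtain x where "x \<in> verts (comp v)" "mdegree (comp v) x \<le> 1"
      using is_path_properties(4)[OF path[OF v]] by blast
    then show ?thesis using deg[of x v] sub[OF v] vcomp by auto
  qed
  \<comment> \<open>Components are subgraphs rather than vertex classes, so vertices are grouped by
    the map \<open>comp\<close>; its fibres are the vertex sets of the components, which lets sums
    over vertices be regrouped.\<close>
  have fibre: "{v \<in> verts G. comp v = comp u} = verts (comp u)" if u: "u \<in> verts G" for u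
  proof (intro set_eqI iffI)
    fix v assume "v \<in> {v \<in> verts G. comp v = comp u}"
    then show "v \<in> verts (comp u)" using self[of v] by auto
  next
    fix v assume v: "v \<in> verts (comp u)"
    then have "(u, v) \<in> (adjacency G)\<^sup>*" by (simp add: vcomp)
    moreover from this have "(v, u) \<in> (adjacency G)\<^sup>*"
      using sym_rtrancl[OF sym_adjacency] by (meson symD)
    ultimately have "(adjacency G)\<^sup>* `` {v} = (adjacency G)\<^sup>* `` {u}" by (auto intro: rtrancl_trans)
    then show "v \<in> {v \<in> verts G. comp v = comp u}" using v sub[OF u] by (auto simp: comp_def)
  qed
  have one: "(\<Sum>v\<in>verts (comp u). mdegree G v) + 2 = 2 * card (verts (comp u))" if u: "u \<in> verts G" for u
  proof -
    have "finite_mgraph (comp u)"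
      using finite_mgraph_induced[OF fin sub[OF u]] by (simp add: comp_def induced_subgraph_def)
    then have "(\<Sum>v\<in>verts (comp u). mdegree (comp u) v) = 2 * card (edges (comp u))" by (rule handshake)
    moreover have "(\<Sum>v\<in>verts (comp u). mdegree (comp u) v) = (\<Sum>v\<in>verts (comp u). mdegree G v)"
      by (intro sum.cong refl deg)
    ultimately show ?thesis using is_path_properties(2)[OF path[OF u]] by simp
  qed
  have gen: "(\<Sum>v\<in>verts G. f v) = (\<Sum>C\<in>components G. \<Sum>v\<in>verts C. f v)" for f :: "_ \<Rightarrow> nat"
  proof -
    have "(\<Sum>v\<in>verts G. f v) = (\<Sum>C\<in>comp ` verts G. \<Sum>v | v \<in> verts G \<and> comp v = C. f v)"
      using fV by (rule sum.image_gen)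
    also have "\<dots> = (\<Sum>C\<in>comp ` verts G. \<Sum>v\<in>verts C. f v)"
      using fibre by (intro sum.cong) auto
    finally show ?thesis by (simp add: comps)
  qed
  have "(\<Sum>v\<in>verts G. mdegree G v) + 2 * num_components G
      = (\<Sum>C\<in>components G. (\<Sum>v\<in>verts C. mdegree G v) + 2)"
    unfolding gen sum.distrib num_components_def by simp
  also have "\<dots> = (\<Sum>C\<in>components G. 2 * card (verts C))"
    using one by (intro sum.cong) (auto simp: comps)
  also have "\<dots> = 2 * (\<Sum>v\<in>verts G. 1)" unfolding gen by (simp add: sum_distrib_left)
  finally show "(\<Sum>v\<in>verts G. mdegree G v) + 2 * num_components G = 2 * card (verts G)" by simp
  show "1 \<le> num_components G" if "verts G \<noteq> {}"
    using that fV by (simp add: num_components_def comps Suc_le_eq card_gt_0_iff)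
qed

lemma component_connected:
  assumes "u \<in> verts G"
  shows "connected_mgraph (induced_subgraph G ((adjacency G)\<^sup>* `` {u}))"
proof -
  define D where "D = induced_subgraph G ((adjacency G)\<^sup>* `` {u})"
  have reach: "(u, x) \<in> (adjacency D)\<^sup>*" if "(u, x) \<in> (adjacency G)\<^sup>*" for x
    using that
  proof induction
    case (step y z)
    then have "(u, z) \<in> (adjacency G)\<^sup>*" by simp
    with step(1,2) have "(y, z) \<in> adjacency D"
      by (auto simp: adjacency_def D_def induced_subgraph_def)
    with step.IH show ?case by simp
  qed simp
  show ?thesis unfolding connected_mgraph_def D_def[symmetric]
  proof (intro ballI)
    fix x y assume "x \<in> verts D" "y \<in> verts D"
    then have "(u, x) \<in> (adjacency D)\<^sup>*" "(u, y) \<in> (adjacency D)\<^sup>*"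
      using reach by (auto simp: D_def induced_subgraph_def)
    then show "(x, y) \<in> (adjacency D)\<^sup>*"
      using sym_rtrancl[OF sym_adjacency] by (meson rtrancl_trans symD)
  qed
qed

text \<open>A component of the restriction misses a vertex of the connected cycle, so some edge
  leaves it and one of its vertices has degree at most 1. For the count, the edge ends lost in
  \<open>V\<close> are twice the number of path components; a lost edge has no more ends in
  \<open>V\<close> than outside, up to one each, and the degree sum outside is
  \<open>2 * card (verts C - V)\<close>.\<close>

lemma induced_subgraph_of_cycle:
  assumes fin: "finite_mgraph C" and C: "is_cycle C" and V: "V \<subset> verts C"
  shows "D \<in> components (induced_subgraph C V) \<Longrightarrow> is_path D"
    "num_components (induced_subgraph C V) \<le> card (verts C - V)"
proof -
  define H where "H = induced_subgraph C V"
  have H: "verts H = V" "edges H = {e \<in> edges C. ends C e \<subseteq> V}" "ends H = ends C"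
    by (auto simp: H_def induced_subgraph_def)
  have fH: "finite_mgraph H" unfolding H_def using fin V by (intro finite_mgraph_induced) auto
  have fE: "finite (edges C)" and fV: "finite (verts C)" using fin by (auto simp: finite_mgraph_def)
  note cyc = is_cycle_properties[OF C]
  have path: "is_path D" if DH: "D \<in> components H" for D
  proof -
    obtain u where u: "u \<in> V" and D: "D = induced_subgraph H ((adjacency H)\<^sup>* `` {u})"
      using DH H by (auto simp: components_def)
    define K where "K = (adjacency H)\<^sup>* `` {u}"
    have KV: "K \<subseteq> V" using reachable_in_verts[of u _ H] u H by (auto simp: K_def)
    have Dv: "verts D = K" "edges D = {e \<in> edges C. ends C e \<subseteq> K}" "ends D = ends C"
      using KV H by (auto simp: D K_def[symmetric] induced_subgraph_def)
    have fD: "finite_mgraph D" unfolding D K_def[symmetric]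
      using fH KV H by (intro finite_mgraph_induced) auto
    have degD: "mdegree D v \<le> 2" if "v \<in> verts D" for v
    proof -
      have "mdegree D v \<le> mdegree C v"
        unfolding mdegree_def Dv using fE by (intro card_mono) auto
      then show ?thesis using cyc(2)[of v] that Dv KV V by auto
    qed
    have "\<exists>x y. x \<in> K \<and> y \<notin> K \<and> (x, y) \<in> adjacency C"
    proof (rule ccontr)
      assume "\<not> ?thesis"
      then have "adjacency C `` K \<subseteq> K" by blast
      then have cl: "(adjacency C)\<^sup>* `` K = K" by (rule Image_closed_trancl)
      obtain y where y: "y \<in> verts C" "y \<notin> V" using V by blast
      then have "(u, y) \<in> (adjacency C)\<^sup>*" using cyc(1) u V by (auto simp: connected_mgraph_def)
      moreover have "u \<in> K" by (simp add: K_def)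
      ultimately show False using cl y KV by blast
    qed
    then obtain x y e where xy: "x \<in> K" "y \<notin> K" "e \<in> edges C" "ends C e = {x, y}"
      by (auto simp: adjacency_def)
    then have "{e \<in> edges D. x \<in> ends D e} \<subset> {e \<in> edges C. x \<in> ends C e}"
      unfolding Dv by auto
    then have "mdegree D x < mdegree C x" unfolding mdegree_def using fE by (intro psubset_card_mono) auto
    then have "mdegree D x \<le> 1" using cyc(2)[of x] xy KV V by auto
    moreover have "connected_mgraph D" unfolding D using u H by (intro component_connected) simp
    ultimately show ?thesis using is_pathI[OF fD _ degD, of x] xy Dv by auto
  qed
  then show "D \<in> components (induced_subgraph C V) \<Longrightarrow> is_path D" by (simp add: H_def)
  let ?W = "verts C - V"
  have fV': "finite V" using fV V finite_subset by blast
  have le: "card (ends C e \<inter> V) \<le> (if e \<in> edges H then 2 else 0) + card (ends C e \<inter> ?W)"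
    if e: "e \<in> edges C" for e
  proof -
    have e2: "card (ends C e) = 2" "ends C e \<subseteq> verts C"
      using fin e by (auto simp: finite_mgraph_def loopless_mgraph_def)
    have fe: "finite (ends C e)" using e2 by (metis card.infinite zero_neq_numeral)
    have "ends C e = (ends C e \<inter> V) \<union> (ends C e \<inter> ?W)" using e2 by blast
    then have sum: "2 = card (ends C e \<inter> V) + card (ends C e \<inter> ?W)"
      using card_Un_disjoint[of "ends C e \<inter> V" "ends C e \<inter> ?W"] fe e2 by fastforce
    show ?thesis
    proof (cases "e \<in> edges H")
      case True
      then show ?thesis using sum by simp
    next
      case False
      then have "ends C e \<inter> ?W \<noteq> {}" using e e2 H by auto
      then have "1 \<le> card (ends C e \<inter> ?W)" using fe by (simp add: Suc_le_eq card_gt_0_iff)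
      then show ?thesis using sum by simp
    qed
  qed
  have "2 * card V = (\<Sum>v\<in>V. mdegree C v)" using cyc(2) V by (simp add: subset_iff psubset_eq)
  also have "\<dots> = (\<Sum>e\<in>edges C. card (ends C e \<inter> V))" using fE fV' by (rule sum_mdegree)
  also have "\<dots> \<le> (\<Sum>e\<in>edges C. (if e \<in> edges H then 2 else 0) + card (ends C e \<inter> ?W))"
    by (rule sum_mono) (rule le)
  also have "\<dots> = 2 * card (edges H) + (\<Sum>v\<in>?W. mdegree C v)"
  proof -
    have "(\<Sum>e\<in>edges C. if e \<in> edges H then 2 else 0) = (\<Sum>e\<in>edges H. (2::nat))"
      using fE H by (intro sum.mono_neutral_cong_right) auto
    then show ?thesis using sum_mdegree[of C ?W] fE fV by (simp add: sum.distrib)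
  qed
  also have "(\<Sum>v\<in>?W. mdegree C v) = 2 * card ?W" using cyc(2) by simp
  also have "2 * card (edges H) = (\<Sum>v\<in>V. mdegree H v)" using handshake[OF fH] H by simp
  finally have "2 * card V \<le> (\<Sum>v\<in>V. mdegree H v) + 2 * card ?W" .
  moreover have "(\<Sum>v\<in>V. mdegree H v) + 2 * num_components H = 2 * card V"
    using path_components(3)[OF fH path] H by simp
  ultimately show "num_components (induced_subgraph C V) \<le> card ?W" by (simp add: H_def)
qed

section \<open>Degrees from multiplicities and from colours\<close>

lemma mdegree_eq_sum_multiplicity:
  assumes fin: "finite_mgraph G" and v: "v \<in> verts G"
  shows "mdegree G v = (\<Sum>u\<in>verts G - {v}. card {e \<in> edges G. ends G e = {v, u}})"
proof -
  have fE: "finite (edges G)" and fV: "finite (verts G)" using fin by (auto simp: finite_mgraph_def)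
  have "{e \<in> edges G. v \<in> ends G e} = (\<Union>u\<in>verts G - {v}. {e \<in> edges G. ends G e = {v, u}})"
  proof (intro set_eqI iffI)
    fix e assume "e \<in> {e \<in> edges G. v \<in> ends G e}"
    then have e: "e \<in> edges G" "v \<in> ends G e" by auto
    obtain x where "ends G e = {v, x}" "v \<noteq> x" "(v, x) \<in> adjacency G"
      using incident_edge_neighbour[OF fin e] .
    then show "e \<in> (\<Union>u\<in>verts G - {v}. {e \<in> edges G. ends G e = {v, u}})"
      using e by (auto simp: adjacency_def)
  qed auto
  then have "mdegree G v = card (\<Union>u\<in>verts G - {v}. {e \<in> edges G. ends G e = {v, u}})"
    by (simp add: mdegree_def)
  also have "\<dots> = (\<Sum>u\<in>verts G - {v}. card {e \<in> edges G. ends G e = {v, u}})"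
    using fE fV by (intro card_UN_disjoint) (auto simp: doubleton_eq_iff)
  finally show ?thesis .
qed

lemma color_subgraph_simps [simp]:
  "verts (color_subgraph G c j) = verts G"
  "edges (color_subgraph G c j) = {e \<in> edges G. c e = j}"
  "ends (color_subgraph G c j) = ends G"
  by (simp_all add: color_subgraph_def)

lemma mdegree_sum_colors:
  assumes fin: "finite_mgraph G" and c: "edge_coloring k G c"
  shows "mdegree G v = (\<Sum>j\<in>{1..k}. mdegree (color_subgraph G c j) v)"
proof -
  have fE: "finite (edges G)" using fin by (auto simp: finite_mgraph_def)
  have "{e \<in> edges G. v \<in> ends G e} = (\<Union>j\<in>{1..k}. {e \<in> edges G. c e = j \<and> v \<in> ends G e})"
    using c by (auto simp: edge_coloring_def Pi_def)
  then have "mdegree G v = card (\<Union>j\<in>{1..k}. {e \<in> edges G. c e = j \<and> v \<in> ends G e})"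
    by (simp add: mdegree_def)
  also have "\<dots> = (\<Sum>j\<in>{1..k}. card {e \<in> edges G. c e = j \<and> v \<in> ends G e})"
    using fE by (intro card_UN_disjoint) auto
  finally show ?thesis by (simp add: mdegree_def conj_assoc)
qed

lemma verts_multi_K [simp]: "verts (multi_K a p l m) = {..<p} \<times> {..<a}"
  and ends_multi_K [simp]: "ends (multi_K a p l m) = fst"
  by (simp_all add: multi_K_def)

lemma finite_multi_K: "finite_mgraph (multi_K a p l m)"
proof -
  have "edges (multi_K a p l m) \<subseteq>
      (\<lambda>((u, v), i). ({u, v}, i)) ` ((({..<p} \<times> {..<a}) \<times> ({..<p} \<times> {..<a})) \<times> {..<l + m})"
  proof
    fix e assume "e \<in> edges (multi_K a p l m)"
    then obtain u v i where "e = ({u, v}, i)" "u \<in> {..<p} \<times> {..<a}" "v \<in> {..<p} \<times> {..<a}"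
        "i < (if fst u = fst v then l else m)"
      unfolding multi_K_def mgraph.simps mem_Collect_eq by blast
    then show "e \<in> (\<lambda>((u, v), i). ({u, v}, i)) `
        ((({..<p} \<times> {..<a}) \<times> ({..<p} \<times> {..<a})) \<times> {..<l + m})"
      by (intro image_eqI[of _ _ "((u, v), i)"]) (auto split: if_splits)
  qed
  then have "finite (edges (multi_K a p l m))" by (rule finite_subset) auto
  then show ?thesis using loopless_multi_K by (simp add: finite_mgraph_def)
qed

lemma mdegree_multi_K:
  assumes v: "v \<in> {..<p} \<times> {..<a}"
  shows "mdegree (multi_K a p l m) v = l * (a - 1) + m * a * (p - 1)"
proof -
  obtain s x where sx: "v = (s, x)" "s < p" "x < a" using v by auto
  let ?V = "{..<p} \<times> {..<a}"
  let ?f = "\<lambda>u. if fst u = fst v then l else m"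
  have "mdegree (multi_K a p l m) v =
      (\<Sum>u\<in>?V - {v}. card {e \<in> edges (multi_K a p l m). ends (multi_K a p l m) e = {v, u}})"
    using mdegree_eq_sum_multiplicity[OF finite_multi_K] v by simp
  also have "\<dots> = (\<Sum>u\<in>?V - {v}. ?f u)"
  proof (rule sum.cong)
    fix u assume "u \<in> ?V - {v}"
    then show "card {e \<in> edges (multi_K a p l m). ends (multi_K a p l m) e = {v, u}} = ?f u"
      using multi_K_multiplicity[of v a p l m u] v by (auto simp: eq_commute)
  qed simp
  \<comment> \<open>The omitted term \<open>u = v\<close> would have the value \<open>l\<close>;
    adding it lets the sum run over the whole product \<open>?V\<close>.\<close>
  finally have "mdegree (multi_K a p l m) v + l = (\<Sum>u\<in>?V. ?f u)"
    using sum.remove[of ?V v ?f] v by simp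
  also have "\<dots> = (\<Sum>s'<p. \<Sum>x'<a. if s' = s then l else m)"
    unfolding sx(1) sum.cartesian_product by (simp add: case_prod_unfold)
  also have "\<dots> = a * l + (\<Sum>s'\<in>{..<p} - {s}. \<Sum>x'<a. if s' = s then l else m)"
    using sx by (subst sum.remove[of _ s]) auto
  also have "(\<Sum>s'\<in>{..<p} - {s}. \<Sum>x'<a. if s' = s then l else m) = (\<Sum>s'\<in>{..<p} - {s}. a * m)"
    by (intro sum.cong) auto
  also have "\<dots> = m * a * (p - 1)" using sx by simp
  finally have "mdegree (multi_K a p l m) v + l = a * l + m * a * (p - 1)" .
  then show ?thesis using sx by (cases a) (auto simp: algebra_simps)
qed

section \<open>From multiplicities to colourings\<close>

text \<open>Serves to colour \<open>n\<close> parallel edges with prescribed numbers of each colour: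
  the indices are cut into consecutive intervals.\<close>

lemma exists_function_with_fibre_cards:
  fixes b :: "'j \<Rightarrow> nat"
  assumes "finite J" "(\<Sum>j\<in>J. b j) = n"
  shows "\<exists>g. (\<forall>i<n. g i \<in> J) \<and> (\<forall>j\<in>J. card {i. i < n \<and> g i = j} = b j)"
  using assms
proof (induction J arbitrary: n rule: finite_induct)
  case (insert j J)
  define n' where "n' = (\<Sum>j\<in>J. b j)"
  have n: "n = n' + b j" using insert by (simp add: n'_def)
  obtain g where g: "\<And>i. i < n' \<Longrightarrow> g i \<in> J" "\<And>j'. j' \<in> J \<Longrightarrow> card {i. i < n' \<and> g i = j'} = b j'"
    using insert.IH[of n'] n'_def by blast
  define g' where "g' i = (if i < n' then g i else j)" for i
  have "{i. i < n \<and> g' i = j'} = {i. i < n' \<and> g i = j'}" if "j' \<in> J" for j'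
    using that insert.hyps n by (auto simp: g'_def)
  moreover have "{i. i < n \<and> g' i = j} = {n'..<n}"
  proof -
    have "g i \<noteq> j" if "i < n'" for i using g(1)[OF that] insert.hyps by blast
    then show ?thesis using n by (auto simp: g'_def split: if_splits)
  qed
  moreover have "g' i \<in> insert j J" for i using g(1) by (simp add: g'_def)
  ultimately show ?case using g(2) n by (intro exI[of _ g']) simp
qed simp

text \<open>Greedy choice. It serves to distribute the inner edges of a new part over the colours
  within their capacities.\<close>

lemma exists_bounded_function_with_sum:
  fixes b :: "'j \<Rightarrow> nat"
  assumes "finite J" "S \<le> (\<Sum>j\<in>J. b j)"
  shows "\<exists>y. (\<forall>j\<in>J. y j \<le> b j) \<and> (\<Sum>j\<in>J. y j) = S"
  using assms
proof (induction J arbitrary: S rule: finite_induct)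
  case (insert j J)
  define S' where "S' = min S (\<Sum>j\<in>J. b j)"
  obtain y where y: "\<And>j'. j' \<in> J \<Longrightarrow> y j' \<le> b j'" "(\<Sum>j\<in>J. y j) = S'"
    using insert.IH[of S'] by (auto simp: S'_def)
  have "(\<Sum>j'\<in>J. (y(j := S - S')) j') = (\<Sum>j\<in>J. y j)"
    using insert.hyps by (intro sum.cong) auto
  moreover have "S - S' \<le> b j" "S' \<le> S" using insert.prems insert.hyps by (auto simp: S'_def)
  ultimately show ?case using insert.hyps y
    by (intro exI[of _ "y(j := S - S')"]) auto
qed simp

lemma multi_K_edge_cases:
  assumes "e \<in> edges (multi_K a p l m)"
  obtains u v i where "e = ({u, v}, i)" "u \<noteq> v" "u \<in> {..<p} \<times> {..<a}" "v \<in> {..<p} \<times> {..<a}"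
    "i < (if fst u = fst v then l else m)"
proof -
  obtain u v i where e: "e = ({u, v}, i)" "u \<noteq> v"
    using assms unfolding multi_K_def mgraph.simps mem_Collect_eq by blast
  show thesis
    using that[OF e] assms unfolding e(1) multi_K_edge_iff[OF e(2)] by blast
qed

lemma edges_multi_K_subset:
  "edges (multi_K a p l m) \<subseteq> edges (multi_K a (p + r) l m)"
proof
  fix e assume "e \<in> edges (multi_K a p l m)"
  then obtain u v i where e: "e = ({u, v}, i)" "u \<noteq> v" "u \<in> {..<p} \<times> {..<a}" "v \<in> {..<p} \<times> {..<a}"
    "i < (if fst u = fst v then l else m)" by (rule multi_K_edge_cases)
  have "{..<p} \<times> {..<a} \<subseteq> {..<p + r} \<times> {..<a}" by auto
  then have "u \<in> {..<p + r} \<times> {..<a}" "v \<in> {..<p + r} \<times> {..<a}" using e by blast+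
  then show "e \<in> edges (multi_K a (p + r) l m)" unfolding e(1) multi_K_edge_iff[OF e(2)] using e(5) by blast
qed

text \<open>Parallel edges are interchangeable, so the numbers \<open>B j x y\<close> are all that
  must be constructed. Old edges keep their colours thanks to \<open>old\<close>; row sums 2, an
  empty diagonal and connectedness make each colour a spanning cycle by
  \<open>is_cycleI\<close>.\<close>

lemma embeds_if_even_system:
  fixes a p r l m k c
  defines "G \<equiv> multi_K a p l m" and "K \<equiv> multi_K a (p + r) l m"
    and "V \<equiv> {..<p} \<times> {..<a}" and "Y \<equiv> {..<p + r} \<times> {..<a}"
  assumes sys: "even_system {1..k} Y B" and ne: "Y \<noteq> {}"
    and rows: "\<And>j x. j \<in> {1..k} \<Longrightarrow> x \<in> Y \<Longrightarrow> (\<Sum>y\<in>Y. B j x y) = 2"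
    and diag: "\<And>j x. j \<in> {1..k} \<Longrightarrow> x \<in> Y \<Longrightarrow> B j x x = 0"
    and old: "\<And>j x y. j \<in> {1..k} \<Longrightarrow> x \<in> V \<Longrightarrow> y \<in> V \<Longrightarrow>
      B j x y = card {e \<in> edges G. c e = j \<and> ends G e = {x, y}}"
    and new: "\<And>x y. x \<in> Y \<Longrightarrow> y \<in> Y \<Longrightarrow> x \<noteq> y \<Longrightarrow> \<not> (x \<in> V \<and> y \<in> V) \<Longrightarrow>
      (\<Sum>j\<in>{1..k}. B j x y) = (if fst x = fst y then l else m)"
    and c: "edge_coloring k G c"
  shows "embeds_in_hamiltonian_decomposition k G c K"
proof -
  have VY: "V \<subseteq> Y" by (auto simp: V_def Y_def)
  have GK: "edges G \<subseteq> edges K" unfolding G_def K_def by (rule edges_multi_K_subset)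
  define good where "good g x y \<longleftrightarrow> (let n = if fst x = fst y then l else m in
      (\<forall>i<n. g i \<in> {1..k}) \<and> (\<forall>j\<in>{1..k}. card {i. i < n \<and> g i = j} = B j x y))"
    for g :: "nat \<Rightarrow> nat" and x y :: "nat \<times> nat"
  \<comment> \<open>An edge carries the unordered pair \<open>s\<close> of its ends, so the colours
    are chosen per \<open>s\<close> and must fit both orders of the ends; symmetry of
    \<open>B\<close> ensures this.\<close>
  have "\<exists>g. \<forall>x y. x \<in> Y \<and> y \<in> Y \<and> x \<noteq> y \<and> \<not> (x \<in> V \<and> y \<in> V) \<and> s = {x, y} \<longrightarrow> good g x y" for s
  proof (cases "\<exists>x y. x \<in> Y \<and> y \<in> Y \<and> x \<noteq> y \<and> \<not> (x \<in> V \<and> y \<in> V) \<and> s = {x, y}")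
    case True
    then obtain x y where xy: "x \<in> Y" "y \<in> Y" "x \<noteq> y" "\<not> (x \<in> V \<and> y \<in> V)" "s = {x, y}" by blast
    have "\<exists>g. good g x y"
      unfolding good_def Let_def
      by (rule exists_function_with_fibre_cards[OF finite_atLeastAtMost new[OF xy(1-4)]])
    then obtain g where g: "good g x y" ..
    have "good g y x"
      using g even_system_sym[OF sys _ xy(1,2)] 
      unfolding good_def Let_def eq_commute[of "fst y" "fst x"] by simp
    then show ?thesis using g xy(5) by (intro exI[of _ g]) (auto simp: doubleton_eq_iff)
  qed blast
  then have "\<exists>f. \<forall>s x y. x \<in> Y \<and> y \<in> Y \<and> x \<noteq> y \<and> \<not> (x \<in> V \<and> y \<in> V) \<and> s = {x, y} \<longrightarrow> good (f s) x y"
    by (intro choice allI)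
  then obtain f where f: "\<And>x y. x \<in> Y \<Longrightarrow> y \<in> Y \<Longrightarrow> x \<noteq> y \<Longrightarrow> \<not> (x \<in> V \<and> y \<in> V) \<Longrightarrow> good (f {x, y}) x y"
    by blast
  define c' where "c' e = (if e \<in> edges G then c e else f (fst e) (snd e))" for e
  have edgeG: "({x, y}, i) \<in> edges G \<longleftrightarrow> ({x, y}, i) \<in> edges K \<and> x \<in> V \<and> y \<in> V"
    if "x \<noteq> y" for x y i
    using VY unfolding G_def K_def multi_K_edge_iff[OF that] V_def Y_def by blast
  have count: "card {e \<in> edges K. c' e = j \<and> ends K e = {x, y}} = B j x y"
    if j: "j \<in> {1..k}" and xy: "x \<in> Y" "y \<in> Y" "x \<noteq> y" for j x y
  proof (cases "x \<in> V \<and> y \<in> V")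
    case True
    have "e \<in> edges K \<and> c' e = j \<and> fst e = {x, y} \<longleftrightarrow> e \<in> edges G \<and> c e = j \<and> fst e = {x, y}" for e
      using True edgeG[OF xy(3), of "snd e"] GK by (cases e) (auto simp: c'_def)
    then show ?thesis using old[OF j, of x y] True by (simp add: G_def K_def)
  next
    case False
    let ?n = "if fst x = fst y then l else m"
    have "e \<in> edges K \<and> c' e = j \<and> fst e = {x, y} \<longleftrightarrow> e \<in> Pair {x, y} ` {i. i < ?n \<and> f {x, y} i = j}" for e
    proof (cases "fst e = {x, y}")
      case True
      then obtain i where e: "e = ({x, y}, i)" by (cases e) auto
      have "e \<notin> edges G" using False edgeG[OF xy(3)] e by blast
      moreover have "e \<in> edges K \<longleftrightarrow> i < ?n"
        using xy unfolding e K_def multi_K_edge_iff[OF xy(3)] Y_def by blast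
      ultimately show ?thesis by (auto simp: c'_def e)
    qed auto
    then have "{e \<in> edges K. c' e = j \<and> ends K e = {x, y}} = Pair {x, y} ` {i. i < ?n \<and> f {x, y} i = j}"
      by (auto simp: K_def)
    then have "card {e \<in> edges K. c' e = j \<and> ends K e = {x, y}} = card {i. i < ?n \<and> f {x, y} i = j}"
      by (simp add: card_image inj_on_def)
    then show ?thesis using f[OF xy False] j unfolding good_def Let_def by simp
  qed
  have col: "edge_coloring k K c'"
    unfolding edge_coloring_def
  proof
    fix e assume e: "e \<in> edges K"
    show "c' e \<in> {1..k}"
    proof (cases "e \<in> edges G")
      case True
      then show ?thesis using c by (auto simp: c'_def edge_coloring_def)
    next
      case False
      obtain x y i where xy: "e = ({x, y}, i)" "x \<noteq> y" "x \<in> Y" "y \<in> Y" "i < (if fst x = fst y then l else m)"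
        using e unfolding K_def Y_def by (rule multi_K_edge_cases)
      have "\<not> (x \<in> V \<and> y \<in> V)" using False e edgeG[OF xy(2)] xy(1) by blast
      then have "good (f {x, y}) x y" using f xy by blast
      then show ?thesis using False xy(1,5) unfolding good_def Let_def by (simp add: c'_def)
    qed
  qed
  have YK: "verts K = Y" by (simp add: K_def Y_def)
  have fK: "finite_mgraph K" unfolding K_def by (rule finite_multi_K)
  have fY: "finite Y" by (simp add: Y_def)
  have "hamiltonian_cycle (color_subgraph K c' j) K" if j: "j \<in> {1..k}" for j
  proof -
    let ?H = "color_subgraph K c' j"
    have fH: "finite_mgraph ?H" using fK by (rule finite_mgraph_color_subgraph)
    have mult: "card {e \<in> edges ?H. ends ?H e = {x, y}} = B j x y" if "x \<in> Y" "y \<in> Y" "x \<noteq> y" for x y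
      using count[OF j that] by (simp add: conj_assoc)
    have deg: "mdegree ?H v = 2" if v: "v \<in> verts ?H" for v
    proof -
      have vY: "v \<in> Y" using v YK by simp
      have "mdegree ?H v = (\<Sum>u\<in>Y - {v}. card {e \<in> edges ?H. ends ?H e = {v, u}})"
        using mdegree_eq_sum_multiplicity[OF fH v] YK by simp
      also have "\<dots> = (\<Sum>u\<in>Y - {v}. B j v u)" using vY by (intro sum.cong refl mult) auto
      also have "\<dots> = (\<Sum>u\<in>Y. B j v u)" using diag[OF j vY] fY vY by (simp add: sum.remove)
      finally show ?thesis using rows[OF j vY] by simp
    qed
    have "linked (B j) Y \<subseteq> adjacency ?H"
    proof (rule subrelI)
      fix x y assume "(x, y) \<in> linked (B j) Y"
      then have xy: "x \<in> Y" "y \<in> Y" "0 < B j x y" by (auto simp: linked_def)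
      then have "x \<noteq> y" using diag[OF j] by fastforce
      have "0 < card {e \<in> edges ?H. ends ?H e = {x, y}}"
        using xy(3) unfolding mult[OF xy(1,2) \<open>x \<noteq> y\<close>] .
      then have "{e \<in> edges ?H. ends ?H e = {x, y}} \<noteq> {}" unfolding card_gt_0_iff by (rule conjunct1)
      then obtain e where "e \<in> edges ?H" "ends ?H e = {x, y}" by blast
      then show "(x, y) \<in> adjacency ?H" using xy YK unfolding adjacency_def color_subgraph_simps by blast
    qed
    then have "(linked (B j) Y)\<^sup>* \<subseteq> (adjacency ?H)\<^sup>*" by (rule rtrancl_mono)
    moreover have "connected_on (B j) Y" using sys j by (simp add: even_system_def)
    ultimately have conn: "connected_mgraph ?H" using YK by (auto simp: connected_on_def connected_mgraph_def)
    obtain s where "s \<in> verts ?H" using ne YK by auto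
    then have "is_cycle ?H" using is_cycleI[OF fH conn deg] by blast
    then show ?thesis by (auto simp: hamiltonian_cycle_def subgraph_def)
  qed
  then show ?thesis unfolding embeds_in_hamiltonian_decomposition_def
    using col by (intro exI[of _ c']) (simp add: c'_def)
qed

section \<open>Necessity of the conditions\<close>

lemma color_subgraph_induced:
  "induced_subgraph (color_subgraph G c j) V = color_subgraph (induced_subgraph G V) c j"
proof -
  have "{e \<in> edges G. c e = j \<and> ends G e \<subseteq> V} = {e \<in> edges G. ends G e \<subseteq> V \<and> c e = j}" by blast
  then show ?thesis by (simp add: induced_subgraph_def color_subgraph_def conj_assoc)
qed

lemma embeds_necessary:
  fixes a p r k l m c
  defines "G \<equiv> multi_K a p l m"
  assumes a: "1 < a" and p: "1 \<le> p" and r: "1 \<le> r"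
    and emb: "embeds_in_hamiltonian_decomposition k G c (multi_K a (p + r) l m)"
  shows "2 * k = l * (a - 1) + m * a * (p + r - 1)" "l \<le> m * a * (p + r - 1)"
    "j \<in> {1..k} \<Longrightarrow> C \<in> components (color_subgraph G c j) \<Longrightarrow> is_path C"
    "j \<in> {1..k} \<Longrightarrow> num_components (color_subgraph G c j) \<le> a * r"
proof -
  define K where "K = multi_K a (p + r) l m"
  obtain c' where c': "edge_coloring k K c'" "\<And>e. e \<in> edges G \<Longrightarrow> c' e = c e"
    and ham: "\<And>j. j \<in> {1..k} \<Longrightarrow> is_cycle (color_subgraph K c' j)"
    using emb unfolding embeds_in_hamiltonian_decomposition_def hamiltonian_cycle_def K_def by blast
  have fK: "finite_mgraph K" unfolding K_def by (rule finite_multi_K)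
  have vK: "verts K = {..<p + r} \<times> {..<a}" by (simp add: K_def)
  have v0: "(0, 0) \<in> {..<p + r} \<times> {..<a}" using a p by auto
  have "mdegree K (0, 0) = (\<Sum>j\<in>{1..k}. mdegree (color_subgraph K c' j) (0, 0))"
    by (rule mdegree_sum_colors[OF fK c'(1)])
  also have "\<dots> = (\<Sum>j\<in>{1..k}. 2)"
    using v0 vK by (intro sum.cong refl is_cycle_properties(2) ham) auto
  finally show k: "2 * k = l * (a - 1) + m * a * (p + r - 1)"
    using mdegree_multi_K[OF v0, of l m] by (simp add: K_def)
  \<comment> \<open>Restriction to the first \<open>q\<close> parts, needed for \<open>q = p\<close>
    (the given colouring) and for \<open>q = 1\<close> (a single part).\<close>
  have sub: "(D \<in> components (color_subgraph (multi_K a q l m) c' j) \<longrightarrow> is_path D) \<and>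
      num_components (color_subgraph (multi_K a q l m) c' j) \<le> a * (p + r - q)"
    if q: "q < p + r" and j: "j \<in> {1..k}" for q j D
  proof -
    define V where "V = {..<q} \<times> {..<a}"
    let ?C = "color_subgraph K c' j"
    have "(q, 0) \<in> verts K - V" using q a by (simp add: V_def vK)
    then have V: "V \<subset> verts ?C" using q by (auto simp: V_def vK)
    have fC: "finite_mgraph ?C" by (rule finite_mgraph_color_subgraph[OF fK])
    have "induced_subgraph K V = multi_K a q l m"
      using multi_K_induced_subgraph[of a q "p + r - q" l m] q by (simp add: K_def V_def)
    then have ind: "induced_subgraph ?C V = color_subgraph (multi_K a q l m) c' j"
      by (simp add: color_subgraph_induced)
    have "verts ?C - V = {q..<p + r} \<times> {..<a}" using q by (auto simp: V_def vK)
    then have "card (verts ?C - V) = a * (p + r - q)" by simp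
    then show ?thesis using induced_subgraph_of_cycle[OF fC ham[OF j] V] unfolding ind by auto
  qed
  have same: "color_subgraph G c j = color_subgraph (multi_K a p l m) c' j" for j
  proof -
    have "{e \<in> edges G. c e = j} = {e \<in> edges G. c' e = j}" using c'(2) by auto
    then show ?thesis by (simp add: color_subgraph_def G_def)
  qed
  show "is_path C" if "j \<in> {1..k}" "C \<in> components (color_subgraph G c j)"
    using sub[of p j C] that r unfolding same by simp
  show "num_components (color_subgraph G c j) \<le> a * r" if "j \<in> {1..k}"
    using sub[of p j] that r unfolding same by simp
  \<comment> \<open>Within one part each colour has degree sum at most \<open>2 * (a - 1)\<close>,
    while all edges together have \<open>a * (l * (a - 1))\<close>. Hence
    \<open>a * l \<le> 2 * k\<close>, and the formula for \<open>2 * k\<close> turns this into the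
    bound on \<open>l\<close>.\<close>
  let ?P = "multi_K a 1 l m"
  have vP: "verts ?P = {..<1} \<times> {..<a}" by (rule verts_multi_K)
  have cP: "card (verts ?P) = a" unfolding vP by simp
  have fP: "finite_mgraph ?P" by (rule finite_multi_K)
  have "edges ?P \<subseteq> edges K"
    using edges_multi_K_subset[of a 1 l m "p + r - 1"] p by (simp add: K_def)
  then have colP: "edge_coloring k ?P c'" using c'(1) by (auto simp: edge_coloring_def)
  have "(\<Sum>v\<in>verts ?P. mdegree ?P v) = (\<Sum>v\<in>verts ?P. \<Sum>j\<in>{1..k}. mdegree (color_subgraph ?P c' j) v)"
    by (intro sum.cong refl mdegree_sum_colors[OF fP colP])
  also have "\<dots> = (\<Sum>j\<in>{1..k}. \<Sum>v\<in>verts ?P. mdegree (color_subgraph ?P c' j) v)" by (rule sum.swap)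
  also have "\<dots> \<le> (\<Sum>j\<in>{1..k}. 2 * (a - 1))"
  proof (rule sum_mono)
    fix j assume j: "j \<in> {1..k}"
    let ?H = "color_subgraph ?P c' j"
    have fH: "finite_mgraph ?H" by (rule finite_mgraph_color_subgraph[OF fP])
    have path: "is_path D" if "D \<in> components ?H" for D
      using sub[of 1 j D] j that p r by simp
    have "verts ?H \<noteq> {}" using a unfolding color_subgraph_simps vP by auto
    then have "1 \<le> num_components ?H" using path_components(4)[OF fH path] by simp
    moreover have "(\<Sum>v\<in>verts ?H. mdegree ?H v) + 2 * num_components ?H = 2 * card (verts ?H)"
      by (rule path_components(3)[OF fH path])
    ultimately show "(\<Sum>v\<in>verts ?P. mdegree ?H v) \<le> 2 * (a - 1)"
      using cP unfolding color_subgraph_simps by linarith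
  qed
  also have "(\<Sum>v\<in>verts ?P. mdegree ?P v) = (\<Sum>v\<in>verts ?P. l * (a - 1))"
  proof (rule sum.cong)
    fix v assume "v \<in> verts ?P"
    then show "mdegree ?P v = l * (a - 1)" using mdegree_multi_K[of v 1 a l m] unfolding vP by simp
  qed simp
  finally have "a * (l * (a - 1)) \<le> k * (2 * (a - 1))" using cP by simp
  then have "(a - 1) * (a * l) \<le> (a - 1) * (2 * k)" by (simp add: algebra_simps)
  then have "a * l \<le> 2 * k" using a by simp
  moreover have "a * l = l * (a - 1) + l" using a by (cases a) auto
  ultimately show "l \<le> m * a * (p + r - 1)" using k by linarith
qed

section \<open>Sufficiency: constructing the extension\<close>

lemma embeds_sufficient:
  fixes a p r l m k c
  defines "G \<equiv> multi_K a p l m"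
  assumes a: "1 < a" and p: "1 \<le> p" and r: "1 \<le> r"
    and r_large: "l * (a - 1) + m * a * (p - 1) \<le> r * (m * a * (a - 1))"
    and c: "edge_coloring k G c"
    and k: "2 * k = l * (a - 1) + m * a * (p + r - 1)"
    and paths: "\<And>j C. j \<in> {1..k} \<Longrightarrow> C \<in> components (color_subgraph G c j) \<Longrightarrow> is_path C"
    and comps: "\<And>j. j \<in> {1..k} \<Longrightarrow> num_components (color_subgraph G c j) \<le> a * r"
  shows "embeds_in_hamiltonian_decomposition k G c (multi_K a (p + r) l m)"
proof -

  \<comment> \<open>Degrees and path counts of the given colouring\<close>
  define J where "J = {1..k}"
  define V where "V = {..<p} \<times> {..<a}"
  define H where "H j = color_subgraph G c j" for j
  define \<omega> where "\<omega> j = num_components (H j)" for j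
  define dg where "dg j v = mdegree (H j) v" for j v
  define D where "D = l * (a - 1) + m * a * (p - 1)"
  have fJ: "finite J" and cJ: "card J = k" by (simp_all add: J_def)
  have fG: "finite_mgraph G" unfolding G_def by (rule finite_multi_K)
  have fH: "finite_mgraph (H j)" for j unfolding H_def by (rule finite_mgraph_color_subgraph[OF fG])
  have vG: "verts G = V" and eG: "ends G = fst" by (simp_all add: G_def V_def)
  have H: "verts (H j) = V" "edges (H j) = {e \<in> edges G. c e = j}" "ends (H j) = fst" for j
    by (simp_all add: H_def vG eG)
  have fV: "finite V" and cV: "card V = p * a" by (simp_all add: V_def)
  have "(0, 0) \<in> V" using a p by (auto simp: V_def)
  then have Vne: "V \<noteq> {}" by blast
  have path: "is_path C" if "j \<in> J" "C \<in> components (H j)" for j C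
    using paths that by (simp add: J_def H_def)
  have dg2: "dg j v \<le> 2" if "j \<in> J" "v \<in> V" for j v
    using path_components(1)[OF fH[of j] path[OF that(1)], where v = v] that(2) H by (simp add: dg_def)
  have dg_end: "\<exists>x\<in>V. (v, x) \<in> (adjacency (H j))\<^sup>* \<and> dg j x \<le> 1" if "j \<in> J" "v \<in> V" for j v
    using path_components(2)[OF fH[of j] path[OF that(1)], where v = v] that(2) H by (simp add: dg_def)
  have dg_sum: "(\<Sum>v\<in>V. dg j v) + 2 * \<omega> j = 2 * (p * a)" if "j \<in> J" for j
    using path_components(3)[OF fH[of j] path[OF that]] H cV by (simp add: dg_def \<omega>_def)
  have \<omega>1: "1 \<le> \<omega> j" if "j \<in> J" for j
    using path_components(4)[OF fH[of j] path[OF that]] H Vne by (simp add: \<omega>_def)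
  have \<omega>ar: "\<omega> j \<le> a * r" if "j \<in> J" for j
    using comps that by (simp add: \<omega>_def H_def J_def)
  have dg_col: "(\<Sum>j\<in>J. dg j v) = D" if "v \<in> V" for v
    using mdegree_sum_colors[OF fG c, of v] mdegree_multi_K[of v p a l m] that
    unfolding J_def dg_def H_def D_def G_def V_def by simp
  \<comment> \<open>\<open>D\<close> is the degree in \<open>G\<close>, so \<open>m * a * r\<close>
    is what each old vertex lacks over all colours.\<close>
  have kD: "2 * k = D + m * a * r"
    using p k unfolding D_def by (cases p) (simp_all add: algebra_simps)
  \<comment> \<open>The lack in colour \<open>j\<close> is \<open>2 * \<omega> j\<close>, two ends
    for each path; counted by vertices instead, each of the \<open>p * a\<close> old vertices lacks
    \<open>m * a * r\<close>.\<close>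
  have \<omega>_sum: "2 * (\<Sum>j\<in>J. \<omega> j) = p * a * (m * a * r)"
  proof -
    have "(\<Sum>j\<in>J. \<Sum>v\<in>V. dg j v) + 2 * (\<Sum>j\<in>J. \<omega> j) = (\<Sum>j\<in>J. (\<Sum>v\<in>V. dg j v) + 2 * \<omega> j)"
      by (simp add: sum.distrib sum_distrib_left)
    also have "\<dots> = p * a * (2 * k)" using dg_sum by (simp add: cJ)
    also have "(\<Sum>j\<in>J. \<Sum>v\<in>V. dg j v) = (\<Sum>v\<in>V. \<Sum>j\<in>J. dg j v)" by (rule sum.swap)
    also have "\<dots> = p * a * D" using dg_col by (simp add: cV)
    finally show ?thesis unfolding kD by (simp add: algebra_simps)
  qed
  have k_le: "2 * k \<le> r * (m * a * a)"
  proof -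
    have "m * a * r = r * (m * a)" by simp
    then have "2 * k \<le> r * (m * a * (a - 1)) + r * (m * a)"
      using r_large unfolding kD D_def by linarith
    also have "\<dots> = r * (m * a * a)" using a by (cases a) (simp_all add: algebra_simps)
    finally show ?thesis .
  qed

  text \<open>Every new part will carry \<open>y j\<close> edges of colour \<open>j\<close>, the same number for all parts;
    its \<open>a\<close> vertices must then be joined to the rest by \<open>2 * (a - y j)\<close> edges of that colour, so
    that \<open>\<omega> j \<le> r * (a - y j)\<close> is needed.\<close>
  define q where "q j = (\<omega> j + r - 1) div r" for j
  \<comment> \<open>\<open>q j\<close> is the ceiling of \<open>\<omega> j / r\<close>, the least
    value allowed for \<open>a - y j\<close>.\<close>
  have q_ge: "\<omega> j \<le> r * q j" and q_le: "r * q j \<le> \<omega> j + r - 1" for j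
  proof -
    have "(\<omega> j + r - 1) = r * q j + (\<omega> j + r - 1) mod r" by (simp add: q_def)
    moreover have "(\<omega> j + r - 1) mod r < r" using r by simp
    ultimately show "\<omega> j \<le> r * q j" "r * q j \<le> \<omega> j + r - 1" by linarith+
  qed
  \<comment> \<open>This will give \<open>y j < a\<close>, hence the positive degrees
    \<open>2 * (a - y j)\<close> that splitting requires.\<close>
  have q1: "1 \<le> q j" if "j \<in> J" for j
    using q_ge[of j] \<omega>1[OF that] by (cases "q j") auto
  \<comment> \<open>Condition (iv) enters here: \<open>\<omega> j / r\<close> is at most the integer
    \<open>a\<close>, hence so is its ceiling.\<close>
  have qa: "q j \<le> a" if "j \<in> J" for j
  proof -
    have "r * q j < r * Suc a" using q_le[of j] \<omega>ar[OF that] r by (simp add: algebra_simps)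
    then have "q j < Suc a" by (simp only: mult_less_cancel1)
    then show ?thesis by simp
  qed
  \<comment> \<open>Rounding up adds at most \<open>r - 1\<close> to \<open>r * q j\<close> in each
    colour, \<open>k * (r - 1)\<close> in all, and \<open>k_le\<close> bounds this total. What is
    then left of \<open>2 * k * a\<close> is at least \<open>l * (a * (a - 1))\<close>, twice the
    number \<open>S\<close> of edges inside a part, so the capacities \<open>a - q j\<close>
    suffice.\<close>
  have q_sum: "2 * (\<Sum>j\<in>J. q j) \<le> m * a * a * (p + r - 1)"
  proof -
    have "r * (2 * (\<Sum>j\<in>J. q j)) = 2 * (\<Sum>j\<in>J. r * q j)"
      by (simp add: sum_distrib_left mult.left_commute)
    also have "\<dots> \<le> 2 * (\<Sum>j\<in>J. \<omega> j + (r - 1))"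
      using q_le r by (intro mult_left_mono sum_mono) auto
    also have "\<dots> = 2 * (\<Sum>j\<in>J. \<omega> j) + 2 * k * (r - 1)"
      by (simp add: sum.distrib cJ algebra_simps)
    also have "\<dots> \<le> p * a * (m * a * r) + r * (m * a * a) * (r - 1)"
      unfolding \<omega>_sum using k_le by (intro add_left_mono mult_right_mono) auto
    also have "\<dots> = r * (m * a * a * (p + r - 1))"
      using r by (cases r) (simp_all add: algebra_simps)
    finally show ?thesis using r by simp
  qed
  define S where "S = l * (a * (a - 1)) div 2"
  have S: "2 * S = l * (a * (a - 1))"
  proof -
    have "even (a * (a - 1))" using a by (cases "even a") auto
    then show ?thesis by (simp add: S_def)
  qed
  have "2 * S \<le> 2 * (\<Sum>j\<in>J. a - q j)"
  proof -
    have "(\<Sum>j\<in>J. a - q j) = (\<Sum>j\<in>J. a) - (\<Sum>j\<in>J. q j)"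
      using qa by (intro sum_subtractf_nat) auto
    then have "2 * (\<Sum>j\<in>J. a - q j) = 2 * k * a - 2 * (\<Sum>j\<in>J. q j)" by (simp add: cJ diff_mult_distrib2)
    moreover have "2 * k * a = l * (a * (a - 1)) + m * a * a * (p + r - 1)"
      unfolding k by (simp add: algebra_simps)
    ultimately show ?thesis using q_sum S by linarith
  qed
  then have "S \<le> (\<Sum>j\<in>J. a - q j)" by simp
  then obtain y where y: "\<And>j. j \<in> J \<Longrightarrow> y j \<le> a - q j" and y_sum: "(\<Sum>j\<in>J. y j) = S"
    using exists_bounded_function_with_sum[OF fJ] by blast
  have ya: "y j + q j \<le> a" if "j \<in> J" for j using y[OF that] qa[OF that] by simp
  have y_lt: "y j < a" if "j \<in> J" for j using ya[OF that] q1[OF that] by simp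
  have y\<omega>: "\<omega> j \<le> r * (a - y j)" if "j \<in> J" for j
  proof -
    have "r * q j \<le> r * (a - y j)" using ya[OF that] by (intro mult_left_mono) auto
    with q_ge[of j] show ?thesis by (rule le_trans)
  qed

  \<comment> \<open>The amalgamated graph\<close>
  define u where "u = (p, 0::nat)"
  define N where "N j x z = card {e \<in> edges G. c e = j \<and> ends G e = {x, z}}" for j x z
  \<comment> \<open>The degree of \<open>u\<close> in colour \<open>j\<close> is to be
    \<open>r * (2 * (a - y j))\<close>: the \<open>2 * a * r\<close> ends at new vertices without
    the \<open>2 * y j\<close> inner ones of each part. Edges to old vertices take
    \<open>2 * \<omega> j\<close> of it; the rest are loops, destined to join different new
    parts.\<close>
  define B0 where "B0 j x z = (if x = u then if z = u then 2 * (r * (a - y j) - \<omega> j) else 2 - dg j z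
      else if z = u then 2 - dg j x else N j x z)" for j x z
  have uV: "u \<notin> V" by (simp add: u_def V_def)
  have B0_simps: "B0 j u u = 2 * (r * (a - y j) - \<omega> j)"
    "x \<in> V \<Longrightarrow> B0 j u x = 2 - dg j x" "x \<in> V \<Longrightarrow> B0 j x u = 2 - dg j x"
    "x \<in> V \<Longrightarrow> z \<in> V \<Longrightarrow> B0 j x z = N j x z" for j x z
    using uV by (auto simp: B0_def)
  have N_sym: "N j x z = N j z x" for j x z by (simp add: N_def insert_commute)
  have N_diag: "N j x x = 0" for j x
  proof -
    have "{e \<in> edges G. c e = j \<and> ends G e = {x, x}} = {}"
      using fG by (force simp: finite_mgraph_def loopless_mgraph_def)
    then show ?thesis by (simp only: N_def card.empty)
  qed
  have N_row: "(\<Sum>z\<in>V. N j x z) = dg j x" if "x \<in> V" for j x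
  proof -
    have "dg j x = (\<Sum>z\<in>V - {x}. N j x z)"
      using mdegree_eq_sum_multiplicity[OF fH[of j], of x] that H by (simp add: dg_def N_def eG conj_assoc)
    then show ?thesis using that fV N_diag by (simp add: sum.remove)
  qed
  have row0: "(\<Sum>z\<in>insert u V. B0 j x z) = 2" if "j \<in> J" "x \<in> V" for j x
  proof -
    have "(\<Sum>z\<in>insert u V. B0 j x z) = (2 - dg j x) + (\<Sum>z\<in>V. N j x z)"
      using fV uV that by (simp add: B0_simps)
    then show ?thesis using N_row dg2 that by simp
  qed
  have free: "(\<Sum>z\<in>V. 2 - dg j z) = 2 * \<omega> j" if "j \<in> J" for j
  proof -
    have "(\<Sum>z\<in>V. 2 - dg j z) = (\<Sum>z\<in>V. 2) - (\<Sum>z\<in>V. dg j z)"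
      using dg2[OF that] by (intro sum_subtractf_nat) auto
    then show ?thesis using dg_sum[OF that] by (simp add: cV)
  qed
  have row0u: "(\<Sum>z\<in>insert u V. B0 j u z) = r * (2 * (a - y j))" if "j \<in> J" for j
  proof -
    have "(\<Sum>z\<in>insert u V. B0 j u z) = 2 * (r * (a - y j) - \<omega> j) + 2 * \<omega> j"
      using fV uV free[OF that] by (simp add: B0_simps)
    then show ?thesis using y\<omega>[OF that] by simp
  qed
  have sym0: "B0 j x z = B0 j z x" for j x z by (simp add: B0_def N_sym)
  have sys0: "even_system J (insert u V) B0"
    unfolding even_system_def
  proof (intro conjI ballI)
    show "finite J" by (rule fJ)
    show "finite (insert u V)" using fV by simp
    show "B0 j x z = B0 j z x" for j x z by (rule sym0)
    show "even (B0 j x x)" for j x by (simp add: B0_def N_diag)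
    show "even (\<Sum>z\<in>insert u V. B0 j x z)" if "j \<in> J" "x \<in> insert u V" for j x
      using row0[OF that(1), of x] row0u[OF that(1)] that(2) by (cases "x = u") auto
    show "connected_on (B0 j) (insert u V)" if j: "j \<in> J" for j
    proof (rule connected_onI)
      let ?R = "linked (B0 j) (insert u V)"
      show "sym ?R" using sym0 by (auto simp: sym_def linked_def)
      have "adjacency (H j) \<subseteq> ?R"
      proof (rule subrelI)
        fix x z assume "(x, z) \<in> adjacency (H j)"
        then obtain e where e: "x \<in> V" "z \<in> V" "e \<in> edges G" "c e = j" "ends G e = {x, z}"
          by (auto simp: adjacency_def H eG)
        have "finite {e \<in> edges G. c e = j \<and> ends G e = {x, z}}"
          using fG by (simp add: finite_mgraph_def)
        then have "0 < N j x z" using e unfolding N_def by (subst card_gt_0_iff) blast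
        then show "(x, z) \<in> ?R" using e by (simp add: linked_def B0_simps)
      qed
      then have star: "(adjacency (H j))\<^sup>* \<subseteq> ?R\<^sup>*" by (rule rtrancl_mono)
      \<comment> \<open>Each component of \<open>H j\<close> is a path, so it has a vertex of degree
        at most 1, and such a vertex is joined to \<open>u\<close>.\<close>
      show "(x, u) \<in> ?R\<^sup>*" if x: "x \<in> insert u V" for x
      proof (cases "x = u")
        case False
        then have "x \<in> V" using x by simp
        then obtain z where z: "z \<in> V" "(x, z) \<in> (adjacency (H j))\<^sup>*" "dg j z \<le> 1"
          using dg_end[OF j] by blast
        then have "(z, u) \<in> ?R" by (simp add: linked_def B0_simps)
        then show ?thesis using z(2) star by (meson rtrancl_into_rtrancl subsetD)
      qed simp
    qed
  qed

  \<comment> \<open>First round: one vertex for each new part\<close>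
  define W where "W = (\<lambda>i. (p + i, 0::nat)) ` {1..<r}"
  \<comment> \<open>\<open>U\<close> has one representative for each new part; \<open>u\<close>
    itself represents part \<open>p\<close>, and \<open>W\<close> the other \<open>r - 1\<close>
    parts.\<close>
  define U where "U = {p..<p + r} \<times> {0::nat}"
  have fW: "finite W" by (simp add: W_def)
  have cW: "Suc (card W) = r" "card W = r - 1" using r by (simp_all add: W_def card_image inj_on_def)
  have UW: "insert u W = U"
  proof (intro set_eqI iffI)
    fix x assume "x \<in> U"
    then obtain s where s: "x = (s, 0)" "p \<le> s" "s < p + r" by (auto simp: U_def)
    then show "x \<in> insert u W"
      by (cases "s = p") (auto simp: u_def W_def intro!: image_eqI[of _ _ "s - p"])
  qed (use r in \<open>auto simp: U_def u_def W_def\<close>)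
  have WV: "W \<inter> insert u V = {}" by (auto simp: W_def u_def V_def)
  have UV: "U \<inter> V = {}" by (auto simp: U_def V_def)
  have Y1: "insert u V \<union> W = V \<union> U" using UW by blast
  have Vu: "insert u V - {u} = V" using uV by blast
  have "\<exists>B1. even_system J (insert u V \<union> W) B1
    \<and> (\<forall>j\<in>J. \<forall>x\<in>insert u V - {u}. \<forall>z\<in>insert u V - {u}. B1 j x z = B0 j x z)
    \<and> (\<forall>j\<in>J. \<forall>x\<in>insert u V - {u}. (\<Sum>z\<in>insert u V \<union> W. B1 j x z) = (\<Sum>z\<in>insert u V. B0 j x z))
    \<and> (\<forall>j\<in>J. \<forall>i\<in>insert u W. (\<Sum>z\<in>insert u V \<union> W. B1 j i z) = 2 * (a - y j))
    \<and> (\<forall>x\<in>insert u V - {u}. \<forall>i\<in>insert u W. (\<Sum>j\<in>J. B1 j x i) = m * a)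
    \<and> (\<forall>i\<in>insert u W. \<forall>i'\<in>insert u W. (\<Sum>j\<in>J. B1 j i i') = (if i = i' then 0 else m * a * a))"
  proof (rule detach_vertex[OF fW sys0 _ WV])
    show "u \<in> insert u V" by simp
    show "(\<Sum>z\<in>insert u V. B0 j u z) = Suc (card W) * (2 * (a - y j))" if "j \<in> J" for j
      using row0u[OF that] unfolding cW(1) .
    show "even (2 * (a - y j)) \<and> 0 < 2 * (a - y j)" if "j \<in> J" for j
      using y_lt[OF that] by simp
    show "(\<Sum>j\<in>J. B0 j x u) = Suc (card W) * (m * a)" if "x \<in> insert u V - {u}" for x
    proof -
      have x: "x \<in> V" using that by simp
      have "(\<Sum>j\<in>J. B0 j x u) = (\<Sum>j\<in>J. 2 - dg j x)" using x by (simp add: B0_simps)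
      also have "\<dots> = (\<Sum>j\<in>J. 2) - (\<Sum>j\<in>J. dg j x)"
        using dg2 x by (intro sum_subtractf_nat) auto
      also have "\<dots> = 2 * k - D" using dg_col[OF x] by (simp add: cJ)
      finally show ?thesis unfolding cW(1) kD by (simp add: algebra_simps)
    qed
    show "(\<Sum>j\<in>J. B0 j u u) = Suc (card W) * card W * (m * a * a)"
    proof -
      \<comment> \<open>With inner edges included, the new vertices have
        \<open>r * a * (2 * k)\<close> edge ends. Taking off the edges to \<open>V\<close> and the
        inner edges leaves \<open>m * a * a\<close> for each ordered pair of different new
        parts.\<close>
      have "(\<Sum>j\<in>J. B0 j u u) + 2 * (\<Sum>j\<in>J. \<omega> j) + 2 * r * (\<Sum>j\<in>J. y j)
          = (\<Sum>j\<in>J. B0 j u u + 2 * \<omega> j + 2 * r * y j)"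
        by (simp add: sum.distrib sum_distrib_left)
      also have "\<dots> = (\<Sum>j\<in>J. 2 * (r * a))"
      proof (rule sum.cong)
        fix j assume j: "j \<in> J"
        have "B0 j u u + 2 * \<omega> j = 2 * (r * (a - y j))" using y\<omega>[OF j] by (simp add: B0_simps)
        moreover have "r * (a - y j) + r * y j = r * a"
          using y_lt[OF j] by (simp add: add_mult_distrib2[symmetric])
        ultimately show "B0 j u u + 2 * \<omega> j + 2 * r * y j = 2 * (r * a)" by simp
      qed simp
      also have "\<dots> = r * a * (2 * k)" by (simp add: cJ)
      finally have "(\<Sum>j\<in>J. B0 j u u) + p * a * (m * a * r) + r * (l * (a * (a - 1)))
          = r * a * (l * (a - 1) + m * a * (p + r - 1))"
        unfolding \<omega>_sum y_sum k S[symmetric] by simp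
      then show ?thesis unfolding cW(1) unfolding cW(2) using r by (cases r) (simp_all add: algebra_simps)
    qed
  qed
  then obtain B1 where P1: "even_system J (V \<union> U) B1
    \<and> (\<forall>j\<in>J. \<forall>x\<in>V. \<forall>z\<in>V. B1 j x z = B0 j x z)
    \<and> (\<forall>j\<in>J. \<forall>x\<in>V. (\<Sum>z\<in>V \<union> U. B1 j x z) = (\<Sum>z\<in>insert u V. B0 j x z))
    \<and> (\<forall>j\<in>J. \<forall>i\<in>U. (\<Sum>z\<in>V \<union> U. B1 j i z) = 2 * (a - y j))
    \<and> (\<forall>x\<in>V. \<forall>i\<in>U. (\<Sum>j\<in>J. B1 j x i) = m * a)
    \<and> (\<forall>i\<in>U. \<forall>i'\<in>U. (\<Sum>j\<in>J. B1 j i i') = (if i = i' then 0 else m * a * a))"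
    unfolding Y1 Vu UW by (rule exE)
  note B1 = P1[THEN conjunct1]
    P1[THEN conjunct2, THEN conjunct1, rule_format]
    P1[THEN conjunct2, THEN conjunct2, THEN conjunct1, rule_format]
    P1[THEN conjunct2, THEN conjunct2, THEN conjunct2, THEN conjunct1, rule_format]
    P1[THEN conjunct2, THEN conjunct2, THEN conjunct2, THEN conjunct2, THEN conjunct1, rule_format]
    P1[THEN conjunct2, THEN conjunct2, THEN conjunct2, THEN conjunct2, THEN conjunct2, rule_format]

  \<comment> \<open>Second round: \<open>a\<close> vertices in each new part\<close>
  define Y1 where "Y1 = V \<union> U"
  have fU: "finite U" by (simp add: U_def)
  have fY1: "finite Y1" using fV fU by (simp add: Y1_def)
  have Y1U: "Y1 - U = V" using UV by (auto simp: Y1_def)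
  \<comment> \<open>The \<open>y j\<close> inner edges of each new part come in as loops at its
    representative, counted twice. They raise its degree from \<open>2 * (a - y j)\<close> to
    \<open>2 * a\<close>, that is, 2 for each of the \<open>a\<close> pieces.\<close>
  define B2 where "B2 j x z = B1 j x z + (if x = z \<and> x \<in> U then 2 * y j else 0)" for j x z
  have row2: "(\<Sum>z\<in>Y1. B2 j x z) = (\<Sum>z\<in>Y1. B1 j x z) + (if x \<in> U then 2 * y j else 0)"
    if "x \<in> Y1" for j x
    using that fY1 by (simp add: B2_def sum.distrib)
  have row2U: "(\<Sum>z\<in>Y1. B2 j x z) = a * 2" if "j \<in> J" "x \<in> U" for j x
    using row2[of x j] B1(4)[OF that] y_lt[OF that(1)] that(2) by (simp add: Y1_def)
  have row2V: "(\<Sum>z\<in>Y1. B2 j x z) = 2" if "j \<in> J" "x \<in> V" for j x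
    using row2[of x j] B1(3)[OF that] row0[OF that] that(2) UV by (auto simp: Y1_def)
  have sys2: "even_system J Y1 B2"
    unfolding even_system_def
  proof (intro conjI ballI)
    show "finite J" "finite Y1" by (rule fJ, rule fY1)
    show "B2 j x z = B2 j z x" if "j \<in> J" "x \<in> Y1" "z \<in> Y1" for j x z
      using even_system_sym[OF B1(1) that(1), of x z] that by (auto simp: B2_def Y1_def)
    show "even (B2 j x x)" if "j \<in> J" "x \<in> Y1" for j x
      using B1(1) that by (simp add: even_system_def B2_def Y1_def)
    show "even (\<Sum>z\<in>Y1. B2 j x z)" if "j \<in> J" "x \<in> Y1" for j x
      using row2U[OF that(1), of x] row2V[OF that(1), of x] that(2) by (auto simp: Y1_def)
    show "connected_on (B2 j) Y1" if "j \<in> J" for j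
    proof -
      have "connected_on (B1 j) Y1" using B1(1) that by (simp add: even_system_def Y1_def)
      moreover have "(linked (B1 j) Y1)\<^sup>* \<subseteq> (linked (B2 j) Y1)\<^sup>*"
        by (rule rtrancl_mono) (auto simp: linked_def B2_def)
      ultimately show ?thesis by (auto simp: connected_on_def)
    qed
  qed
  define Z where "Z v = {fst v} \<times> {..<a}" for v :: "nat \<times> nat"
  define Y where "Y = {..<p + r} \<times> {..<a}"
  have YZ: "Y1 \<union> (\<Union>v\<in>U. Z v) = Y"
    using a by (force simp: Y1_def U_def Z_def V_def Y_def)
  have "\<exists>B3. even_system J (Y1 \<union> (\<Union>v\<in>U. Z v)) B3
    \<and> (\<forall>j\<in>J. \<forall>x\<in>Y1 - U. \<forall>z\<in>Y1 - U. B3 j x z = B2 j x z)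
    \<and> (\<forall>j\<in>J. \<forall>x\<in>Y1 - U. (\<Sum>z\<in>Y1 \<union> (\<Union>v\<in>U. Z v). B3 j x z) = (\<Sum>z\<in>Y1. B2 j x z))
    \<and> (\<forall>j\<in>J. \<forall>v\<in>U. \<forall>i\<in>Z v. (\<Sum>z\<in>Y1 \<union> (\<Union>v\<in>U. Z v). B3 j i z) = 2)
    \<and> (\<forall>x\<in>Y1 - U. \<forall>v\<in>U. \<forall>i\<in>Z v. (\<Sum>j\<in>J. B3 j x i) = m)
    \<and> (\<forall>v\<in>U. \<forall>v'\<in>U. \<forall>i\<in>Z v. \<forall>i'\<in>Z v'.
        (\<Sum>j\<in>J. B3 j i i') = (if v \<noteq> v' then m else if i = i' then 0 else l))"
  proof (rule detach_vertices[OF fU sys2])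
    show "U \<subseteq> Y1" by (simp add: Y1_def)
    show "card (Z v) = a \<and> Z v \<inter> Y1 = {v}" if "v \<in> U" for v
      using that a by (auto simp: Z_def Y1_def U_def V_def)
    show "Z v \<inter> Z v' = {}" if "v \<in> U" "v' \<in> U" "v \<noteq> v'" for v v'
      using that by (auto simp: Z_def U_def)
    show "0 < a" using a by simp
    show "even (2::nat) \<and> (0::nat) < 2" by simp
    show "(\<Sum>z\<in>Y1. B2 j v z) = a * 2" if "j \<in> J" "v \<in> U" for j v
      by (rule row2U[OF that])
    show "(\<Sum>j\<in>J. B2 j x v) = a * m" if "x \<in> Y1 - U" "v \<in> U" for x v
    proof -
      have x: "x \<in> V" "x \<noteq> v" using that UV unfolding Y1U by auto
      then show ?thesis using B1(5)[OF x(1) that(2)] by (simp add: B2_def mult.commute)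
    qed
    show "(\<Sum>j\<in>J. B2 j v v') = a * (a * m)" if "v \<in> U" "v' \<in> U" "v \<noteq> v'" for v v'
      using B1(6)[OF that(1,2)] that by (simp add: B2_def mult.commute mult.left_commute)
    \<comment> \<open>After the first round the representatives carry no loops, so the only loops
      are the inserted ones, \<open>S\<close> in number; \<open>2 * S\<close> is the loop entry that
      yields multiplicity \<open>l\<close> inside the part.\<close>
    show "(\<Sum>j\<in>J. B2 j v v) = a * (a - 1) * l" if "v \<in> U" for v
    proof -
      have "(\<Sum>j\<in>J. B2 j v v) = (\<Sum>j\<in>J. B1 j v v) + 2 * (\<Sum>j\<in>J. y j)"
        using that by (simp add: B2_def sum.distrib sum_distrib_left)
      also have "\<dots> = 2 * S" using B1(6)[OF that that] y_sum by simp
      finally show ?thesis using S by (simp only: mult.commute)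
    qed
  qed
  then obtain B3 where P3: "even_system J Y B3
    \<and> (\<forall>j\<in>J. \<forall>x\<in>V. \<forall>z\<in>V. B3 j x z = B2 j x z)
    \<and> (\<forall>j\<in>J. \<forall>x\<in>V. (\<Sum>z\<in>Y. B3 j x z) = (\<Sum>z\<in>Y1. B2 j x z))
    \<and> (\<forall>j\<in>J. \<forall>v\<in>U. \<forall>i\<in>Z v. (\<Sum>z\<in>Y. B3 j i z) = 2)
    \<and> (\<forall>x\<in>V. \<forall>v\<in>U. \<forall>i\<in>Z v. (\<Sum>j\<in>J. B3 j x i) = m)
    \<and> (\<forall>v\<in>U. \<forall>v'\<in>U. \<forall>i\<in>Z v. \<forall>i'\<in>Z v'.
        (\<Sum>j\<in>J. B3 j i i') = (if v \<noteq> v' then m else if i = i' then 0 else l))"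
    unfolding Y1U YZ by (rule exE)
  note B3 = P3[THEN conjunct1]
    P3[THEN conjunct2, THEN conjunct1, rule_format]
    P3[THEN conjunct2, THEN conjunct2, THEN conjunct1, rule_format]
    P3[THEN conjunct2, THEN conjunct2, THEN conjunct2, THEN conjunct1, rule_format]
    P3[THEN conjunct2, THEN conjunct2, THEN conjunct2, THEN conjunct2, THEN conjunct1, rule_format]
    P3[THEN conjunct2, THEN conjunct2, THEN conjunct2, THEN conjunct2, THEN conjunct2, rule_format]

  \<comment> \<open>Reading off degrees and multiplicities\<close>
  have outside: "(fst x, 0) \<in> U \<and> x \<in> Z (fst x, 0)" if "x \<in> Y" "x \<notin> V" for x
    using that by (auto simp: Y_def V_def U_def Z_def)
  have V_lt: "fst x < p" if "x \<in> V" for x using that by (auto simp: V_def)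
  have U_ge: "p \<le> fst x" if "x \<in> Y" "x \<notin> V" for x using that by (auto simp: Y_def V_def)
  have old3: "B3 j x z = N j x z" if "j \<in> J" "x \<in> V" "z \<in> V" for j x z
    using B3(2)[OF that] B1(2)[OF that] B0_simps(4)[of x z j] that UV by (auto simp: B2_def)
  have diag3: "B3 j x x = 0" if "j \<in> J" "x \<in> Y" for j x
  proof (cases "x \<in> V")
    case True
    then show ?thesis using old3[OF that(1) True True] N_diag by simp
  next
    case False
    then have "(\<Sum>j\<in>J. B3 j x x) = 0" using outside[OF that(2) False] B3(6)[of "(fst x, 0)" "(fst x, 0)" x x] by simp
    then show ?thesis using fJ that(1) by simp
  qed
  have new3: "(\<Sum>j\<in>J. B3 j x z) = (if fst x = fst z then l else m)"
    if xz: "x \<in> Y" "z \<in> Y" "x \<noteq> z" "\<not> (x \<in> V \<and> z \<in> V)" for x z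
  proof -
    consider "x \<in> V" "z \<notin> V" | "x \<notin> V" "z \<in> V" | "x \<notin> V" "z \<notin> V" using xz(4) by blast
    then show ?thesis
    proof cases
      case 1
      then show ?thesis using B3(5)[of x "(fst z, 0)" z] outside[OF xz(2)] V_lt[of x] U_ge[OF xz(2)] by simp
    next
      case 2
      then have "(\<Sum>j\<in>J. B3 j z x) = m" using B3(5)[of z "(fst x, 0)" x] outside[OF xz(1)] by simp
      then show ?thesis using even_system_sum_sym[OF B3(1) xz(1,2)] 2 V_lt[of z] U_ge[OF xz(1)] by simp
    next
      case 3
      then show ?thesis
        using B3(6)[of "(fst x, 0)" "(fst z, 0)" x z] outside[OF xz(1)] outside[OF xz(2)] xz(3) by simp
    qed
  qed
  have row3: "(\<Sum>z\<in>Y. B3 j x z) = 2" if "j \<in> J" "x \<in> Y" for j x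
  proof (cases "x \<in> V")
    case True
    then show ?thesis using B3(3)[OF that(1) True] row2V[OF that(1) True] by simp
  next
    case False
    then show ?thesis using B3(4)[OF that(1), of "(fst x, 0)" x] outside[OF that(2)] by simp
  qed
  have Yne: "Y \<noteq> {}" using Vne YZ by (auto simp: Y1_def)
  show ?thesis
    unfolding G_def
  proof (rule embeds_if_even_system)
    show "even_system {1..k} ({..<p + r} \<times> {..<a}) B3" using B3(1) unfolding J_def Y_def .
    show "{..<p + r} \<times> {..<a} \<noteq> {}" using Yne unfolding Y_def .
    show "(\<Sum>z\<in>{..<p + r} \<times> {..<a}. B3 j x z) = 2"
      if "j \<in> {1..k}" "x \<in> {..<p + r} \<times> {..<a}" for j x
      using row3 that unfolding J_def Y_def .
    show "B3 j x x = 0" if "j \<in> {1..k}" "x \<in> {..<p + r} \<times> {..<a}" for j x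
      using diag3 that unfolding J_def Y_def .
    show "B3 j x z = card {e \<in> edges (multi_K a p l m). c e = j \<and> ends (multi_K a p l m) e = {x, z}}"
      if "j \<in> {1..k}" "x \<in> {..<p} \<times> {..<a}" "z \<in> {..<p} \<times> {..<a}" for j x z
      using old3 that unfolding J_def V_def N_def G_def .
    show "(\<Sum>j\<in>{1..k}. B3 j x z) = (if fst x = fst z then l else m)"
      if "x \<in> {..<p + r} \<times> {..<a}" "z \<in> {..<p + r} \<times> {..<a}" "x \<noteq> z"
        "\<not> (x \<in> {..<p} \<times> {..<a} \<and> z \<in> {..<p} \<times> {..<a})" for x z
      using new3 that unfolding J_def V_def Y_def .
    show "edge_coloring k (multi_K a p l m) c" using c unfolding G_def .
  qed
qed

theorem theorem3:
  fixes a p r k lam mu :: nat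
    and c :: "(nat \<times> nat) set \<times> nat \<Rightarrow> nat"
  assumes "a > 1" and "p \<ge> 1" and "r \<ge> 1" and "k \<ge> 1" and "mu \<ge> 1" and "lam \<noteq> mu"
    and "real r \<ge> (real lam * (real a - 1) + real mu * real a * (real p - 1))
                    / (real mu * real a * (real a - 1))"
    and "edge_coloring k (multi_K a p lam mu) c"
  shows "embeds_in_hamiltonian_decomposition k (multi_K a p lam mu) c (multi_K a (p + r) lam mu)
    \<longleftrightarrow>
      real k = (real lam * (real a - 1) + real mu * real a * (real p + real r - 1)) / 2
    \<and> real lam \<le> real mu * real a * (real p + real r - 1)
    \<and> (\<forall>j\<in>{1..k}. \<forall>C\<in>components (color_subgraph (multi_K a p lam mu) c j). is_path C)
    \<and> (\<forall>j\<in>{1..k}. num_components (color_subgraph (multi_K a p lam mu) c j) \<le> a * r)"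
proof -
  \<comment> \<open>Since \<open>a\<close>, \<open>p\<close> and \<open>r\<close> are positive,
    truncated subtraction on naturals agrees with real subtraction here.\<close>
  have real_diff: "real a - 1 = real (a - 1)" "real p - 1 = real (p - 1)"
    "real p + real r - 1 = real (p + r - 1)" using assms by (simp_all add: of_nat_diff)
  have k_iff: "real k = (real lam * (real a - 1) + real mu * real a * (real p + real r - 1)) / 2
      \<longleftrightarrow> 2 * k = lam * (a - 1) + mu * a * (p + r - 1)"
  proof -
    have "real k = (real lam * (real a - 1) + real mu * real a * (real p + real r - 1)) / 2
      \<longleftrightarrow> real (2 * k) = real (lam * (a - 1) + mu * a * (p + r - 1))"
      unfolding real_diff by auto
    then show ?thesis by (simp only: of_nat_eq_iff)
  qed
  have lam_iff: "real lam \<le> real mu * real a * (real p + real r - 1) \<longleftrightarrow> lam \<le> mu * a * (p + r - 1)"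
    unfolding real_diff by (simp only: of_nat_mult[symmetric] of_nat_le_iff)
  have "0 < real mu * real a * (real a - 1)" using assms by simp
  then have "real lam * (real a - 1) + real mu * real a * (real p - 1) \<le> real r * (real mu * real a * (real a - 1))"
    using assms(7) by (simp add: pos_divide_le_eq)
  then have "real (lam * (a - 1) + mu * a * (p - 1)) \<le> real (r * (mu * a * (a - 1)))"
    unfolding real_diff by simp
  then have r_large: "lam * (a - 1) + mu * a * (p - 1) \<le> r * (mu * a * (a - 1))"
    by (simp only: of_nat_le_iff)
  show ?thesis
    unfolding k_iff lam_iff
    using embeds_necessary[OF assms(1-3), of k lam mu c]
      embeds_sufficient[OF assms(1-3) r_large assms(8)] by blast
qed

end
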